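(* The Riemann tensor $R_\nabla:\Omega\to\Omega^2\otimes_{\mathcal{B}}\Omega$ of the quantum Levi-Civita connection on the quantum projective space satisfies $$\begin{aligned}R_\nabla(\partial p)&=q^{(\alpha_s,\alpha_s)}\mathsf{E}_{23}\mathsf{T}_{1234}\mathsf{E}_{23}\,\partial p\wedge\bar\partial p\otimes\partial p+q^{(\alpha_s,\alpha_s)}\mathsf{E}_{23}\mathsf{T}_{1234}\mathsf{E}_{23}\,\bar\partial p\wedge\partial p\otimes\partial p\\&\quad-q^{(\alpha_s,\alpha_s)}q^{-(\omega_s,2\rho)}\,\partial p\wedge g_{-+}.\end{aligned}$$ This can also be written as $$\begin{aligned}R_\nabla(\partial p)&=q^{(\alpha_s,\alpha_s)}\mathsf{E}_{23}\mathsf{T}_{1234}\mathsf{E}_{23}\,\partial p\wedge\bar\partial p\otimes\partial p-\mathsf{E}_{23}\mathsf{T}_{1234}\mathsf{E}_{23}\mathsf{T}_{1234}^{-1}\,\partial p\wedge\bar\partial p\otimes\partial p\\&\quad-(1-q^{-(\alpha_s,\alpha_s)})q^{-(\omega_s,2\rho)}\wedge(g_{+-})\otimes\partial p-q^{(\alpha_s,\alpha_s)}q^{-(\omega_s,2\rho)}\,\partial p\wedge g_{-+}.\end{aligned}$$ Here $\partial p\wedge g_{-+}:=(\wedge\otimes\mathrm{id})(\partial p\otimes g_{-+})$ and $\wedge(g_{+-})\in\Omega^2$ is the image of $g_{+-}$ under $\wedge:\Omega\otimes_{\mathcal{B}}\Omega\to\Omega^2$.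
   Context: **Quantum group data.** Fix an integer $r\ge 1$, a real number $0<q<1$ and $s\in\{1,r\}$. $U_q(\mathfrak{sl}_{r+1})$ is the quantized enveloping algebra with generators $K_i^{\pm1},E_i,F_i$, $1\le i\le r$ (Klimyk–Schmüdgen conventions: $\Delta(K_i)=K_i\otimes K_i$, $\Delta(E_i)=E_i\otimes K_i+1\otimes E_i$, $\Delta(F_i)=F_i\otimes 1+K_i^{-1}\otimes F_i$; $K_i$ acts on a vector of weight $\mu$ by $q^{(\alpha_i,\mu)}$). Here $\alpha_i$ are the simple roots, $\omega_i$ the fundamental weights, $\rho=\sum_i\omega_i$, $w_0$ the longest Weyl group element, $(\cdot,\cdot)$ the invariant form with $(\alpha_i,\alpha_i)=2$. Put $a=(\alpha_s,\alpha_s)=2$, $w=(\omega_s,\omega_s)$, $m=(\omega_s,2\rho)=r$. $V(\lambda)$ is the simple type 1 module of highest weight $\lambda$, $V=V(\omega_s)$, and $V^*$ is its dual with $(Xf)(v)=f(S(X)v)$, $S$ the antipode. $\hat{R}_{X,Y}:X\otimes Y\to Y\otimes X$ is the braiding on finite-dimensional type 1 modules determined by being a module map with $\hat{R}_{V(\lambda),V(\mu)}(v\otimes u)=q^{(\lambda,w_0\mu)}u\otimes v$ for $v$ a highest weight vector of $V(\lambda)$ and $u$ a lowest weight vector of $V(\mu)$. Let $(v_i)$ be a weight basis of $V$ with weights $\lambda_i$ and dual basis $(f^i)$ of $V^*$. Define $\mathsf{E}:V^*\otimes V\to\mathbb{C}$, $\mathsf{E}(f^i\otimes v_j)=\delta_{ij}$,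 and $\mathsf{E}':V\otimes V^*\to\mathbb{C}$, $\mathsf{E}'(v_i\otimes f^j)=q^{(\lambda_i,2\rho)}\delta_{ij}$. Subscripts indicate the tensor legs on which a map acts; products of maps are compositions (rightmost first), legs being renumbered after each contraction. Put $$\mathsf{S}_{123}=(\hat{R}_{V,V^*})_{23}(\hat{R}_{V,V})_{12}(\hat{R}_{V,V^*}^{-1})_{23},\quad \tilde{\mathsf{S}}_{234}=(\hat{R}_{V,V^*})_{23}(\hat{R}_{V^*,V^*}^{-1})_{34}(\hat{R}_{V,V^*}^{-1})_{23},\quad \mathsf{T}_{1234}=\mathsf{S}_{123}\tilde{\mathsf{S}}_{234}=\tilde{\mathsf{S}}_{234}\mathsf{S}_{123}$$ (acting on $V\otimes V^*\otimes V$, $V^*\otimes V\otimes V^*$, $V\otimes V^*\otimes V\otimes V^*$ at the indicated legs). **Index-free notation.** A family $x=(x^{ij})_{1\le i,j\le r+1}$ is identified with $\sum_{i,j}v_i\otimes f^j\otimes x^{ij}$; products of families $xy$ (also $x\otimes y$, $x\wedge y$) denote $\sum v_i\otimes f^j\otimes v_k\otimes f^l\otimes x^{ij}y^{kl}$ (resp. with $\otimes_{\mathcal{B}}$, $\wedge$), and similarly for more factors. The maps above act on the $V,V^*$ legs; other maps act on components. Elements such as $g_{+-}$ below carry no legs. **Algebra and first-order calculus.** $\mathcal{B}$ is the unital algebra generated by $p^{ij}$, $1\le i,j\le r+1$, with relations $\mathsf{S}_{123}pp=q^{w}pp$, $\tilde{\mathsf{S}}_{234}pp=q^{-w}pp$,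 $\mathsf{E}'_{12}p=q^{m}$. The Heckenberger–Kolb first-order differential calculus is $\Omega=\Omega_+\oplus\Omega_-$, with $\Omega_+,\Omega_-$ generated as left $\mathcal{B}$-modules by $\partial p^{ij}$, resp. $\bar\partial p^{ij}$, with relations $$\tilde{\mathsf{S}}_{234}p\,\partial p=q^{-w}p\,\partial p,\quad \mathsf{E}'_{12}\partial p=0,\qquad \mathsf{S}_{123}p\,\bar\partial p=q^{w}p\,\bar\partial p,\quad \mathsf{E}'_{12}\bar\partial p=0,$$ right module structure $\partial p\,p=q^{a}\mathsf{T}_{1234}p\,\partial p$, $\bar\partial p\,p=q^{-a}\mathsf{T}_{1234}p\,\bar\partial p$, and differential $\mathrm{d}=\partial+\bar\partial$, where $\partial,\bar\partial:\mathcal{B}\to\Omega_\pm$ are the derivations with $p^{ij}\mapsto\partial p^{ij},\bar\partial p^{ij}$. **Universal calculus.** $\Omega^\bullet$ is the quotient of the tensor algebra $T_{\mathcal{B}}(\Omega)$ by the two-sided ideal generated by $\{\sum_i\mathrm{d}a_i\otimes\mathrm{d}b_i:\sum_i a_i\mathrm{d}b_i=0\}\subset\Omega\otimes_{\mathcal{B}}\Omega$; its product is $\wedge$, and $\mathrm{d}(a\,\mathrm{d}b)=\mathrm{d}a\wedge\mathrm{d}b$. **Metric components.** $g_{+-}=\mathsf{E}'_{12}\mathsf{E}_{23}\,\partial p\otimes\bar\partial p$ and $g_{-+}=\mathsf{E}'_{12}\mathsf{E}_{23}\,\bar\partial p\otimes\partial p$ in $\Omega\otimes_{\mathcal{B}}\Omega$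 (central elements). **Connection.** The quantum Levi-Civita connection is the (well-defined) linear map $\nabla:\Omega\to\Omega\otimes_{\mathcal{B}}\Omega$ with $\nabla(b\omega)=\mathrm{d}b\otimes\omega+b\nabla(\omega)$ for $b\in\mathcal{B}$, $\omega\in\Omega$, and $$\nabla(\partial p)=q^{a}\mathsf{E}_{23}\mathsf{T}_{1234}\,\bar\partial p\otimes\partial p-q^{a}q^{-m}\,p\,g_{-+},\qquad \nabla(\bar\partial p)=\mathsf{E}_{23}\,\partial p\otimes\bar\partial p-q^{-m}\,p\,g_{+-}.$$ **Riemann tensor.** $R_\nabla:=(\mathrm{d}\otimes\mathrm{id}-(\wedge\otimes\mathrm{id})\circ(\mathrm{id}\otimes\nabla))\circ\nabla:\Omega\to\Omega^2\otimes_{\mathcal{B}}\Omega$. *)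

theory Defs
  imports "HOL-Analysis.Analysis" "HOL-Library.Poly_Mapping"
begin

section \<open>Complex vector spaces, free objects and presentations\<close>

class complex_vector = ab_group_add +
  fixes scaleC :: "complex \<Rightarrow> 'a \<Rightarrow> 'a"  (infixr \<open>*\<^sub>C\<close> 75)
  assumes scaleC_add_right: "c *\<^sub>C (x + y) = c *\<^sub>C x + c *\<^sub>C y"
    and scaleC_add_left: "(c + d) *\<^sub>C x = c *\<^sub>C x + d *\<^sub>C x"
    and scaleC_scaleC: "c *\<^sub>C (d *\<^sub>C x) = (c * d) *\<^sub>C x"
    and scaleC_one: "1 *\<^sub>C x = x"

global_interpretation complex_vector:
  vector_space "scaleC :: complex \<Rightarrow> 'a \<Rightarrow> 'a::complex_vector"
  by unfold_locales (simp_all add: scaleC_add_right scaleC_add_left scaleC_scaleC scaleC_one)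

class complex_algebra_1 = complex_vector + ring_1 +
  assumes mult_scaleC_left: "(c *\<^sub>C x) * y = c *\<^sub>C (x * y)"
    and mult_scaleC_right: "x * (c *\<^sub>C y) = c *\<^sub>C (x * y)"

instantiation complex :: complex_algebra_1
begin
definition scaleC_complex :: "complex \<Rightarrow> complex \<Rightarrow> complex" where "scaleC_complex c x = c * x"
instance by standard (simp_all add: scaleC_complex_def algebra_simps)
end

instantiation poly_mapping :: (type, complex_vector) complex_vector
begin
definition scaleC_poly_mapping :: "complex \<Rightarrow> ('a \<Rightarrow>\<^sub>0 'b) \<Rightarrow> ('a \<Rightarrow>\<^sub>0 'b)"
  where "scaleC_poly_mapping c = Poly_Mapping.map (\<lambda>x. c *\<^sub>C x)"
instance
proof
  have lookup_scaleC: "Poly_Mapping.lookup (c *\<^sub>C x) k = c *\<^sub>C Poly_Mapping.lookup x k"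
    for c and x :: "'a \<Rightarrow>\<^sub>0 'b" and k
    by (simp add: scaleC_poly_mapping_def Poly_Mapping.map.rep_eq when_def)
  fix c d :: complex and x y :: "'a \<Rightarrow>\<^sub>0 'b"
  show "c *\<^sub>C (x + y) = c *\<^sub>C x + c *\<^sub>C y"
    by (rule poly_mapping_eqI) (simp add: lookup_scaleC lookup_add scaleC_add_right)
  show "(c + d) *\<^sub>C x = c *\<^sub>C x + d *\<^sub>C x"
    by (rule poly_mapping_eqI) (simp add: lookup_scaleC lookup_add scaleC_add_left)
  show "c *\<^sub>C (d *\<^sub>C x) = (c * d) *\<^sub>C x"
    by (rule poly_mapping_eqI) (simp add: lookup_scaleC scaleC_scaleC)
  show "1 *\<^sub>C x = x"
    by (rule poly_mapping_eqI) (simp add: lookup_scaleC scaleC_one)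
qed
end

text \<open>The free complex vector space on \<open>'g\<close> is \<open>'g \<Rightarrow>\<^sub>0 complex\<close>; \<open>free_eval f\<close> is the linear
  extension of \<open>f\<close>.\<close>

definition free_eval :: "('g \<Rightarrow> 'm::complex_vector) \<Rightarrow> ('g \<Rightarrow>\<^sub>0 complex) \<Rightarrow> 'm" where
  "free_eval f x = (\<Sum>g\<in>Poly_Mapping.keys x. Poly_Mapping.lookup x g *\<^sub>C f g)"

text \<open>If the elements \<open>e g\<close> span, \<open>lin_lift e f\<close> is the linear map with \<open>e g \<mapsto> f g\<close>, whenever such
  a map exists (then the choice of the preimage does not matter).\<close>

definition lin_lift :: "('g \<Rightarrow> 'm::complex_vector) \<Rightarrow> ('g \<Rightarrow> 'k::complex_vector) \<Rightarrow> 'm \<Rightarrow> 'k" where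
  "lin_lift e f y = free_eval f (SOME x. free_eval e x = y)"

text \<open>The free unital algebra on \<open>'g\<close> is the monoid algebra \<open>'g fword \<Rightarrow>\<^sub>0 complex\<close> of the free
  monoid of words; the multiplication is the convolution of \<^theory>\<open>HOL-Library.Poly_Mapping\<close>.\<close>

datatype 'g fword = Word (letters: "'g list")

instantiation fword :: (type) monoid_add
begin
definition zero_fword :: "'a fword" where "zero_fword = Word []"
definition plus_fword :: "'a fword \<Rightarrow> 'a fword \<Rightarrow> 'a fword"
  where "plus_fword u v = Word (letters u @ letters v)"
instance by standard (simp_all add: zero_fword_def plus_fword_def)
end

definition alg_eval :: "('g \<Rightarrow> 'b::complex_algebra_1) \<Rightarrow> ('g fword \<Rightarrow>\<^sub>0 complex) \<Rightarrow> 'b" where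
  "alg_eval p = free_eval (\<lambda>u. prod_list (map p (letters u)))"

definition two_sided_ideal :: "'a::ring_1 set \<Rightarrow> 'a set" where
  "two_sided_ideal A = \<Inter>{J. A \<subseteq> J \<and> 0 \<in> J \<and> (\<forall>x\<in>J. \<forall>y\<in>J. x + y \<in> J)
      \<and> (\<forall>a. \<forall>x\<in>J. a * x \<in> J \<and> x * a \<in> J)}"

text \<open>The type \<open>'b\<close> is the unital algebra with generators \<open>p g\<close> and defining relators \<open>A\<close>.\<close>

definition presented_algebra ::
    "('g \<Rightarrow> 'b::complex_algebra_1) \<Rightarrow> ('g fword \<Rightarrow>\<^sub>0 complex) set \<Rightarrow> bool" where
  "presented_algebra p A \<longleftrightarrow>
     surj (alg_eval p) \<and> {x. alg_eval p x = 0} = two_sided_ideal A"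

text \<open>The free left \<open>'b\<close>-module on \<open>'g\<close> is \<open>'g \<Rightarrow>\<^sub>0 'b\<close>.\<close>

definition free_lmult :: "'b::ring_1 \<Rightarrow> ('g \<Rightarrow>\<^sub>0 'b) \<Rightarrow> ('g \<Rightarrow>\<^sub>0 'b)" where
  "free_lmult b = Poly_Mapping.map (\<lambda>x. b * x)"

definition module_eval ::
    "('b::ring_1 \<Rightarrow> 'm::ab_group_add \<Rightarrow> 'm) \<Rightarrow> ('g \<Rightarrow> 'm) \<Rightarrow> ('g \<Rightarrow>\<^sub>0 'b) \<Rightarrow> 'm" where
  "module_eval la f x = (\<Sum>g\<in>Poly_Mapping.keys x. la (Poly_Mapping.lookup x g) (f g))"

definition left_submodule :: "('g \<Rightarrow>\<^sub>0 'b::ring_1) set \<Rightarrow> ('g \<Rightarrow>\<^sub>0 'b) set" where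
  "left_submodule A = \<Inter>{N. A \<subseteq> N \<and> 0 \<in> N \<and> (\<forall>x\<in>N. \<forall>y\<in>N. x + y \<in> N)
      \<and> (\<forall>b. \<forall>x\<in>N. free_lmult b x \<in> N)}"

text \<open>The submodule \<open>M\<close> is the left module with generators \<open>f g\<close> and defining relators \<open>A\<close>.\<close>

definition presented_left_module ::
    "('b::ring_1 \<Rightarrow> 'm::ab_group_add \<Rightarrow> 'm) \<Rightarrow> 'm set \<Rightarrow> ('g \<Rightarrow> 'm) \<Rightarrow> ('g \<Rightarrow>\<^sub>0 'b) set \<Rightarrow> bool" where
  "presented_left_module la M f A \<longleftrightarrow>
     range (module_eval la f) = M \<and> {x. module_eval la f x = 0} = left_submodule A"

definition bimodule ::
    "('b::complex_algebra_1 \<Rightarrow> 'm::complex_vector \<Rightarrow> 'm) \<Rightarrow> ('m \<Rightarrow> 'b \<Rightarrow> 'm) \<Rightarrow> bool" where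
  "bimodule la ra \<longleftrightarrow>
     (\<forall>b. Vector_Spaces.linear scaleC scaleC (la b)) \<and>
     (\<forall>m. Vector_Spaces.linear scaleC scaleC (\<lambda>b. la b m)) \<and>
     (\<forall>b. Vector_Spaces.linear scaleC scaleC (\<lambda>m. ra m b)) \<and>
     (\<forall>m. Vector_Spaces.linear scaleC scaleC (ra m)) \<and>
     (\<forall>m. la 1 m = m \<and> ra m 1 = m) \<and>
     (\<forall>a b m. la (a * b) m = la a (la b m)) \<and>
     (\<forall>a b m. ra m (a * b) = ra (ra m a) b) \<and>
     (\<forall>a b m. ra (la a m) b = la a (ra m b))"

text \<open>\<open>'t\<close> with \<open>tn\<close> is the tensor product over \<open>'b\<close> of the right module \<open>'m\<close> and the left module
  \<open>'k\<close>: the free vector space on pairs, modulo bilinearity and balancedness.\<close>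

definition balanced_relators ::
    "('m::complex_vector \<Rightarrow> 'b \<Rightarrow> 'm) \<Rightarrow> ('b \<Rightarrow> 'k::complex_vector \<Rightarrow> 'k) \<Rightarrow> ('m \<times> 'k \<Rightarrow>\<^sub>0 complex) set" where
  "balanced_relators ra la =
     {Poly_Mapping.single (x + y, z) 1 - Poly_Mapping.single (x, z) 1 - Poly_Mapping.single (y, z) 1 | x y z. True} \<union>
     {Poly_Mapping.single (x, y + z) 1 - Poly_Mapping.single (x, y) 1 - Poly_Mapping.single (x, z) 1 | x y z. True} \<union>
     {Poly_Mapping.single (c *\<^sub>C x, y) 1 - Poly_Mapping.single (x, y) c | c x y. True} \<union>
     {Poly_Mapping.single (x, c *\<^sub>C y) 1 - Poly_Mapping.single (x, y) c | c x y. True} \<union>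
     {Poly_Mapping.single (ra x b, y) 1 - Poly_Mapping.single (x, la b y) 1 | x b y. True}"

definition is_tensor_product ::
    "('m::complex_vector \<Rightarrow> 'b \<Rightarrow> 'm) \<Rightarrow> ('b \<Rightarrow> 'k::complex_vector \<Rightarrow> 'k) \<Rightarrow>
     ('m \<Rightarrow> 'k \<Rightarrow> 't::complex_vector) \<Rightarrow> bool" where
  "is_tensor_product ra la tn \<longleftrightarrow>
     surj (free_eval (case_prod tn)) \<and>
     {x. free_eval (case_prod tn) x = 0} = complex_vector.span (balanced_relators ra la)"

section \<open>Weights of \<open>sl\<close>\<close>

text \<open>Weights are realised as functions on the coordinates \<open>1, \<dots>, r + 1\<close> with coordinate sum \<open>0\<close>;
  the invariant form is the standard scalar product.\<close>

type_synonym weight = "nat \<Rightarrow> real"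

definition wform :: "nat \<Rightarrow> weight \<Rightarrow> weight \<Rightarrow> real" where
  "wform r l m = (\<Sum>k = 1..r+1. l k * m k)"

definition simple_root :: "nat \<Rightarrow> weight" where
  "simple_root i = (\<lambda>k. if k = i then 1 else if k = i + 1 then - 1 else 0)"

definition fundamental_weight :: "nat \<Rightarrow> nat \<Rightarrow> weight" where
  "fundamental_weight r i = (\<lambda>k. if k \<in> {1..r+1}
     then (if k \<le> i then 1 else 0) - real i / real (r + 1) else 0)"

definition weight_lattice :: "nat \<Rightarrow> weight set" where
  "weight_lattice r =
     {\<lambda>k. \<Sum>i = 1..r. of_int (c i) * fundamental_weight r i k | c :: nat \<Rightarrow> int. True}"

definition two_rho :: "nat \<Rightarrow> weight" where
  "two_rho r = (\<lambda>k. 2 * (\<Sum>i = 1..r. fundamental_weight r i k))"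

text \<open>The longest element of the symmetric group reverses the coordinates.\<close>

definition longest :: "nat \<Rightarrow> weight \<Rightarrow> weight" where
  "longest r l = (\<lambda>k. if k \<in> {1..r+1} then l (r + 2 - k) else 0)"

definition qpow :: "real \<Rightarrow> real \<Rightarrow> complex" where
  "qpow q x = complex_of_real (q powr x)"

section \<open>Modules over the quantized enveloping algebra\<close>

text \<open>A module on \<open>complex ^ 'i\<close> is given by the matrices of the generators; the column index
  is the input.\<close>

record 'i uq_action =
  actK :: "nat \<Rightarrow> complex ^ 'i ^ 'i"
  actE :: "nat \<Rightarrow> complex ^ 'i ^ 'i"
  actF :: "nat \<Rightarrow> complex ^ 'i ^ 'i"

definition uq_module :: "nat \<Rightarrow> real \<Rightarrow> 'i::finite uq_action \<Rightarrow> bool" where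
  "uq_module r q X \<longleftrightarrow>
    (let K = actK X; E = actE X; F = actF X;
         cartan = (\<lambda>i j. wform r (simple_root i) (simple_root j)) in
     (\<forall>i\<in>{1..r}. invertible (K i)) \<and>
     (\<forall>i\<in>{1..r}. \<forall>j\<in>{1..r}.
        K i ** K j = K j ** K i \<and>
        K i ** E j ** matrix_inv (K i) = (q powr cartan i j) *\<^sub>R E j \<and>
        K i ** F j ** matrix_inv (K i) = (q powr (- cartan i j)) *\<^sub>R F j \<and>
        E i ** F j - F j ** E i =
          (if i = j then inverse (q - inverse q) *\<^sub>R (K i - matrix_inv (K i)) else 0) \<and>
        (cartan i j = 0 \<longrightarrow> E i ** E j = E j ** E i \<and> F i ** F j = F j ** F i) \<and>
        (cartan i j = - 1 \<longrightarrow>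
           E i ** E i ** E j - (q + inverse q) *\<^sub>R (E i ** E j ** E i) + E j ** E i ** E i = 0 \<and>
           F i ** F i ** F j - (q + inverse q) *\<^sub>R (F i ** F j ** F i) + F j ** F i ** F i = 0)))"

definition weight_vector :: "nat \<Rightarrow> real \<Rightarrow> 'i::finite uq_action \<Rightarrow> weight \<Rightarrow> complex ^ 'i \<Rightarrow> bool" where
  "weight_vector r q X m v \<longleftrightarrow> v \<noteq> 0 \<and>
     (\<forall>i\<in>{1..r}. actK X i *v v = qpow q (wform r (simple_root i) m) *s v)"

definition highest_weight_vector ::
    "nat \<Rightarrow> real \<Rightarrow> 'i::finite uq_action \<Rightarrow> weight \<Rightarrow> complex ^ 'i \<Rightarrow> bool" where
  "highest_weight_vector r q X m v \<longleftrightarrow> weight_vector r q X m v \<and> (\<forall>i\<in>{1..r}. actE X i *v v = 0)"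

definition lowest_weight_vector ::
    "nat \<Rightarrow> real \<Rightarrow> 'i::finite uq_action \<Rightarrow> weight \<Rightarrow> complex ^ 'i \<Rightarrow> bool" where
  "lowest_weight_vector r q X m v \<longleftrightarrow> weight_vector r q X m v \<and> (\<forall>i\<in>{1..r}. actF X i *v v = 0)"

definition simple_module :: "nat \<Rightarrow> 'i::finite uq_action \<Rightarrow> bool" where
  "simple_module r X \<longleftrightarrow>
     (\<forall>W. vec.subspace W \<and>
          (\<forall>i\<in>{1..r}. \<forall>v\<in>W. actK X i *v v \<in> W \<and> matrix_inv (actK X i) *v v \<in> W \<and>
                          actE X i *v v \<in> W \<and> actF X i *v v \<in> W)
        \<longrightarrow> W = {0} \<or> W = UNIV)"

text \<open>\<open>X\<close> is (a copy of) \<open>V(m)\<close>. It is of type 1 because the highest weight lies in the weight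
  lattice and the \<open>K i\<close> act on the highest weight vector by positive powers of \<open>q\<close>, without signs.\<close>

definition is_simple_type1 :: "nat \<Rightarrow> real \<Rightarrow> 'i::finite uq_action \<Rightarrow> weight \<Rightarrow> bool" where
  "is_simple_type1 r q X m \<longleftrightarrow> uq_module r q X \<and> simple_module r X \<and> m \<in> weight_lattice r \<and>
     (\<exists>v. highest_weight_vector r q X m v)"

definition kron :: "complex ^ 'i ^ 'i \<Rightarrow> complex ^ 'j ^ 'j \<Rightarrow> complex ^ ('i \<times> 'j) ^ ('i \<times> 'j)" where
  "kron A B = (\<chi> x y. A $ fst x $ fst y * B $ snd x $ snd y)"

definition vtensor :: "complex ^ 'i \<Rightarrow> complex ^ 'j \<Rightarrow> complex ^ ('i \<times> 'j)" where
  "vtensor v u = (\<chi> x. v $ fst x * u $ snd x)"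

text \<open>Coproduct: \<open>K \<mapsto> K \<otimes> K\<close>, \<open>E \<mapsto> E \<otimes> K + 1 \<otimes> E\<close>, \<open>F \<mapsto> F \<otimes> 1 + K\<inverse> \<otimes> F\<close>.\<close>

definition tensor_action :: "'i::finite uq_action \<Rightarrow> 'j::finite uq_action \<Rightarrow> ('i \<times> 'j) uq_action" where
  "tensor_action X Y = \<lparr>
     actK = (\<lambda>i. kron (actK X i) (actK Y i)),
     actE = (\<lambda>i. kron (actE X i) (actK Y i) + kron (mat 1) (actE Y i)),
     actF = (\<lambda>i. kron (actF X i) (mat 1) + kron (matrix_inv (actK X i)) (actF Y i))\<rparr>"

text \<open>The dual module in the dual basis. The antipode for the above coproduct is \<open>K \<mapsto> K\<inverse>\<close>,
  \<open>E \<mapsto> - E K\<inverse>\<close>, \<open>F \<mapsto> - K F\<close>.\<close>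

definition dual_action :: "'i::finite uq_action \<Rightarrow> 'i uq_action" where
  "dual_action X = \<lparr>
     actK = (\<lambda>i. transpose (matrix_inv (actK X i))),
     actE = (\<lambda>i. transpose (- (actE X i ** matrix_inv (actK X i)))),
     actF = (\<lambda>i. transpose (- (actK X i ** actF X i)))\<rparr>"

definition module_map ::
    "nat \<Rightarrow> 'i::finite uq_action \<Rightarrow> 'j::finite uq_action \<Rightarrow> complex ^ 'i ^ 'j \<Rightarrow> bool" where
  "module_map r X Y M \<longleftrightarrow> (\<forall>i\<in>{1..r}.
     M ** actK X i = actK Y i ** M \<and> M ** actE X i = actE Y i ** M \<and> M ** actF X i = actF Y i ** M)"

text \<open>Only the case of simple \<open>X = V(l)\<close> and \<open>Y = V(m)\<close> is used. There the value on the tensor of a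
  highest and a lowest weight vector determines the module map; \<open>longest r m\<close> is the lowest weight
  of \<open>V(m)\<close>.\<close>

definition braiding ::
    "nat \<Rightarrow> real \<Rightarrow> 'i::finite uq_action \<Rightarrow> 'j::finite uq_action \<Rightarrow> complex ^ ('i \<times> 'j) ^ ('j \<times> 'i)" where
  "braiding r q X Y = (THE M.
     module_map r (tensor_action X Y) (tensor_action Y X) M \<and>
     (\<forall>l m v u. is_simple_type1 r q X l \<and> is_simple_type1 r q Y m \<and>
        highest_weight_vector r q X l v \<and> lowest_weight_vector r q Y (longest r m) u \<longrightarrow>
        M *v vtensor v u = qpow q (wform r l (longest r m)) *s vtensor u v))"

section \<open>Index-free notation\<close>

text \<open>A tensor with \<open>k\<close> legs and coefficients in \<open>'m\<close> is a function on index lists of length \<open>k\<close>,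
  the list \<open>[i1, \<dots>, ik]\<close> giving the coefficient of the corresponding tensor of basis vectors
  (of \<open>V\<close> or the dual, as the leg requires). Legs are numbered from 1.\<close>

definition fam1 :: "('n \<Rightarrow> 'n \<Rightarrow> 'm) \<Rightarrow> 'n list \<Rightarrow> 'm" where
  "fam1 x I = x (I ! 0) (I ! 1)"

definition fam2 :: "('a \<Rightarrow> 'b \<Rightarrow> 'm) \<Rightarrow> ('n \<Rightarrow> 'n \<Rightarrow> 'a) \<Rightarrow> ('n \<Rightarrow> 'n \<Rightarrow> 'b) \<Rightarrow> 'n list \<Rightarrow> 'm" where
  "fam2 f x y I = f (x (I ! 0) (I ! 1)) (y (I ! 2) (I ! 3))"

definition fam3 :: "('a \<Rightarrow> 'b \<Rightarrow> 'c \<Rightarrow> 'm) \<Rightarrow> ('n \<Rightarrow> 'n \<Rightarrow> 'a) \<Rightarrow> ('n \<Rightarrow> 'n \<Rightarrow> 'b) \<Rightarrow>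
    ('n \<Rightarrow> 'n \<Rightarrow> 'c) \<Rightarrow> 'n list \<Rightarrow> 'm" where
  "fam3 f x y z I = f (x (I ! 0) (I ! 1)) (y (I ! 2) (I ! 3)) (z (I ! 4) (I ! 5))"

text \<open>A map on the legs \<open>k, k + 1\<close>, given by its matrix.\<close>

definition on_legs :: "nat \<Rightarrow> complex ^ ('n \<times> 'n) ^ ('n \<times> 'n) \<Rightarrow>
    ('n::finite list \<Rightarrow> 'm::complex_vector) \<Rightarrow> 'n list \<Rightarrow> 'm" where
  "on_legs k A x I = (\<Sum>(a, b)\<in>UNIV.
     A $ (I ! (k - 1), I ! k) $ (a, b) *\<^sub>C x (I[k - 1 := a, k := b]))"

text \<open>A bilinear form contracting the legs \<open>k, k + 1\<close>.\<close>

definition contract :: "nat \<Rightarrow> ('n \<Rightarrow> 'n \<Rightarrow> complex) \<Rightarrow>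
    ('n::finite list \<Rightarrow> 'm::complex_vector) \<Rightarrow> 'n list \<Rightarrow> 'm" where
  "contract k B x I = (\<Sum>(a, b)\<in>UNIV. B a b *\<^sub>C x (take (k - 1) I @ [a, b] @ drop (k - 1) I))"

definition evE :: "'n \<Rightarrow> 'n \<Rightarrow> complex" where
  "evE i j = (if i = j then 1 else 0)"

definition evE' :: "nat \<Rightarrow> real \<Rightarrow> ('n \<Rightarrow> weight) \<Rightarrow> 'n \<Rightarrow> 'n \<Rightarrow> complex" where
  "evE' r q wt i j = (if i = j then qpow q (wform r (wt i) (two_rho r)) else 0)"

definition S123 :: "nat \<Rightarrow> real \<Rightarrow> 'n::finite uq_action \<Rightarrow>
    ('n list \<Rightarrow> 'm::complex_vector) \<Rightarrow> 'n list \<Rightarrow> 'm" where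
  "S123 r q V x =
     on_legs 2 (braiding r q V (dual_action V))
       (on_legs 1 (braiding r q V V)
         (on_legs 2 (matrix_inv (braiding r q V (dual_action V))) x))"

definition tildeS234 :: "nat \<Rightarrow> real \<Rightarrow> 'n::finite uq_action \<Rightarrow>
    ('n list \<Rightarrow> 'm::complex_vector) \<Rightarrow> 'n list \<Rightarrow> 'm" where
  "tildeS234 r q V x =
     on_legs 2 (braiding r q V (dual_action V))
       (on_legs 3 (matrix_inv (braiding r q (dual_action V) (dual_action V)))
         (on_legs 2 (matrix_inv (braiding r q V (dual_action V))) x))"

definition T1234 :: "nat \<Rightarrow> real \<Rightarrow> 'n::finite uq_action \<Rightarrow>
    ('n list \<Rightarrow> 'm::complex_vector) \<Rightarrow> 'n list \<Rightarrow> 'm" where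
  "T1234 r q V x = S123 r q V (tildeS234 r q V x)"

text \<open>The inverse of \<open>T1234\<close>: the inverses of the six factors, composed in reverse order.\<close>

definition T1234_inv :: "nat \<Rightarrow> real \<Rightarrow> 'n::finite uq_action \<Rightarrow>
    ('n list \<Rightarrow> 'm::complex_vector) \<Rightarrow> 'n list \<Rightarrow> 'm" where
  "T1234_inv r q V x =
     (let R = braiding r q V (dual_action V);
          S_inv = (\<lambda>y. on_legs 2 R (on_legs 1 (matrix_inv (braiding r q V V))
                     (on_legs 2 (matrix_inv R) y)));
          tildeS_inv = (\<lambda>y. on_legs 2 R (on_legs 3 (braiding r q (dual_action V) (dual_action V))
                     (on_legs 2 (matrix_inv R) y)))
      in tildeS_inv (S_inv x))"

section \<open>The algebra, the calculus and the connection\<close>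

text \<open>Algebras, modules and tensor products are whole types, characterised up to isomorphism by the
  exact presentations in \<open>is_quantum_projective_calculus\<close> below.
  The data: the generators of the algebra \<open>'b\<close>; the bimodule \<open>'o\<close> of one-forms with the two
  derivations; its tensor square \<open>'t\<close>; the quotient map from \<open>'t\<close> to the two-forms \<open>'w\<close>; the tensor
  product \<open>'u\<close> of two-forms and one-forms.\<close>

record ('n, 'b, 'o, 't, 'w, 'u) calculus =
  pgen :: "'n \<Rightarrow> 'n \<Rightarrow> 'b"
  lmul :: "'b \<Rightarrow> 'o \<Rightarrow> 'o"
  rmul :: "'o \<Rightarrow> 'b \<Rightarrow> 'o"
  del :: "'b \<Rightarrow> 'o"
  delbar :: "'b \<Rightarrow> 'o"
  tens :: "'o \<Rightarrow> 'o \<Rightarrow> 't"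
  wedge_map :: "'t \<Rightarrow> 'w"
  wtens :: "'w \<Rightarrow> 'o \<Rightarrow> 'u"

definition dp :: "('n, 'b, 'o, 't, 'w, 'u) calculus \<Rightarrow> 'n \<Rightarrow> 'n \<Rightarrow> 'o" where
  "dp C i j = del C (pgen C i j)"

definition dbp :: "('n, 'b, 'o, 't, 'w, 'u) calculus \<Rightarrow> 'n \<Rightarrow> 'n \<Rightarrow> 'o" where
  "dbp C i j = delbar C (pgen C i j)"

definition dif :: "('n, 'b, 'o::complex_vector, 't, 'w, 'u) calculus \<Rightarrow> 'b \<Rightarrow> 'o" where
  "dif C b = del C b + delbar C b"

definition wedge :: "('n, 'b, 'o, 't, 'w, 'u) calculus \<Rightarrow> 'o \<Rightarrow> 'o \<Rightarrow> 'w" where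
  "wedge C x y = wedge_map C (tens C x y)"

definition B_relators :: "nat \<Rightarrow> nat \<Rightarrow> real \<Rightarrow> 'n::finite uq_action \<Rightarrow> ('n \<Rightarrow> weight) \<Rightarrow>
    (('n \<times> 'n) fword \<Rightarrow>\<^sub>0 complex) set" where
  "B_relators r s q V wt =
     (let om = fundamental_weight r s; w = wform r om om; m = wform r om (two_rho r);
          P = (\<lambda>i j. Poly_Mapping.single (Word [(i, j)]) 1); PP = fam2 (*) P P in
      {S123 r q V PP I - qpow q w *\<^sub>C PP I | I. length I = 4} \<union>
      {tildeS234 r q V PP I - qpow q (- w) *\<^sub>C PP I | I. length I = 4} \<union>
      {contract 1 (evE' r q wt) (fam1 P) [] - qpow q m *\<^sub>C 1})"

definition Omega_relators :: "nat \<Rightarrow> real \<Rightarrow> ('n \<Rightarrow> weight) \<Rightarrow> ('n::finite \<Rightarrow> 'n \<Rightarrow> 'b) \<Rightarrow>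
    (('n list \<Rightarrow> ('n \<times> 'n \<Rightarrow>\<^sub>0 'b)) \<Rightarrow> 'n list \<Rightarrow> ('n \<times> 'n \<Rightarrow>\<^sub>0 'b::complex_algebra_1)) \<Rightarrow>
    complex \<Rightarrow> ('n \<times> 'n \<Rightarrow>\<^sub>0 'b) set" where
  "Omega_relators r q wt p Z c =
     (let e = (\<lambda>i j. Poly_Mapping.single (i, j) 1); pe = fam2 free_lmult p e in
      {Z pe I - c *\<^sub>C pe I | I. length I = 4} \<union> {contract 1 (evE' r q wt) (fam1 e) []})"

definition derivation ::
    "('b::complex_algebra_1 \<Rightarrow> 'o::complex_vector \<Rightarrow> 'o) \<Rightarrow> ('o \<Rightarrow> 'b \<Rightarrow> 'o) \<Rightarrow> ('b \<Rightarrow> 'o) \<Rightarrow> bool" where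
  "derivation la ra D \<longleftrightarrow> Vector_Spaces.linear scaleC scaleC D \<and>
     (\<forall>a b. D (a * b) = ra (D a) b + la a (D b))"

definition is_fodc :: "nat \<Rightarrow> nat \<Rightarrow> real \<Rightarrow> 'n::finite uq_action \<Rightarrow> ('n \<Rightarrow> weight) \<Rightarrow>
    ('n, 'b::complex_algebra_1, 'o::complex_vector, 't, 'w, 'u) calculus \<Rightarrow> bool" where
  "is_fodc r s q V wt C \<longleftrightarrow>
    (let al = simple_root s; om = fundamental_weight r s; a = wform r al al; w = wform r om om;
         p = pgen C; T = T1234 r q V in
     bimodule (lmul C) (rmul C) \<and>
     (\<exists>Mp Mm.
        presented_left_module (lmul C) Mp (case_prod (dp C))
          (Omega_relators r q wt p (tildeS234 r q V) (qpow q (- w))) \<and>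
        presented_left_module (lmul C) Mm (case_prod (dbp C))
          (Omega_relators r q wt p (S123 r q V) (qpow q w)) \<and>
        Mp \<inter> Mm = {0} \<and> (\<forall>x. \<exists>y\<in>Mp. \<exists>z\<in>Mm. x = y + z) \<and>
        range (del C) \<subseteq> Mp \<and> range (delbar C) \<subseteq> Mm) \<and>
     (\<forall>i j k l. rmul C (dp C i j) (p k l) = qpow q a *\<^sub>C T (fam2 (lmul C) p (dp C)) [i, j, k, l]) \<and>
     (\<forall>i j k l. rmul C (dbp C i j) (p k l) = qpow q (- a) *\<^sub>C T (fam2 (lmul C) p (dbp C)) [i, j, k, l]) \<and>
     derivation (lmul C) (rmul C) (del C) \<and>
     derivation (lmul C) (rmul C) (delbar C))"

text \<open>The bimodule structures induced on the tensor square and on the two-forms.\<close>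

definition tlmul :: "('n, 'b, 'o::complex_vector, 't::complex_vector, 'w, 'u) calculus \<Rightarrow> 'b \<Rightarrow> 't \<Rightarrow> 't" where
  "tlmul C b = lin_lift (\<lambda>(x, y). tens C x y) (\<lambda>(x, y). tens C (lmul C b x) y)"

definition trmul :: "('n, 'b, 'o::complex_vector, 't::complex_vector, 'w, 'u) calculus \<Rightarrow> 't \<Rightarrow> 'b \<Rightarrow> 't" where
  "trmul C t b = lin_lift (\<lambda>(x, y). tens C x y) (\<lambda>(x, y). tens C x (rmul C y b)) t"

definition wrmul :: "('n, 'b, 'o::complex_vector, 't::complex_vector, 'w::complex_vector, 'u) calculus \<Rightarrow>
    'w \<Rightarrow> 'b \<Rightarrow> 'w" where
  "wrmul C z b = lin_lift (\<lambda>(x, y). wedge C x y) (\<lambda>(x, y). wedge C x (rmul C y b)) z"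

text \<open>The degree-two part of the ideal of the tensor algebra that defines the universal calculus:
  the ideal is generated in degree two, so this is the sub-bimodule generated by the elements
  \<open>\<Sum>i. d (a i) \<otimes> d (b i)\<close> with \<open>(\<Sum>i. a i d (b i)) = 0\<close>.\<close>

definition universal_relators ::
    "('n, 'b, 'o::complex_vector, 't::complex_vector, 'w, 'u) calculus \<Rightarrow> 't set" where
  "universal_relators C = {free_eval (\<lambda>(a, b). tens C (dif C a) (dif C b)) x | x.
     free_eval (\<lambda>(a, b). lmul C a (dif C b)) x = 0}"

definition universal_kernel ::
    "('n, 'b, 'o::complex_vector, 't::complex_vector, 'w, 'u) calculus \<Rightarrow> 't set" where
  "universal_kernel C = \<Inter>{N. universal_relators C \<subseteq> N \<and> complex_vector.subspace N \<and>
     (\<forall>b. \<forall>t\<in>N. tlmul C b t \<in> N \<and> trmul C t b \<in> N)}"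

definition is_quantum_projective_calculus ::
    "nat \<Rightarrow> nat \<Rightarrow> real \<Rightarrow> 'n::finite uq_action \<Rightarrow> ('n \<Rightarrow> weight) \<Rightarrow>
     ('n, 'b::complex_algebra_1, 'o::complex_vector, 't::complex_vector, 'w::complex_vector,
      'u::complex_vector) calculus \<Rightarrow> bool" where
  "is_quantum_projective_calculus r s q V wt C \<longleftrightarrow>
     presented_algebra (case_prod (pgen C)) (B_relators r s q V wt) \<and>
     is_fodc r s q V wt C \<and>
     is_tensor_product (rmul C) (lmul C) (tens C) \<and>
     Vector_Spaces.linear scaleC scaleC (wedge_map C) \<and> surj (wedge_map C) \<and>
     {t. wedge_map C t = 0} = universal_kernel C \<and>
     is_tensor_product (wrmul C) (lmul C) (wtens C)"

text \<open>The differential \<open>a db \<mapsto> da \<and> db\<close> on one-forms.\<close>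

definition dform :: "('n, 'b, 'o::complex_vector, 't, 'w::complex_vector, 'u) calculus \<Rightarrow> 'o \<Rightarrow> 'w" where
  "dform C = lin_lift (\<lambda>(a, b). lmul C a (dif C b)) (\<lambda>(a, b). wedge C (dif C a) (dif C b))"

text \<open>\<open>wedge_id C x t\<close> is the image of \<open>x \<otimes> t\<close> under \<open>\<and> \<otimes> id\<close>.\<close>

definition wedge_id :: "('n, 'b, 'o::complex_vector, 't::complex_vector, 'w, 'u::complex_vector) calculus \<Rightarrow>
    'o \<Rightarrow> 't \<Rightarrow> 'u" where
  "wedge_id C x = lin_lift (\<lambda>(y, z). tens C y z) (\<lambda>(y, z). wtens C (wedge C x y) z)"

definition g_pm :: "nat \<Rightarrow> real \<Rightarrow> ('n::finite \<Rightarrow> weight) \<Rightarrow>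
    ('n, 'b, 'o, 't::complex_vector, 'w, 'u) calculus \<Rightarrow> 't" where
  "g_pm r q wt C = contract 1 (evE' r q wt) (contract 2 evE (fam2 (tens C) (dp C) (dbp C))) []"

definition g_mp :: "nat \<Rightarrow> real \<Rightarrow> ('n::finite \<Rightarrow> weight) \<Rightarrow>
    ('n, 'b, 'o, 't::complex_vector, 'w, 'u) calculus \<Rightarrow> 't" where
  "g_mp r q wt C = contract 1 (evE' r q wt) (contract 2 evE (fam2 (tens C) (dbp C) (dp C))) []"

definition is_levi_civita :: "nat \<Rightarrow> nat \<Rightarrow> real \<Rightarrow> 'n::finite uq_action \<Rightarrow> ('n \<Rightarrow> weight) \<Rightarrow>
    ('n, 'b, 'o::complex_vector, 't::complex_vector, 'w, 'u) calculus \<Rightarrow> ('o \<Rightarrow> 't) \<Rightarrow> bool" where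
  "is_levi_civita r s q V wt C nab \<longleftrightarrow>
    (let a = wform r (simple_root s) (simple_root s);
         m = wform r (fundamental_weight r s) (two_rho r) in
     Vector_Spaces.linear scaleC scaleC nab \<and>
     (\<forall>b x. nab (lmul C b x) = tens C (dif C b) x + tlmul C b (nab x)) \<and>
     (\<forall>i j. nab (dp C i j) =
        qpow q a *\<^sub>C contract 2 evE (T1234 r q V (fam2 (tens C) (dbp C) (dp C))) [i, j]
        - (qpow q a * qpow q (- m)) *\<^sub>C tlmul C (pgen C i j) (g_mp r q wt C)) \<and>
     (\<forall>i j. nab (dbp C i j) =
        contract 2 evE (fam2 (tens C) (dp C) (dbp C)) [i, j]
        - qpow q (- m) *\<^sub>C tlmul C (pgen C i j) (g_pm r q wt C)))"

text \<open>Neither \<open>d \<otimes> id\<close> nor \<open>id \<otimes> \<nabla>\<close> descends to the tensor product over the algebra by itself; the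
  difference does.\<close>

definition riemann :: "('n, 'b, 'o::complex_vector, 't::complex_vector, 'w::complex_vector,
    'u::complex_vector) calculus \<Rightarrow> ('o \<Rightarrow> 't) \<Rightarrow> 'o \<Rightarrow> 'u" where
  "riemann C nab x =
     lin_lift (\<lambda>(y, z). tens C y z)
       (\<lambda>(y, z). wtens C (dform C y) z - wedge_id C y (nab z)) (nab x)"

end

theory Submission imports Defs begin

text \<open>
  Write \<open>x = \<partial>p\<close> and \<open>y = \<partial>'p\<close> for the holomorphic and the antiholomorphic half of \<open>dp\<close>, and \<open>t = q\<^sup>2\<close>.  A word of families
  such as \<open>y x\<close> has legs \<open>v f v f\<close>.  Moving the inner \<open>f\<close> past the inner \<open>v\<close> by the inverse of
  the mixed braiding, called \<open>K\<close> below, flattens the legs to \<open>v v f f\<close>, and then every operation in the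
  statement is a pair of commuting Hecke operators, one on the \<open>v\<close> legs and one on the \<open>f\<close> legs, possibly
  followed by the quantum trace of the two middle legs: that trace alone is \<open>E\<^sub>2\<^sub>3\<close>;
  preceded by \<open>R\<inverse>\<close> on the first two legs it is \<open>E'\<^sub>1\<^sub>2\<close>, preceded by \<open>R\<inverse>\<close> on the last two it is the
  trace over legs 3 and 4, and \<open>E\<^sub>2\<^sub>3 T\<close> has \<open>R\<close> on the first and \<open>R\<inverse>\<close> on the last two, which the Hecke relation relates to the previous ones
  (lemmas \<open>mulL_flat\<close>, \<open>tr1_flat\<close>, \<open>tr2_flat\<close>, \<open>mulL_TL\<close>).  So there are two
  products of families, the matrix product (\<open>mulL\<close>) and an opposite one with \<open>R\<inverse>\<close> on both pairs (\<open>omulL\<close>), which is associative as well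
  by the braid relations (\<open>omulL_assoc\<close>).

  The relations of the calculus say that the flattened words \<open>p x\<close> and \<open>p y\<close> are fixed by a Hecke operator.
  Evaluated through the two products they become \<open>p x = 0\<close>, \<open>x p = x\<close>, \<open>p y = y\<close>, \<open>y p = 0\<close> and the
  mirror rules for the opposite product.  Hence \<open>x x = 0\<close> and \<open>y y = 0\<close>, and \<open>x\<close>, \<open>y\<close> are
  combinations of terms \<open>a db\<close>, so that the universal differential is defined on all one-forms.  The
  same symmetry applied to \<open>p y x\<close> and \<open>p x y\<close> gives the rank one identities: the product \<open>y x\<close> is
  \<open>p\<close> times its trace \<open>G y x\<close>, a multiple of the metric component without free legs, and
  \<open>E\<^sub>2\<^sub>3 T\<inverse> x y = p (G x y)\<close> (\<open>mul_yx\<close>, \<open>mul_Ti_xy\<close>).  Both traces commute with \<open>p\<close>, and their images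
  in two-forms are opposite to each other, because the trace of \<open>dx = - (x \<wedge> y + y \<wedge> x)\<close> vanishes together
  with that of \<open>x\<close>.

  Let \<open>L\<close> be the map \<open>d \<otimes> id - (\<wedge> \<otimes> id)(id \<otimes> \<nabla>)\<close>, so that the Riemann tensor is \<open>L \<nabla>\<close>.  Since
  \<open>dy\<close> is the product \<open>x \<wedge> y + y \<wedge> x\<close>, applying \<open>L\<close> to \<open>y \<otimes> x\<close> yields the two cubic words of the statement
  together with \<open>y \<wedge> \<nabla>x\<close>; the traces of all these terms vanish, so \<open>L\<close> kills \<open>G y x\<close> (\<open>rlift_G\<close>).  In
  \<open>L(p G) = dp \<wedge> G + p L(G)\<close> there remain \<open>x \<wedge> G\<close>, which is the last term of the formula, and \<open>y \<wedge> G\<close>, which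
  cancels exactly the contribution of \<open>y \<wedge> \<nabla>x\<close> under \<open>E\<^sub>2\<^sub>3 T\<close> (\<open>riemann_x\<close>).  The second formula follows
  because rank one turns both \<open>E\<^sub>2\<^sub>3 T E\<^sub>2\<^sub>3\<close> of \<open>y \<wedge> x \<otimes> x\<close> and the term with \<open>T\<inverse>\<close> into
  multiples of \<open>\<wedge>(g\<^sub>+\<^sub>-) \<otimes> x\<close>.

  All this needs the Hecke relation, the braid relation and a few identities for the quantum trace, collected in the locale
  \<open>braided_legs\<close>.  They hold because the braidings can be computed: \<open>V\<close> has one-dimensional weight
  spaces lined up in a chain by the operators \<open>E\<^sub>i\<close> and \<open>F\<^sub>i\<close> (\<open>simple_module_chain\<close>), so a module map out of a
  tensor product of two chains is determined by its value on (highest) \<open>\<otimes>\<close> (lowest) (\<open>module_map_zero\<close>), and it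
  suffices to exhibit the well-known R-matrix of type A and its partial transpose as module maps
  (\<open>braidings_explicit\<close>).
\<close>

section \<open>Operators and traces on tensor legs\<close>

text \<open>
  A tensor is a function on index assignments: \<open>f k\<close> is the index in leg \<open>k\<close>, and legs beyond the ones in use
  are simply ignored.  Assignments on all of \<open>nat\<close> instead of lists make operators on far-apart legs commute
  without length conditions, which keeps the later equational reasoning unconditional.
\<close>

definition opL :: "nat \<Rightarrow> complex ^ ('n::finite \<times> 'n) ^ ('n \<times> 'n) \<Rightarrow>
    ((nat \<Rightarrow> 'n) \<Rightarrow> 'm::complex_vector) \<Rightarrow> (nat \<Rightarrow> 'n) \<Rightarrow> 'm" where
  "opL k A z f = (\<Sum>a\<in>UNIV. \<Sum>b\<in>UNIV. A $ (f k, f (Suc k)) $ (a, b) *\<^sub>C z (f(k := a, Suc k := b)))"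

text \<open>
  The assignment that has the index \<open>a\<close> in two new adjacent legs \<open>k\<close>, \<open>k + 1\<close>; later legs move up by two.
\<close>

definition plug :: "nat \<Rightarrow> 'n \<Rightarrow> (nat \<Rightarrow> 'n) \<Rightarrow> nat \<Rightarrow> 'n" where
  "plug k a f = (\<lambda>j. if j < k then f j else if j \<le> Suc k then a else f (j - 2))"

definition ctr :: "nat \<Rightarrow> ('n::finite \<Rightarrow> complex) \<Rightarrow>
    ((nat \<Rightarrow> 'n) \<Rightarrow> 'm::complex_vector) \<Rightarrow> (nat \<Rightarrow> 'n) \<Rightarrow> 'm" where
  "ctr k w z f = (\<Sum>a\<in>UNIV. w a *\<^sub>C z (plug k a f))"

lemma scaleC_sum_right: "c *\<^sub>C (\<Sum>i\<in>A. x i) = (\<Sum>i\<in>A. c *\<^sub>C (x i :: 'm::complex_vector))"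
  by (rule complex_vector.scale_sum_right)
lemma scaleC_sum_left: "(\<Sum>i\<in>A. c i) *\<^sub>C x = (\<Sum>i\<in>A. c i *\<^sub>C (x :: 'm::complex_vector))"
  by (rule complex_vector.scale_sum_left)

lemma opL_lincomb:
  "opL k A (\<lambda>f. \<alpha> *\<^sub>C z f + \<beta> *\<^sub>C z' f) = (\<lambda>f. \<alpha> *\<^sub>C opL k A z f + \<beta> *\<^sub>C opL k A z' f)"
  by (rule ext) (simp add: opL_def scaleC_add_right scaleC_scaleC sum.distrib scaleC_sum_right mult.commute)

lemma ctr_lincomb:
  "ctr k w (\<lambda>f. \<alpha> *\<^sub>C z f + \<beta> *\<^sub>C z' f) = (\<lambda>f. \<alpha> *\<^sub>C ctr k w z f + \<beta> *\<^sub>C ctr k w z' f)"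
  by (rule ext) (simp add: ctr_def scaleC_add_right scaleC_scaleC sum.distrib scaleC_sum_right mult.commute)

lemma opL_scale: "opL k A (\<lambda>f. \<alpha> *\<^sub>C z f) = (\<lambda>f. \<alpha> *\<^sub>C opL k A z f)"
  by (rule ext) (simp add: opL_def scaleC_scaleC scaleC_sum_right mult.commute)
lemma ctr_weight_scale: "ctr k (\<lambda>a. \<alpha> * w a) z f = \<alpha> *\<^sub>C ctr k w z f"
  by (simp add: ctr_def scaleC_scaleC scaleC_sum_right)

lemma sum_pair_UNIV: "(\<Sum>x\<in>(UNIV::('a::finite \<times> 'b::finite) set). g x) = (\<Sum>a\<in>UNIV. \<Sum>b\<in>UNIV. g (a, b))"
  by (simp add: sum.cartesian_product)

lemma sum3_swap: "(\<Sum>a\<in>A. \<Sum>b\<in>B. \<Sum>c\<in>C. g a b c) = (\<Sum>c\<in>C. \<Sum>a\<in>A. \<Sum>b\<in>B. g a b c)"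
proof -
  have "(\<Sum>a\<in>A. \<Sum>b\<in>B. \<Sum>c\<in>C. g a b c) = (\<Sum>a\<in>A. \<Sum>c\<in>C. \<Sum>b\<in>B. g a b c)"
    by (intro sum.cong refl) (rule sum.swap)
  also have "\<dots> = (\<Sum>c\<in>C. \<Sum>a\<in>A. \<Sum>b\<in>B. g a b c)"
    by (rule sum.swap)
  finally show ?thesis .
qed

lemma sum4_swap: "(\<Sum>a\<in>A. \<Sum>b\<in>B. \<Sum>c\<in>C. \<Sum>d\<in>D. g a b c d) = (\<Sum>c\<in>C. \<Sum>d\<in>D. \<Sum>a\<in>A. \<Sum>b\<in>B. g a b c d)"
proof -
  have "(\<Sum>a\<in>A. \<Sum>b\<in>B. \<Sum>c\<in>C. \<Sum>d\<in>D. g a b c d) = (\<Sum>c\<in>C. \<Sum>a\<in>A. \<Sum>b\<in>B. \<Sum>d\<in>D. g a b c d)"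
    by (rule sum3_swap)
  also have "\<dots> = (\<Sum>c\<in>C. \<Sum>d\<in>D. \<Sum>a\<in>A. \<Sum>b\<in>B. g a b c d)"
    by (intro sum.cong refl) (rule sum3_swap)
  finally show ?thesis .
qed

lemma opL_opL_same:
  fixes z :: "(nat \<Rightarrow> 'n::finite) \<Rightarrow> 'm::complex_vector"
  shows "opL k A (opL k B z) = opL k (A ** B) z"
proof (rule ext)
  fix f :: "nat \<Rightarrow> 'n"
  have "opL k A (opL k B z) f = (\<Sum>a\<in>UNIV. \<Sum>b\<in>UNIV. \<Sum>c\<in>UNIV. \<Sum>d\<in>UNIV.
      (A $ (f k, f (Suc k)) $ (a, b) * B $ (a, b) $ (c, d)) *\<^sub>C z (f(k := c, Suc k := d)))"
    by (simp add: opL_def scaleC_sum_right scaleC_scaleC fun_upd_twist)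
  also have "\<dots> = (\<Sum>c\<in>UNIV. \<Sum>d\<in>UNIV. \<Sum>a\<in>UNIV. \<Sum>b\<in>UNIV.
      (A $ (f k, f (Suc k)) $ (a, b) * B $ (a, b) $ (c, d)) *\<^sub>C z (f(k := c, Suc k := d)))"
    by (rule sum4_swap)
  also have "\<dots> = opL k (A ** B) z f"
    by (simp add: opL_def matrix_matrix_mult_def scaleC_sum_left sum_pair_UNIV)
  finally show "opL k A (opL k B z) f = opL k (A ** B) z f" .
qed

lemma opL_mat1 [simp]:
  fixes z :: "(nat \<Rightarrow> 'n::finite) \<Rightarrow> 'm::complex_vector"
  shows "opL k (mat 1) z = z"
proof (rule ext)
  fix f :: "nat \<Rightarrow> 'n"
  have "opL k (mat 1) z f = (\<Sum>a\<in>UNIV. \<Sum>b\<in>UNIV. if a = f k \<and> b = f (Suc k) then z (f(k := a, Suc k := b)) else 0)"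
    unfolding opL_def by (intro sum.cong refl) (auto simp: mat_def scaleC_one)
  also have "\<dots> = (\<Sum>a\<in>UNIV. if a = f k then z (f(k := a)) else 0)"
    by (intro sum.cong refl) (auto simp: sum.delta)
  also have "\<dots> = z f" by (simp add: sum.delta)
  finally show "opL k (mat 1) z f = z f" .
qed

lemma opL_matrix_lincomb:
  fixes z :: "(nat \<Rightarrow> 'n::finite) \<Rightarrow> 'm::complex_vector"
  assumes "\<And>x y. A $ x $ y = \<alpha> * B $ x $ y + \<beta> * (if x = y then 1 else 0)"
  shows "opL k A z = (\<lambda>f. \<alpha> *\<^sub>C opL k B z f + \<beta> *\<^sub>C z f)"
proof (rule ext)
  fix f :: "nat \<Rightarrow> 'n"
  have "opL k A z f = \<alpha> *\<^sub>C opL k B z f + \<beta> *\<^sub>C opL k (mat 1) z f"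
    unfolding opL_def assms
    by (simp add: mat_def scaleC_add_left sum.distrib scaleC_scaleC scaleC_sum_right)
  then show "opL k A z f = \<alpha> *\<^sub>C opL k B z f + \<beta> *\<^sub>C z f" by simp
qed

text \<open>
  With \<open>opL_ctr_below\<close>, \<open>opL_ctr_above\<close> and \<open>ctr_ctr\<close> below, this is the interchange law: operations on disjoint
  legs commute, up to the renumbering caused by a contraction.
\<close>

lemma opL_commute:
  fixes z :: "(nat \<Rightarrow> 'n::finite) \<Rightarrow> 'm::complex_vector"
  assumes "Suc j < k"
  shows "opL j A (opL k B z) = opL k B (opL j A z)"
proof (rule ext)
  fix f :: "nat \<Rightarrow> 'n"
  have *: "f(j := a, Suc j := b, k := c, Suc k := d) = f(k := c, Suc k := d, j := a, Suc j := b)" for a b c d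
    using assms by (auto simp: fun_eq_iff)
  have "opL j A (opL k B z) f = (\<Sum>a\<in>UNIV. \<Sum>b\<in>UNIV. \<Sum>c\<in>UNIV. \<Sum>d\<in>UNIV.
      (A $ (f j, f (Suc j)) $ (a, b) * B $ (f k, f (Suc k)) $ (c, d)) *\<^sub>C z (f(k := c, Suc k := d, j := a, Suc j := b)))"
    using assms by (simp add: opL_def scaleC_sum_right scaleC_scaleC *)
  also have "\<dots> = (\<Sum>c\<in>UNIV. \<Sum>d\<in>UNIV. \<Sum>a\<in>UNIV. \<Sum>b\<in>UNIV.
      (A $ (f j, f (Suc j)) $ (a, b) * B $ (f k, f (Suc k)) $ (c, d)) *\<^sub>C z (f(k := c, Suc k := d, j := a, Suc j := b)))"
    by (rule sum4_swap)
  also have "\<dots> = opL k B (opL j A z) f"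
    using assms by (simp add: opL_def scaleC_sum_right scaleC_scaleC mult.commute)
  finally show "opL j A (opL k B z) f = opL k B (opL j A z) f" .
qed

lemma plug_upd_below: "j < k \<Longrightarrow> plug k a (f(j := b)) = (plug k a f)(j := b)"
  by (auto simp: plug_def fun_eq_iff)
lemma plug_upd_above: "k \<le> j \<Longrightarrow> plug k a (f(j := b)) = (plug k a f)(Suc (Suc j) := b)"
  by (auto simp: plug_def fun_eq_iff)
lemma plug_apply:
  "j < k \<Longrightarrow> plug k a f j = f j" "plug k a f k = a" "plug k a f (Suc k) = a"
  "k \<le> j \<Longrightarrow> plug k a f (Suc (Suc j)) = f j"
  by (auto simp: plug_def)

lemma opL_ctr_below:
  fixes z :: "(nat \<Rightarrow> 'n::finite) \<Rightarrow> 'm::complex_vector"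
  assumes "Suc j < k"
  shows "opL j A (ctr k w z) = ctr k w (opL j A z)"
proof (rule ext)
  fix f :: "nat \<Rightarrow> 'n"
  have "opL j A (ctr k w z) f = (\<Sum>a\<in>UNIV. \<Sum>b\<in>UNIV. \<Sum>c\<in>UNIV.
      (A $ (f j, f (Suc j)) $ (a, b) * w c) *\<^sub>C z ((plug k c f)(j := a, Suc j := b)))"
    using assms by (simp add: opL_def ctr_def scaleC_sum_right scaleC_scaleC plug_upd_below)
  also have "\<dots> = (\<Sum>c\<in>UNIV. \<Sum>a\<in>UNIV. \<Sum>b\<in>UNIV.
      (A $ (f j, f (Suc j)) $ (a, b) * w c) *\<^sub>C z ((plug k c f)(j := a, Suc j := b)))"
    by (rule sum3_swap)
  also have "\<dots> = ctr k w (opL j A z) f"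
    using assms by (simp add: opL_def ctr_def scaleC_sum_right scaleC_scaleC plug_apply mult.commute)
  finally show "opL j A (ctr k w z) f = ctr k w (opL j A z) f" .
qed

lemma opL_ctr_above:
  fixes z :: "(nat \<Rightarrow> 'n::finite) \<Rightarrow> 'm::complex_vector"
  assumes "k \<le> j"
  shows "opL j A (ctr k w z) = ctr k w (opL (Suc (Suc j)) A z)"
proof (rule ext)
  fix f :: "nat \<Rightarrow> 'n"
  have "opL j A (ctr k w z) f = (\<Sum>a\<in>UNIV. \<Sum>b\<in>UNIV. \<Sum>c\<in>UNIV.
      (A $ (f j, f (Suc j)) $ (a, b) * w c) *\<^sub>C z ((plug k c f)(Suc (Suc j) := a, Suc (Suc (Suc j)) := b)))"
    using assms by (simp add: opL_def ctr_def scaleC_sum_right scaleC_scaleC plug_upd_above)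
  also have "\<dots> = (\<Sum>c\<in>UNIV. \<Sum>a\<in>UNIV. \<Sum>b\<in>UNIV.
      (A $ (f j, f (Suc j)) $ (a, b) * w c) *\<^sub>C z ((plug k c f)(Suc (Suc j) := a, Suc (Suc (Suc j)) := b)))"
    by (rule sum3_swap)
  also have "\<dots> = ctr k w (opL (Suc (Suc j)) A z) f"
    using assms by (simp add: opL_def ctr_def scaleC_sum_right scaleC_scaleC plug_apply mult.commute)
  finally show "opL j A (ctr k w z) f = ctr k w (opL (Suc (Suc j)) A z) f" .
qed

lemma plug_plug: "j \<le> k \<Longrightarrow> plug (Suc (Suc k)) b (plug j a f) = plug j a (plug k b f)"
  by (auto simp: plug_def fun_eq_iff less_diff_conv Suc_diff_le numeral_2_eq_2)

lemma ctr_ctr: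
  assumes "j \<le> k"
  shows "ctr j w (ctr (Suc (Suc k)) w' z) = ctr k w' (ctr j w z)"
proof (rule ext)
  fix f
  show "ctr j w (ctr (Suc (Suc k)) w' z) f = ctr k w' (ctr j w z) f"
    using assms
    by (simp add: ctr_def plug_plug scaleC_sum_right scaleC_scaleC mult.commute) (rule sum.swap)
qed

text \<open>
  The matrix entries of the two sides of a braid relation on three legs.  Comparing
  entries instead of operators lets the mixed braid relations be read off from the one for \<open>R\<close> by renaming indices.
\<close>

definition braid_left where
  "braid_left A B C = (\<lambda>i j k a b c. \<Sum>u\<in>UNIV. \<Sum>v\<in>UNIV. \<Sum>w\<in>UNIV.
     A $ (i, j) $ (u, v) * B $ (v, k) $ (w, c) * C $ (u, w) $ (a, b) :: complex)"

definition braid_right where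
  "braid_right A B C = (\<lambda>i j k a b c. \<Sum>u\<in>UNIV. \<Sum>v\<in>UNIV. \<Sum>w\<in>UNIV.
     A $ (j, k) $ (u, v) * B $ (i, u) $ (a, w) * C $ (w, v) $ (b, c) :: complex)"

lemma sum6_swap: "(\<Sum>a\<in>A. \<Sum>b\<in>B. \<Sum>c\<in>C. \<Sum>u\<in>U. \<Sum>v\<in>V. \<Sum>w\<in>W. g a b c u v w)
   = (\<Sum>u\<in>U. \<Sum>v\<in>V. \<Sum>w\<in>W. \<Sum>a\<in>A. \<Sum>b\<in>B. \<Sum>c\<in>C. g a b c u v w)"
proof -
  have "(\<Sum>a\<in>A. \<Sum>b\<in>B. \<Sum>c\<in>C. \<Sum>u\<in>U. \<Sum>v\<in>V. \<Sum>w\<in>W. g a b c u v w)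
      = (\<Sum>a\<in>A. \<Sum>u\<in>U. \<Sum>v\<in>V. \<Sum>b\<in>B. \<Sum>c\<in>C. \<Sum>w\<in>W. g a b c u v w)"
    by (intro sum.cong refl) (rule sum4_swap)
  also have "\<dots> = (\<Sum>u\<in>U. \<Sum>v\<in>V. \<Sum>a\<in>A. \<Sum>b\<in>B. \<Sum>c\<in>C. \<Sum>w\<in>W. g a b c u v w)"
    by (subst sum.swap, intro sum.cong refl) (rule sum.swap)
  also have "\<dots> = (\<Sum>u\<in>U. \<Sum>v\<in>V. \<Sum>w\<in>W. \<Sum>a\<in>A. \<Sum>b\<in>B. \<Sum>c\<in>C. g a b c u v w)"
    by (intro sum.cong refl) (rule trans[OF sum.cong[OF refl sum3_swap] sum.swap])
  finally show ?thesis .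
qed

lemma opL_braid_left:
  fixes z :: "(nat \<Rightarrow> 'n::finite) \<Rightarrow> 'm::complex_vector"
  shows "opL k A (opL (Suc k) B (opL k C z)) f =
    (\<Sum>a\<in>UNIV. \<Sum>b\<in>UNIV. \<Sum>c\<in>UNIV. braid_left A B C (f k) (f (Suc k)) (f (Suc (Suc k))) a b c *\<^sub>C
       z (f(k := a, Suc k := b, Suc (Suc k) := c)))"
proof -
  have upd: "f(Suc (Suc k) := c, k := a, Suc k := b) = f(k := a, Suc k := b, Suc (Suc k) := c)" for a b c
    by (auto simp: fun_eq_iff)
  have "opL k A (opL (Suc k) B (opL k C z)) f =
     (\<Sum>u\<in>UNIV. \<Sum>v\<in>UNIV. \<Sum>w\<in>UNIV. \<Sum>c\<in>UNIV. \<Sum>a\<in>UNIV. \<Sum>b\<in>UNIV.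
       (A $ (f k, f (Suc k)) $ (u, v) * B $ (v, f (Suc (Suc k))) $ (w, c) * C $ (u, w) $ (a, b)) *\<^sub>C
       z (f(k := a, Suc k := b, Suc (Suc k) := c)))"
    by (simp add: opL_def scaleC_sum_right scaleC_scaleC upd mult.assoc)
  also have "\<dots> = (\<Sum>u\<in>UNIV. \<Sum>v\<in>UNIV. \<Sum>w\<in>UNIV. \<Sum>a\<in>UNIV. \<Sum>b\<in>UNIV. \<Sum>c\<in>UNIV.
       (A $ (f k, f (Suc k)) $ (u, v) * B $ (v, f (Suc (Suc k))) $ (w, c) * C $ (u, w) $ (a, b)) *\<^sub>C
       z (f(k := a, Suc k := b, Suc (Suc k) := c)))"
    by (rule sum.cong[OF refl], rule sum.cong[OF refl], rule sum.cong[OF refl], rule sum3_swap[symmetric])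
  also have "\<dots> = (\<Sum>a\<in>UNIV. \<Sum>b\<in>UNIV. \<Sum>c\<in>UNIV. \<Sum>u\<in>UNIV. \<Sum>v\<in>UNIV. \<Sum>w\<in>UNIV.
       (A $ (f k, f (Suc k)) $ (u, v) * B $ (v, f (Suc (Suc k))) $ (w, c) * C $ (u, w) $ (a, b)) *\<^sub>C
       z (f(k := a, Suc k := b, Suc (Suc k) := c)))"
    by (rule sum6_swap)
  finally show ?thesis by (simp add: braid_left_def scaleC_sum_left)
qed

lemma opL_braid_right:
  fixes z :: "(nat \<Rightarrow> 'n::finite) \<Rightarrow> 'm::complex_vector"
  shows "opL (Suc k) A (opL k B (opL (Suc k) C z)) f =
    (\<Sum>a\<in>UNIV. \<Sum>b\<in>UNIV. \<Sum>c\<in>UNIV. braid_right A B C (f k) (f (Suc k)) (f (Suc (Suc k))) a b c *\<^sub>C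
       z (f(k := a, Suc k := b, Suc (Suc k) := c)))"
proof -
  have "opL (Suc k) A (opL k B (opL (Suc k) C z)) f =
     (\<Sum>u\<in>UNIV. \<Sum>v\<in>UNIV. \<Sum>a\<in>UNIV. \<Sum>w\<in>UNIV. \<Sum>b\<in>UNIV. \<Sum>c\<in>UNIV.
       (A $ (f (Suc k), f (Suc (Suc k))) $ (u, v) * B $ (f k, u) $ (a, w) * C $ (w, v) $ (b, c)) *\<^sub>C
       z (f(k := a, Suc k := b, Suc (Suc k) := c)))"
    by (simp add: opL_def scaleC_sum_right scaleC_scaleC mult.assoc)
  also have "\<dots> = (\<Sum>u\<in>UNIV. \<Sum>v\<in>UNIV. \<Sum>w\<in>UNIV. \<Sum>a\<in>UNIV. \<Sum>b\<in>UNIV. \<Sum>c\<in>UNIV.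
       (A $ (f (Suc k), f (Suc (Suc k))) $ (u, v) * B $ (f k, u) $ (a, w) * C $ (w, v) $ (b, c)) *\<^sub>C
       z (f(k := a, Suc k := b, Suc (Suc k) := c)))"
    by (rule sum.cong[OF refl], rule sum.cong[OF refl], rule sum.swap)
  also have "\<dots> = (\<Sum>a\<in>UNIV. \<Sum>b\<in>UNIV. \<Sum>c\<in>UNIV. \<Sum>u\<in>UNIV. \<Sum>v\<in>UNIV. \<Sum>w\<in>UNIV.
       (A $ (f (Suc k), f (Suc (Suc k))) $ (u, v) * B $ (f k, u) $ (a, w) * C $ (w, v) $ (b, c)) *\<^sub>C
       z (f(k := a, Suc k := b, Suc (Suc k) := c)))"
    by (rule sum6_swap)
  finally show ?thesis by (simp add: braid_right_def scaleC_sum_left)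
qed

text \<open>
  The axioms describe the braidings of \<open>V\<close> and \<open>V\<^sup>*\<close> after removal of their scalar factors.  \<open>R\<close> acts on \<open>V \<otimes> V\<close>
  and has the eigenvalues \<open>1\<close> and \<open>-1/t\<close>; \<open>Rs\<close> acts on \<open>V\<^sup>* \<otimes> V\<^sup>*\<close> and has the entries of \<open>R\<close> with
  all indices reversed; \<open>M\<close> maps \<open>V \<otimes> V\<^sup>*\<close> to \<open>V\<^sup>* \<otimes> V\<close>, and its inverse \<open>K\<close> is a partial transpose
  of \<open>R\<close>.  The weight \<open>e\<close> is that of \<open>E'\<close>, normalised so that its trace is compatible with \<open>K\<close> as in
  \<open>e_trace\<close>.  The identities \<open>e_cross_R\<close> and \<open>e_cross_Rs\<close> express that a strand pulled across the cap \<open>E'\<close>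
  comes off.
\<close>

locale braided_legs =
  fixes R Ri Rs Rsi K M :: "complex ^ ('n::finite \<times> 'n) ^ ('n \<times> 'n)"
    and e :: "'n \<Rightarrow> complex" and t :: complex
  assumes t_nz: "t \<noteq> 0"
    and R_inv: "Ri ** R = mat 1" and Rs_inv: "Rsi ** Rs = mat 1"
    and KM: "K ** M = mat 1" and MK: "M ** K = mat 1"
    and Hecke: "Ri $ x $ y = t * R $ x $ y + (1 - t) * (if x = y then 1 else 0)"
    and Hecke': "Rsi $ x $ y = t * Rs $ x $ y + (1 - t) * (if x = y then 1 else 0)"
    and K_entry: "K $ (c, d) $ (a, b) = R $ (a, c) $ (b, d)"
    and Rs_entry: "Rs $ (c, d) $ (a, b) = R $ (b, a) $ (d, c)"
    and braid: "braid_left R R R = braid_right R R R"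
    and e_cross_R: "(\<Sum>a\<in>UNIV. \<Sum>c\<in>UNIV. e a * Ri $ (i, a) $ (b, c) * K $ (c, a) $ (d, h))
        = (if b = d \<and> i = h then e b else 0)"
    and e_cross_Rs: "(\<Sum>a\<in>UNIV. \<Sum>b\<in>UNIV. e a * Rsi $ (a, l) $ (b, c) * K $ (a, b) $ (d, h))
        = (if h = c \<and> l = d then e h else 0)"
    and e_trace: "(\<Sum>a\<in>UNIV. e a * K $ (a, a) $ (b, c)) = (if b = c then 1 else 0)"
    and e_weight: "e a * e b * R $ (a, b) $ (c, d) = e c * e d * R $ (a, b) $ (c, d)"
begin

lemma opL_Ri: "opL k Ri z = (\<lambda>f. t *\<^sub>C opL k R z f + (1 - t) *\<^sub>C z f)"
  by (rule opL_matrix_lincomb) (rule Hecke)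
lemma opL_Rsi: "opL k Rsi z = (\<lambda>f. t *\<^sub>C opL k Rs z f + (1 - t) *\<^sub>C z f)"
  by (rule opL_matrix_lincomb) (rule Hecke')
lemma opL_R: "opL k R z = (\<lambda>f. (1/t) *\<^sub>C opL k Ri z f + (1 - 1/t) *\<^sub>C z f)"
  by (rule opL_matrix_lincomb) (simp add: Hecke t_nz field_simps)
lemma opL_Rs: "opL k Rs z = (\<lambda>f. (1/t) *\<^sub>C opL k Rsi z f + (1 - 1/t) *\<^sub>C z f)"
  by (rule opL_matrix_lincomb) (simp add: Hecke' t_nz field_simps)

lemma opL_cancel [simp]:
  "opL k Ri (opL k R z) = z" "opL k R (opL k Ri z) = z"
  "opL k Rsi (opL k Rs z) = z" "opL k Rs (opL k Rsi z) = z"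
  "opL k K (opL k M z) = z" "opL k M (opL k K z) = z"
  using R_inv Rs_inv KM MK matrix_left_right_inverse[of R Ri] matrix_left_right_inverse[of Rs Rsi]
  by (simp_all add: opL_opL_same)

text \<open>
  Because \<open>K\<close> and \<open>Rs\<close> have the entries of \<open>R\<close> in other places, the next three braid relations are the
  relation for \<open>R\<close> with the six outer indices permuted.
\<close>

lemma braid_K_R: "braid_left R K K = braid_right K K R"
proof (intro ext)
  fix i j k a b c
  have "braid_left R K K i j k a b c = braid_right R R R a i j b c k"
    unfolding braid_left_def braid_right_def K_entry
    by (intro sum.cong refl) (simp add: mult_ac)
  also have "\<dots> = braid_left R R R a i j b c k" by (simp add: braid)
  also have "\<dots> = braid_right K K R i j k a b c"
    unfolding braid_left_def braid_right_def K_entry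
    by (rule sym, subst sum3_swap, intro sum.cong refl) (simp add: mult_ac)
  finally show "braid_left R K K i j k a b c = braid_right K K R i j k a b c" .
qed

lemma braid_K_Rs: "braid_left K K Rs = braid_right Rs K K"
proof (intro ext)
  fix i j k a b c
  have "braid_left K K Rs i j k a b c = braid_left R R R b a i c k j"
    unfolding braid_left_def K_entry Rs_entry
    by (subst sum3_swap, intro sum.cong refl) (simp add: mult_ac)
  also have "\<dots> = braid_right R R R b a i c k j" by (simp add: braid)
  also have "\<dots> = braid_right Rs K K i j k a b c"
    unfolding braid_right_def K_entry Rs_entry
    by (rule sym, subst sum3_swap, intro sum.cong refl) (simp add: mult_ac)
  finally show "braid_left K K Rs i j k a b c = braid_right Rs K K i j k a b c" .
qed

lemma braid_Rs: "braid_left Rs Rs Rs = braid_right Rs Rs Rs"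
proof (intro ext)
  fix i j k a b c
  have "braid_left Rs Rs Rs i j k a b c = braid_right R R R c b a k j i"
    unfolding braid_left_def braid_right_def Rs_entry
    by (subst sum3_swap, intro sum.cong refl) (simp add: mult_ac)
  also have "\<dots> = braid_left R R R c b a k j i" by (simp add: braid)
  also have "\<dots> = braid_right Rs Rs Rs i j k a b c"
    unfolding braid_left_def braid_right_def Rs_entry
    by (subst sum3_swap, intro sum.cong refl) (simp add: mult_ac)
  finally show "braid_left Rs Rs Rs i j k a b c = braid_right Rs Rs Rs i j k a b c" .
qed

lemma opL_braid:
  "opL k R (opL (Suc k) R (opL k R z)) = opL (Suc k) R (opL k R (opL (Suc k) R z))"
  "opL k Rs (opL (Suc k) Rs (opL k Rs z)) = opL (Suc k) Rs (opL k Rs (opL (Suc k) Rs z))"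
  "opL k R (opL (Suc k) K (opL k K z)) = opL (Suc k) K (opL k K (opL (Suc k) R z))"
  "opL k K (opL (Suc k) K (opL k Rs z)) = opL (Suc k) Rs (opL k K (opL (Suc k) K z))"
  by (rule ext, simp only: opL_braid_left opL_braid_right braid braid_Rs braid_K_R braid_K_Rs)+

lemma opL_braid_inv:
  "opL k Ri (opL (Suc k) Ri (opL k Ri z)) = opL (Suc k) Ri (opL k Ri (opL (Suc k) Ri z))"
  "opL k Rsi (opL (Suc k) Rsi (opL k Rsi z)) = opL (Suc k) Rsi (opL k Rsi (opL (Suc k) Rsi z))"
  "opL k Ri (opL (Suc k) K (opL k K z)) = opL (Suc k) K (opL k K (opL (Suc k) Ri z))"
  "opL k K (opL (Suc k) K (opL k Rsi z)) = opL (Suc k) Rsi (opL k K (opL (Suc k) K z))"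
proof -
  show "opL k Ri (opL (Suc k) Ri (opL k Ri z)) = opL (Suc k) Ri (opL k Ri (opL (Suc k) Ri z))"
  proof -
    define y where "y = opL k Ri (opL (Suc k) Ri (opL k Ri z))"
    have "z = opL k R (opL (Suc k) R (opL k R y))" by (simp add: y_def)
    also have "\<dots> = opL (Suc k) R (opL k R (opL (Suc k) R y))" by (rule opL_braid)
    finally have "opL (Suc k) Ri (opL k Ri (opL (Suc k) Ri z)) = y" by simp
    then show ?thesis by (simp add: y_def)
  qed
  show "opL k Rsi (opL (Suc k) Rsi (opL k Rsi z)) = opL (Suc k) Rsi (opL k Rsi (opL (Suc k) Rsi z))"
  proof -
    define y where "y = opL k Rsi (opL (Suc k) Rsi (opL k Rsi z))"
    have "z = opL k Rs (opL (Suc k) Rs (opL k Rs y))" by (simp add: y_def)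
    also have "\<dots> = opL (Suc k) Rs (opL k Rs (opL (Suc k) Rs y))" by (rule opL_braid)
    finally have "opL (Suc k) Rsi (opL k Rsi (opL (Suc k) Rsi z)) = y" by simp
    then show ?thesis by (simp add: y_def)
  qed
  show "opL k Ri (opL (Suc k) K (opL k K z)) = opL (Suc k) K (opL k K (opL (Suc k) Ri z))"
    using opL_braid(3)[of k "opL (Suc k) Ri z"] by (metis opL_cancel(1,2))
  show "opL k K (opL (Suc k) K (opL k Rsi z)) = opL (Suc k) Rsi (opL k K (opL (Suc k) K z))"
    using opL_braid(4)[of k "opL k Rsi z"] by (metis opL_cancel(3,4))
qed

text \<open>
  The trace over legs \<open>k\<close>, \<open>k + 1\<close> of \<open>v f v\<close> equals a trace over the next pair of legs of \<open>v v f\<close>: the strand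
  of the surviving leg \<open>v\<close> is moved across the cap.  The functions \<open>g\<close> in this proof and the following ones
  are the assignments at which \<open>z\<close> is evaluated once all inserted indices have been overwritten.
\<close>

lemma ctr_cross_R: "ctr k e z = ctr (Suc k) e (opL k Ri (opL (Suc k) K z))"
proof (rule ext)
  fix f :: "nat \<Rightarrow> 'n"
  define g where "g b d h = (\<lambda>j. if j < k then f j else if j = k then b else if j = Suc k then d
      else if j = Suc (Suc k) then h else f (j - 2))" for b d h
  have upd: "(plug (Suc k) a f)(k := b, Suc k := d, Suc (Suc k) := h) = g b d h" for a b d h
    by (auto simp: g_def plug_def fun_eq_iff)
  have gg: "g b b (f k) = plug k b f" for b by (auto simp: g_def plug_def fun_eq_iff)
  have "ctr (Suc k) e (opL k Ri (opL (Suc k) K z)) f =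
     (\<Sum>a\<in>UNIV. \<Sum>b\<in>UNIV. \<Sum>c\<in>UNIV. \<Sum>d\<in>UNIV. \<Sum>h\<in>UNIV.
       (e a * Ri $ (f k, a) $ (b, c) * K $ (c, a) $ (d, h)) *\<^sub>C z (g b d h))"
    by (simp add: ctr_def opL_def scaleC_sum_right scaleC_scaleC plug_apply upd mult.assoc)
  also have "\<dots> = (\<Sum>b\<in>UNIV. \<Sum>d\<in>UNIV. \<Sum>h\<in>UNIV. \<Sum>a\<in>UNIV. \<Sum>c\<in>UNIV.
       (e a * Ri $ (f k, a) $ (b, c) * K $ (c, a) $ (d, h)) *\<^sub>C z (g b d h))"
    by (subst sum.swap, rule sum.cong[OF refl], rule sum4_swap)
  also have "\<dots> = (\<Sum>b\<in>UNIV. \<Sum>d\<in>UNIV. \<Sum>h\<in>UNIV. (if b = d \<and> f k = h then e b else 0) *\<^sub>C z (g b d h))"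
    by (simp only: scaleC_sum_left[symmetric] e_cross_R)
  also have "\<dots> = (\<Sum>b\<in>UNIV. \<Sum>d\<in>UNIV. if d = b then e b *\<^sub>C z (g b d (f k)) else 0)"
    by (intro sum.cong refl) (auto simp: if_distrib[of "\<lambda>c. c *\<^sub>C _"] sum.delta cong: if_cong)
  also have "\<dots> = (\<Sum>b\<in>UNIV. e b *\<^sub>C z (g b b (f k)))" by (simp add: sum.delta)
  finally show "ctr k e z f = ctr (Suc k) e (opL k Ri (opL (Suc k) K z)) f" by (simp add: ctr_def gg)
qed

text \<open>
  The same with the surviving leg \<open>f\<close> on the left of the cap and \<open>Rs\<close> in place of \<open>R\<close>.
\<close>

lemma ctr_cross_Rs: "ctr (Suc k) e z = ctr k e (opL (Suc k) Rsi (opL k K z))"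
proof (rule ext)
  fix f :: "nat \<Rightarrow> 'n"
  define g where "g d h c = (\<lambda>j. if j < k then f j else if j = k then d else if j = Suc k then h
      else if j = Suc (Suc k) then c else f (j - 2))" for d h c
  have upd: "(plug k a f)(Suc (Suc k) := c, k := d, Suc k := h) = g d h c" for a c d h
    by (auto simp: g_def plug_def fun_eq_iff)
  have gg: "g (f k) b b = plug (Suc k) b f" for b
    by (auto simp: g_def plug_def fun_eq_iff less_Suc_eq)
  have "ctr k e (opL (Suc k) Rsi (opL k K z)) f =
     (\<Sum>a\<in>UNIV. \<Sum>b\<in>UNIV. \<Sum>c\<in>UNIV. \<Sum>d\<in>UNIV. \<Sum>h\<in>UNIV.
       (e a * Rsi $ (a, f k) $ (b, c) * K $ (a, b) $ (d, h)) *\<^sub>C z (g d h c))"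
    by (simp add: ctr_def opL_def scaleC_sum_right scaleC_scaleC plug_apply upd mult.assoc)
  also have "\<dots> = (\<Sum>a\<in>UNIV. \<Sum>b\<in>UNIV. \<Sum>d\<in>UNIV. \<Sum>h\<in>UNIV. \<Sum>c\<in>UNIV.
       (e a * Rsi $ (a, f k) $ (b, c) * K $ (a, b) $ (d, h)) *\<^sub>C z (g d h c))"
    by (rule sum.cong[OF refl], rule sum.cong[OF refl], rule sum3_swap[symmetric])
  also have "\<dots> = (\<Sum>d\<in>UNIV. \<Sum>h\<in>UNIV. \<Sum>c\<in>UNIV. \<Sum>a\<in>UNIV. \<Sum>b\<in>UNIV.
       (e a * Rsi $ (a, f k) $ (b, c) * K $ (a, b) $ (d, h)) *\<^sub>C z (g d h c))"
    by (subst sum4_swap, rule sum.cong[OF refl], rule sum.cong[OF refl], rule sum3_swap)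
  also have "\<dots> = (\<Sum>d\<in>UNIV. \<Sum>h\<in>UNIV. \<Sum>c\<in>UNIV. (if h = c \<and> f k = d then e h else 0) *\<^sub>C z (g d h c))"
    by (simp only: scaleC_sum_left[symmetric] e_cross_Rs)
  also have "\<dots> = (\<Sum>d\<in>UNIV. if d = f k then (\<Sum>h\<in>UNIV. e h *\<^sub>C z (g d h h)) else 0)"
    by (intro sum.cong refl) (auto simp: if_distrib[of "\<lambda>c. c *\<^sub>C _"] sum.delta sum.delta' cong: if_cong)
  also have "\<dots> = (\<Sum>b\<in>UNIV. e b *\<^sub>C z (g (f k) b b))" by (simp add: sum.delta)
  finally show "ctr (Suc k) e z f = ctr k e (opL (Suc k) Rsi (opL k K z)) f" by (simp add: ctr_def gg)
qed

text \<open>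
  The evaluation \<open>V\<^sup>* \<otimes> V \<rightarrow> \<complex>\<close> is the quantum trace after a crossing.
\<close>

lemma ctr_trace: "ctr k (\<lambda>_. 1) z = ctr k e (opL k K z)"
proof (rule ext)
  fix f :: "nat \<Rightarrow> 'n"
  define g where "g b c = (\<lambda>j. if j < k then f j else if j = k then b else if j = Suc k then c
      else f (j - 2))" for b c
  have upd: "(plug k a f)(k := b, Suc k := c) = g b c" for a b c
    by (auto simp: g_def plug_def fun_eq_iff)
  have gg: "g b b = plug k b f" for b by (auto simp: g_def plug_def fun_eq_iff)
  have "ctr k e (opL k K z) f =
     (\<Sum>a\<in>UNIV. \<Sum>b\<in>UNIV. \<Sum>c\<in>UNIV. (e a * K $ (a, a) $ (b, c)) *\<^sub>C z (g b c))"
    by (simp add: ctr_def opL_def scaleC_sum_right scaleC_scaleC plug_apply upd mult.assoc)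
  also have "\<dots> = (\<Sum>b\<in>UNIV. \<Sum>c\<in>UNIV. \<Sum>a\<in>UNIV. (e a * K $ (a, a) $ (b, c)) *\<^sub>C z (g b c))"
    by (rule sum3_swap[symmetric])
  also have "\<dots> = (\<Sum>b\<in>UNIV. \<Sum>c\<in>UNIV. (if b = c then 1 else 0) *\<^sub>C z (g b c))"
    by (simp only: scaleC_sum_left[symmetric] e_trace)
  also have "\<dots> = (\<Sum>b\<in>UNIV. 1 *\<^sub>C z (g b b))"
    by (intro sum.cong refl) (auto simp: if_distrib[of "\<lambda>c. c *\<^sub>C _"] sum.delta' cong: if_cong)
  finally show "ctr k (\<lambda>_. 1) z f = ctr k e (opL k K z) f" by (simp add: ctr_def gg)
qed

text \<open>
  Two nested caps join the legs \<open>v v\<close> to \<open>f f\<close>, so a crossing on one side can slide over the caps and becomes its transpose on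
  the other side.  \<open>e_weight\<close> takes care of the weights in the caps.
\<close>

lemma ctr_nested_R: "ctr k e (ctr (Suc k) e (opL k R z)) = ctr k e (ctr (Suc k) e (opL (Suc (Suc k)) Rs z))"
proof (rule ext)
  fix f :: "nat \<Rightarrow> 'n"
  define g where "g a b c d = (\<lambda>j. if j < k then f j else if j = k then a else if j = Suc k then b
      else if j = Suc (Suc k) then c else if j = Suc (Suc (Suc k)) then d else f (j - 4))" for a b c d
  have upd: "(plug (Suc k) b (plug k a f))(k := c, Suc k := d) = g c d b a"
     "(plug (Suc k) b (plug k a f))(Suc (Suc k) := c, Suc (Suc (Suc k)) := d) = g a b c d" for a b c d
    by (auto simp: g_def plug_def fun_eq_iff le_Suc_eq not_less_eq_eq numeral_eq_Suc)
  have pl: "plug (Suc k) b (plug k a f) k = a" "plug (Suc k) b (plug k a f) (Suc k) = b"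
    "plug (Suc k) b (plug k a f) (Suc (Suc k)) = b" "plug (Suc k) b (plug k a f) (Suc (Suc (Suc k))) = a" for a b
    by (auto simp: plug_def)
  have wt: "e a * e b * R $ (a, b) $ (c, d) = e c * e d * Rs $ (d, c) $ (b, a)" for a b c d
    by (simp only: Rs_entry e_weight[of a b c d])
  have "ctr k e (ctr (Suc k) e (opL k R z)) f =
     (\<Sum>a\<in>UNIV. \<Sum>b\<in>UNIV. \<Sum>c\<in>UNIV. \<Sum>d\<in>UNIV. (e a * e b * R $ (a, b) $ (c, d)) *\<^sub>C z (g c d b a))"
    by (simp add: ctr_def opL_def scaleC_sum_right scaleC_scaleC pl upd mult.assoc)
  also have "\<dots> = (\<Sum>a\<in>UNIV. \<Sum>b\<in>UNIV. \<Sum>c\<in>UNIV. \<Sum>d\<in>UNIV. (e c * e d * Rs $ (d, c) $ (b, a)) *\<^sub>C z (g c d b a))"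
    by (simp only: wt)
  also have "\<dots> = (\<Sum>c\<in>UNIV. \<Sum>d\<in>UNIV. \<Sum>a\<in>UNIV. \<Sum>b\<in>UNIV. (e c * e d * Rs $ (d, c) $ (b, a)) *\<^sub>C z (g c d b a))"
    by (rule sum4_swap)
  also have "\<dots> = (\<Sum>c\<in>UNIV. \<Sum>d\<in>UNIV. \<Sum>b\<in>UNIV. \<Sum>a\<in>UNIV. (e c * e d * Rs $ (d, c) $ (b, a)) *\<^sub>C z (g c d b a))"
    by (rule sum.cong[OF refl], rule sum.cong[OF refl], rule sum.swap)
  also have "\<dots> = ctr k e (ctr (Suc k) e (opL (Suc (Suc k)) Rs z)) f"
    by (simp add: ctr_def opL_def scaleC_sum_right scaleC_scaleC pl upd mult.assoc)
  finally show "ctr k e (ctr (Suc k) e (opL k R z)) f = ctr k e (ctr (Suc k) e (opL (Suc (Suc k)) Rs z)) f" .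
qed

lemma ctr_nested_Ri: "ctr k e (ctr (Suc k) e (opL k Ri z)) = ctr k e (ctr (Suc k) e (opL (Suc (Suc k)) Rsi z))"
  by (simp add: opL_Ri opL_Rsi ctr_lincomb ctr_nested_R)

end

section \<open>Words of families and the Hecke calculus\<close>

lemma opL_far: "Suc j < k \<or> Suc k < j \<Longrightarrow> opL j A (opL k B z) = opL k B (opL j A z)"
  using opL_commute by metis

context braided_legs
begin

text \<open>
  For a tensor with legs \<open>v f v f\<close> starting at \<open>k\<close>: \<open>mulL\<close> is \<open>E\<close> on the inner legs, that is, the
  matrix product of two families; \<open>omulL\<close> is a second, opposite product; \<open>TL\<close> is the operator \<open>T\<close>.  The scalar factors of
  the braidings cancel in \<open>T\<close>.  \<open>TiL\<close> is the inverse of \<open>T\<close>.  Up to \<open>M\<close> and the trace they are all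
  operators on the flattened legs \<open>v v f f\<close>, and \<open>flat3\<close> is the flattening \<open>v v v f f f\<close> of three families.
\<close>

definition mulL where "mulL k z = ctr (Suc k) (\<lambda>_. 1) z"
definition omulL where "omulL k z = ctr (Suc k) e (opL k Ri (opL (Suc (Suc k)) Rsi (opL (Suc k) K z)))"
definition TL where "TL k z = opL (Suc k) M (opL k R (opL (Suc (Suc k)) Rsi (opL (Suc k) K z)))"
definition TiL where "TiL k z = opL (Suc k) M (opL k Ri (opL (Suc (Suc k)) Rs (opL (Suc k) K z)))"
definition flat3 where "flat3 k z = opL (Suc (Suc k)) K (opL (Suc k) K (opL (Suc (Suc (Suc k))) K z))"

lemma mulL_flat: "mulL k z = ctr (Suc k) e (opL (Suc k) K z)"
  by (simp add: mulL_def ctr_trace)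
lemma tr1_flat: "ctr k e z = ctr (Suc k) e (opL k Ri (opL (Suc k) K z))"
  by (rule ctr_cross_R)
lemma tr2_flat: "ctr (Suc (Suc k)) e z = ctr (Suc k) e (opL (Suc (Suc k)) Rsi (opL (Suc k) K z))"
  by (rule ctr_cross_Rs)

text \<open>
  The factor \<open>R\<close> of \<open>TL\<close>, and \<open>Rs\<close> of \<open>TiL\<close>, is rewritten by the Hecke relation, which splits the product after \<open>TL\<close> or \<open>TiL\<close>
  into the opposite product and a quantum trace of one of the factors.
\<close>

lemma mulL_TL: "mulL k (TL k z) = (\<lambda>f. (1/t) *\<^sub>C omulL k z f + (1 - 1/t) *\<^sub>C ctr (Suc (Suc k)) e z f)"
  by (simp add: mulL_flat TL_def omulL_def tr2_flat[of k z] opL_R[of k] ctr_lincomb)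

lemma mulL_TiL: "mulL k (TiL k z) = (\<lambda>f. (1/t) *\<^sub>C omulL k z f + (1 - 1/t) *\<^sub>C ctr k e z f)"
  by (simp add: mulL_flat TiL_def omulL_def tr1_flat[of k z] opL_Rs[of "Suc (Suc k)"] opL_lincomb ctr_lincomb)

lemma opL_Ri_Ri: "opL k Ri (opL k Ri z) = (\<lambda>f. (1 - t) *\<^sub>C opL k Ri z f + t *\<^sub>C z f)"
  by (subst opL_Ri) (simp add: add.commute)
lemma opL_Rsi_Rsi: "opL k Rsi (opL k Rsi z) = (\<lambda>f. (1 - t) *\<^sub>C opL k Rsi z f + t *\<^sub>C z f)"
  by (subst opL_Rsi) (simp add: add.commute)

text \<open>
  Under the trace, nested caps turn \<open>Rsi\<close> into a second \<open>Ri\<close>, and the Hecke relation reduces the square.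
\<close>

lemma tr_omulL:
  "ctr k e (omulL k z) = (\<lambda>f. (1 - t) *\<^sub>C ctr k e (ctr k e z) f + t *\<^sub>C ctr k e (mulL k z) f)"
proof -
  have "ctr k e (omulL k z) = ctr k e (ctr (Suc k) e (opL (Suc (Suc k)) Rsi (opL k Ri (opL (Suc k) K z))))"
    by (simp add: omulL_def opL_far)
  also have "\<dots> = ctr k e (ctr (Suc k) e (opL k Ri (opL k Ri (opL (Suc k) K z))))"
    by (simp only: ctr_nested_Ri)
  finally show ?thesis
    by (simp add: opL_Ri_Ri ctr_lincomb mulL_flat tr1_flat[of k z, symmetric])
qed

text \<open>
  The following six facts translate products and \<open>T\<close> on neighbouring factors of a triple word to the flattened legs \<open>v v v f f f\<close>,
  where the crossings needed to bring two legs together become Hecke operators next to the innermost cap.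
\<close>

lemma flat3_mul12: "opL (Suc k) K (mulL k z) = ctr (Suc (Suc k)) e (opL (Suc k) Ri (flat3 k z))"
  by (simp add: mulL_flat opL_ctr_above) (subst ctr_cross_R, simp add: flat3_def opL_far)

lemma flat3_mul23: "opL (Suc k) K (mulL (Suc (Suc k)) z) =
    ctr (Suc (Suc k)) e (opL (Suc (Suc (Suc k))) Rsi (flat3 k z))"
  by (simp add: flat3_def mulL_flat opL_ctr_below) (rule ctr_cross_Rs)

lemma flat3_omul12: "opL (Suc k) K (omulL k z) =
    ctr (Suc (Suc k)) e (opL (Suc k) Ri (opL k Ri (opL (Suc (Suc (Suc k))) Rsi (flat3 k z))))"
proof -
  have "opL (Suc k) K (omulL k z) =
    ctr (Suc k) e (opL k Ri (opL (Suc (Suc (Suc k))) K (opL (Suc (Suc k)) Rsi (opL (Suc k) K z))))"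
    by (simp add: omulL_def opL_ctr_above opL_far)
  also have "\<dots> = ctr (Suc (Suc k)) e (opL (Suc k) Ri (opL k Ri
     (opL (Suc (Suc k)) K (opL (Suc (Suc (Suc k))) K (opL (Suc (Suc k)) Rsi (opL (Suc k) K z))))))"
    by (subst ctr_cross_R) (simp add: opL_far)
  finally show ?thesis by (simp add: opL_braid_inv(4) flat3_def opL_far)
qed

lemma flat3_omul23: "opL (Suc k) K (omulL (Suc (Suc k)) z) =
    ctr (Suc (Suc k)) e (opL (Suc (Suc (Suc k))) Rsi (opL (Suc k) Ri (opL (Suc (Suc (Suc (Suc k)))) Rsi (flat3 k z))))"
proof -
  have "opL (Suc k) K (omulL (Suc (Suc k)) z) =
    ctr (Suc (Suc (Suc k))) e (opL (Suc k) K (opL (Suc (Suc k)) Ri (opL (Suc (Suc (Suc (Suc k)))) Rsi (opL (Suc (Suc (Suc k))) K z))))"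
    by (simp add: omulL_def opL_ctr_below)
  also have "\<dots> = ctr (Suc (Suc k)) e (opL (Suc (Suc (Suc k))) Rsi
      (opL (Suc (Suc k)) K (opL (Suc k) K (opL (Suc (Suc k)) Ri (opL (Suc (Suc (Suc (Suc k)))) Rsi (opL (Suc (Suc (Suc k))) K z))))))"
    by (subst ctr_cross_Rs) simp
  also have "\<dots> = ctr (Suc (Suc k)) e (opL (Suc (Suc (Suc k))) Rsi
      (opL (Suc k) Ri (opL (Suc (Suc k)) K (opL (Suc k) K (opL (Suc (Suc (Suc (Suc k)))) Rsi (opL (Suc (Suc (Suc k))) K z))))))"
    by (simp only: opL_braid_inv(3))
  finally show ?thesis by (simp add: flat3_def opL_far)
qed

lemma flat3_TL12: "flat3 k (TL k z) = opL k R (opL (Suc (Suc (Suc k))) Rsi (flat3 k z))"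
proof -
  have "flat3 k (TL k z) = opL (Suc (Suc k)) K (opL (Suc (Suc (Suc k))) K (opL (Suc k) K (TL k z)))"
    by (simp add: flat3_def opL_far)
  also have "\<dots> = opL k R (opL (Suc (Suc k)) K (opL (Suc (Suc (Suc k))) K (opL (Suc (Suc k)) Rsi (opL (Suc k) K z))))"
    by (simp add: TL_def opL_far)
  finally show ?thesis by (simp add: opL_braid_inv(4) flat3_def opL_far)
qed

lemma flat3_TL23: "flat3 k (TL (Suc (Suc k)) z) = opL (Suc k) R (opL (Suc (Suc (Suc (Suc k)))) Rsi (flat3 k z))"
proof -
  have "flat3 k (TL (Suc (Suc k)) z) =
    opL (Suc (Suc k)) K (opL (Suc k) K (opL (Suc (Suc k)) R (opL (Suc (Suc (Suc (Suc k)))) Rsi (opL (Suc (Suc (Suc k))) K z))))"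
    by (simp add: flat3_def TL_def)
  also have "\<dots> = opL (Suc k) R (opL (Suc (Suc k)) K (opL (Suc k) K (opL (Suc (Suc (Suc (Suc k)))) Rsi (opL (Suc (Suc (Suc k))) K z))))"
    by (simp only: opL_braid)
  finally show ?thesis by (simp add: flat3_def opL_far)
qed

text \<open>
  After flattening, both sides are the double trace of a word in Hecke operators on \<open>v v v\<close> and on \<open>f f f\<close>.  A braid
  relation brings an operator next to the nested caps, where it passes from the \<open>v\<close> side to the \<open>f\<close> side; a braid
  relation on that side finishes.
\<close>

lemma omulL_assoc: "omulL k (omulL k z) = omulL k (omulL (Suc (Suc k)) z)"
proof -
  let ?c = "\<lambda>y. ctr (Suc k) e (ctr (Suc (Suc k)) e y)"
  let ?F = "flat3 k z"
  have "omulL k (omulL k z) = ?c (opL k Ri (opL (Suc (Suc (Suc (Suc k)))) Rsi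
      (opL (Suc k) Ri (opL k Ri (opL (Suc (Suc (Suc k))) Rsi ?F)))))"
    by (simp add: omulL_def[of k "omulL k z"] flat3_omul12 opL_ctr_above opL_ctr_below)
  also have "\<dots> = ?c (opL k Ri (opL (Suc k) Ri (opL k Ri
      (opL (Suc (Suc (Suc (Suc k)))) Rsi (opL (Suc (Suc (Suc k))) Rsi ?F)))))"
    by (simp add: opL_far)
  also have "\<dots> = ?c (opL (Suc k) Ri (opL k Ri (opL (Suc k) Ri
      (opL (Suc (Suc (Suc (Suc k)))) Rsi (opL (Suc (Suc (Suc k))) Rsi ?F)))))"
    by (simp only: opL_braid_inv)
  also have "\<dots> = ?c (opL (Suc (Suc (Suc k))) Rsi (opL k Ri (opL (Suc k) Ri
      (opL (Suc (Suc (Suc (Suc k)))) Rsi (opL (Suc (Suc (Suc k))) Rsi ?F)))))"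
    by (simp only: ctr_nested_Ri)
  also have "\<dots> = ?c (opL k Ri (opL (Suc k) Ri (opL (Suc (Suc (Suc k))) Rsi
      (opL (Suc (Suc (Suc (Suc k)))) Rsi (opL (Suc (Suc (Suc k))) Rsi ?F)))))"
    by (simp add: opL_far)
  also have "\<dots> = ?c (opL k Ri (opL (Suc k) Ri (opL (Suc (Suc (Suc (Suc k)))) Rsi
      (opL (Suc (Suc (Suc k))) Rsi (opL (Suc (Suc (Suc (Suc k)))) Rsi ?F)))))"
    by (simp only: opL_braid_inv)
  also have "\<dots> = omulL k (omulL (Suc (Suc k)) z)"
    by (simp add: omulL_def[of k "omulL (Suc (Suc k)) z"] flat3_omul23 opL_ctr_above opL_ctr_below opL_far)
  finally show ?thesis .
qed

text \<open>
  \<open>TL\<close> twice moves the first factor of a triple word to the end.  In flattened form its crossings on the \<open>v\<close> side cancel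
  against those of the trace, which makes traces of two factors commute with the moved one.
\<close>

lemma trace_central:
  "ctr k e (mulL k (TL (Suc (Suc k)) (TL k z))) = ctr (Suc (Suc k)) e (mulL (Suc (Suc k)) z)"
proof -
  let ?F = "flat3 k z"
  have "ctr k e (mulL k (TL (Suc (Suc k)) (TL k z))) =
    ctr (Suc k) e (ctr (Suc (Suc k)) e (opL k Ri (opL (Suc k) Ri (opL (Suc k) R (opL (Suc (Suc (Suc (Suc k)))) Rsi
      (opL k R (opL (Suc (Suc (Suc k))) Rsi ?F)))))))"
    by (subst tr1_flat) (simp only: flat3_mul12 flat3_TL12 flat3_TL23, simp add: opL_ctr_below del: opL_cancel)
  also have "\<dots> = ctr (Suc k) e (ctr (Suc (Suc k)) e (opL (Suc (Suc (Suc (Suc k)))) Rsi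
      (opL (Suc (Suc (Suc k))) Rsi ?F)))"
    by (simp add: opL_far)
  also have "\<dots> = ctr (Suc (Suc k)) e (mulL (Suc (Suc k)) z)"
    by (subst (2) tr2_flat) (simp only: flat3_mul23, simp add: opL_ctr_above)
  finally show ?thesis .
qed

text \<open>
  The mechanism of \<open>trace_central\<close> without the outer trace: one crossing on the \<open>v\<close> side is left over, and the symmetry
  of the first two factors absorbs it.
\<close>

lemma rank_one_mul:
  assumes sym: "opL k R (opL (Suc k) K z) = opL (Suc k) K z"
  shows "mulL k (mulL k (TL (Suc (Suc k)) (TL k z))) = ctr (Suc (Suc k)) e (mulL (Suc (Suc k)) z)"
proof -
  let ?F = "flat3 k z"
  have F: "opL k R ?F = ?F"
  proof -
    have "?F = opL (Suc (Suc k)) K (opL (Suc (Suc (Suc k))) K (opL (Suc k) K z))"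
      by (simp add: flat3_def opL_far)
    also have "\<dots> = opL (Suc (Suc k)) K (opL (Suc (Suc (Suc k))) K (opL k R (opL (Suc k) K z)))"
      by (simp only: sym)
    also have "\<dots> = opL k R (opL (Suc (Suc k)) K (opL (Suc (Suc (Suc k))) K (opL (Suc k) K z)))"
      by (simp add: opL_far)
    also have "\<dots> = opL k R ?F" by (simp add: flat3_def opL_far)
    finally show ?thesis by simp
  qed
  have "mulL k (mulL k (TL (Suc (Suc k)) (TL k z))) =
    ctr (Suc k) e (ctr (Suc (Suc k)) e (opL (Suc k) Ri (opL (Suc k) R (opL (Suc (Suc (Suc (Suc k)))) Rsi
      (opL k R (opL (Suc (Suc (Suc k))) Rsi ?F))))))"
    by (simp only: mulL_flat[of k "mulL k z" for z] flat3_mul12 flat3_TL12 flat3_TL23)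
  also have "\<dots> = ctr (Suc k) e (ctr (Suc (Suc k)) e (opL (Suc (Suc (Suc (Suc k)))) Rsi
      (opL (Suc (Suc (Suc k))) Rsi (opL k R ?F))))"
    by (simp only: opL_cancel) (simp add: opL_far del: opL_cancel)
  also have "\<dots> = ctr (Suc (Suc k)) e (mulL (Suc (Suc k)) z)"
    by (simp only: F, subst (2) tr2_flat) (simp only: flat3_mul23, simp add: opL_ctr_above)
  finally show ?thesis .
qed

text \<open>
  The counterpart for the opposite product.  The surplus crossings now sit on the \<open>f\<close> side and form a square, and the
  linear term of the Hecke relation is a trace over the last factor, which is assumed to vanish.
\<close>

lemma rank_one_omul:
  assumes sym: "opL (Suc (Suc k)) Rs (opL (Suc k) K z) = opL (Suc k) K z"
    and tr0: "ctr (Suc (Suc (Suc (Suc k)))) e z = (\<lambda>_. 0)"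
  shows "omulL k (omulL (Suc (Suc k)) (TL (Suc (Suc k)) (TL k z)))
    = (\<lambda>f. t *\<^sub>C ctr (Suc (Suc k)) e (mulL (Suc (Suc k)) z) f)"
proof -
  let ?F = "flat3 k z"
  let ?c = "\<lambda>y. ctr (Suc k) e (ctr (Suc (Suc k)) e y)"
  let ?s1 = "opL (Suc (Suc (Suc k))) Rsi" and ?s2 = "opL (Suc (Suc (Suc (Suc k)))) Rsi"
  let ?r1 = "opL k Ri" and ?r2 = "opL (Suc k) Ri"
  have F: "?s1 ?F = ?F"
  proof -
    have K2: "opL (Suc (Suc k)) Rsi (opL (Suc k) K z) = opL (Suc k) K z"
      by (subst sym[symmetric]) simp
    have "?F = opL (Suc (Suc k)) K (opL (Suc (Suc (Suc k))) K (opL (Suc k) K z))"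
      by (simp add: flat3_def opL_far)
    also have "\<dots> = opL (Suc (Suc k)) K (opL (Suc (Suc (Suc k))) K (opL (Suc (Suc k)) Rsi (opL (Suc k) K z)))"
      by (simp only: K2)
    also have "\<dots> = ?s1 ?F"
      by (simp add: opL_braid_inv(4)) (simp add: flat3_def opL_far)
    finally show ?thesis by simp
  qed
  have "?c (?s2 (?s1 (?s2 ?F))) = ?c (?s1 (?s2 (?s1 ?F)))"
    by (simp only: opL_braid_inv)
  also have "\<dots> = ?c (?s1 (?s2 ?F))" by (simp only: F)
  also have "\<dots> = ?c (?r2 (?s2 ?F))" by (simp only: ctr_nested_Ri)
  also have "\<dots> = ctr (Suc k) e (opL (Suc (Suc k)) Rsi (opL (Suc k) K (mulL k z)))"
    by (simp add: flat3_mul12 opL_ctr_above opL_far)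
  also have "\<dots> = ctr (Suc (Suc k)) e (mulL k z)"
    by (rule tr2_flat[symmetric])
  also have "\<dots> = mulL k (ctr (Suc (Suc (Suc (Suc k)))) e z)"
    unfolding mulL_def by (rule ctr_ctr[symmetric]) simp
  also have "\<dots> = (\<lambda>_. 0)" by (simp add: tr0 mulL_def ctr_def fun_eq_iff)
  finally have zero: "?c (?s2 (?s1 (?s2 ?F))) = (\<lambda>_. 0)" .

  have "omulL k (omulL (Suc (Suc k)) (TL (Suc (Suc k)) (TL k z))) =
     ?c (?r1 (?s2 (?s1 (?r2 (?s2 (opL (Suc k) R (?s2 (opL k R (?s1 ?F)))))))))"
    by (simp add: omulL_def[of k "omulL (Suc (Suc k)) z" for z] flat3_omul23 flat3_TL12 flat3_TL23 opL_ctr_above opL_ctr_below)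
  also have "\<dots> = ?c (?r1 (?s2 (?s1 (?s2 (?r2 (opL (Suc k) R (?s2 (opL k R ?F))))))))"
    by (simp add: F opL_far del: opL_cancel)
  also have "\<dots> = ?c (?s2 (?s1 (?s2 (?s2 ?F))))"
    by (simp add: opL_far)
  also have "\<dots> = (\<lambda>f. (1 - t) *\<^sub>C ?c (?s2 (?s1 (?s2 ?F))) f + t *\<^sub>C ?c (?s2 (?s1 ?F)) f)"
    by (simp only: opL_Rsi_Rsi opL_lincomb ctr_lincomb)
  also have "\<dots> = (\<lambda>f. t *\<^sub>C ?c (?s2 (?s1 ?F)) f)"
    by (simp add: zero)
  also have "?c (?s2 (?s1 ?F)) = ctr (Suc (Suc k)) e (mulL (Suc (Suc k)) z)"
    by (subst (2) tr2_flat) (simp only: flat3_mul23, simp add: opL_ctr_above)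
  finally show ?thesis .
qed

end

section \<open>The explicit R-matrix of type A\<close>

text \<open>
  The R-matrix of type A, divided by its eigenvalue \<open>q\<^sup>w\<close> on the symmetric part, for \<open>h = q\<close>.  The function \<open>pos\<close> numbers the
  weight vectors from 0, starting at the highest one.
\<close>

definition heckeR :: "('n::finite \<Rightarrow> nat) \<Rightarrow> complex \<Rightarrow> complex ^ ('n \<times> 'n) ^ ('n \<times> 'n)" where
  "heckeR pos h = (\<chi> x y.
     (if fst x = snd y \<and> snd x = fst y then (if fst y = snd y then 1 else 1 / h) else 0) +
     (if x = y \<and> pos (snd y) < pos (fst y) then 1 - 1 / h\<^sup>2 else 0))"

lemma heckeR_entry: "heckeR pos h $ (c, d) $ (a, b) =
     (if c = b \<and> d = a then (if a = b then 1 else 1 / h) else 0) +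
     (if c = a \<and> d = b \<and> pos b < pos a then 1 - 1 / h\<^sup>2 else 0)"
  by (simp add: heckeR_def)

definition heckeRi :: "('n::finite \<Rightarrow> nat) \<Rightarrow> complex \<Rightarrow> complex ^ ('n \<times> 'n) ^ ('n \<times> 'n)" where
  "heckeRi pos h = (\<chi> x y. h\<^sup>2 * heckeR pos h $ x $ y + (1 - h\<^sup>2) * (if x = y then 1 else 0))"

lemma heckeRi_entry:
  assumes "h \<noteq> 0" "inj pos"
  shows "heckeRi pos h $ (c, d) $ (a, b) =
     (if c = b \<and> d = a then (if a = b then 1 else h) else 0) +
     (if c = a \<and> d = b \<and> pos a < pos b then 1 - h\<^sup>2 else 0)"
proof -
  have "pos a = pos b \<longleftrightarrow> a = b" using assms(2) by (auto dest: injD)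
  then show ?thesis using assms(1)
    by (cases "pos a" "pos b" rule: linorder_cases)
      (auto simp: heckeRi_def heckeR_entry field_simps power2_eq_square)
qed

definition dualK :: "complex ^ ('n::finite \<times> 'n) ^ ('n \<times> 'n) \<Rightarrow> complex ^ ('n \<times> 'n) ^ ('n \<times> 'n)" where
  "dualK R = (\<chi> x y. R $ (fst y, fst x) $ (snd y, snd x))"
definition dualRs :: "complex ^ ('n::finite \<times> 'n) ^ ('n \<times> 'n) \<Rightarrow> complex ^ ('n \<times> 'n) ^ ('n \<times> 'n)" where
  "dualRs R = (\<chi> x y. R $ (snd y, fst y) $ (snd x, fst x))"

lemma dualK_entry: "dualK R $ (c, d) $ (a, b) = R $ (a, c) $ (b, d)" by (simp add: dualK_def)
lemma dualRs_entry: "dualRs R $ (c, d) $ (a, b) = R $ (b, a) $ (d, c)" by (simp add: dualRs_def)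

definition dualM :: "('n::finite \<Rightarrow> nat) \<Rightarrow> complex \<Rightarrow> complex ^ ('n \<times> 'n) ^ ('n \<times> 'n)" where
  "dualM pos h = (\<chi> x y. (1 / h\<^sup>2) ^ pos (snd y) / (1 / h\<^sup>2) ^ pos (fst x) *
      heckeRi pos h $ (snd x, snd y) $ (fst x, fst y))"

lemma opL_heckeR:
  fixes z :: "(nat \<Rightarrow> 'n::finite) \<Rightarrow> 'm::complex_vector"
  shows "opL k (heckeR pos h) z f =
    (if f k = f (Suc k) then 1 else 1 / h) *\<^sub>C z (f(k := f (Suc k), Suc k := f k)) +
    (if pos (f (Suc k)) < pos (f k) then 1 - 1 / h\<^sup>2 else 0) *\<^sub>C z f"
proof -
  have "opL k (heckeR pos h) z f =
     (\<Sum>a\<in>UNIV. \<Sum>b\<in>UNIV. (if b = f k then if a = f (Suc k) then (if a = b then 1 else 1 / h) *\<^sub>C z (f(k := a, Suc k := b)) else 0 else 0))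
   + (\<Sum>a\<in>UNIV. \<Sum>b\<in>UNIV. (if b = f (Suc k) then if a = f k then (if pos b < pos a then 1 - 1 / h\<^sup>2 else 0) *\<^sub>C z (f(k := a, Suc k := b)) else 0 else 0))"
    unfolding opL_def sum.distrib[symmetric] by (intro sum.cong refl) (auto simp: heckeR_entry scaleC_add_left)
  also have "\<dots> = (if f k = f (Suc k) then 1 else 1 / h) *\<^sub>C z (f(k := f (Suc k), Suc k := f k)) +
    (if pos (f (Suc k)) < pos (f k) then 1 - 1 / h\<^sup>2 else 0) *\<^sub>C z f"
    by (simp add: sum.delta eq_commute)
  finally show ?thesis .
qed

text \<open>
  Entries of a braid word are its values on delta tensors; so the braid relation can be checked on operators, each of
  which has only two terms.
\<close>

lemma braid_left_eq_opL:
  fixes A B C :: "complex ^ ('n::finite \<times> 'n) ^ ('n \<times> 'n)"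
  defines "f i j k \<equiv> (\<lambda>x. if x = (0::nat) then i else if x = 1 then j else k)"
  defines "z a b c g \<equiv> (if g (0::nat) = a \<and> g 1 = b \<and> g 2 = c then 1 else 0 :: complex)"
  shows "braid_left A B C i j k a b c = opL 0 A (opL (Suc 0) B (opL 0 C (z a b c))) (f i j k)"
    and "braid_right A B C i j k a b c = opL (Suc 0) A (opL 0 B (opL (Suc 0) C (z a b c))) (f i j k)"
proof -
  have ext: "(\<Sum>a'\<in>UNIV. \<Sum>b'\<in>UNIV. \<Sum>c'\<in>UNIV. F a' b' c' *\<^sub>C z a b c ((f i j k)(0 := a', Suc 0 := b', Suc (Suc 0) := c'))) = F a b c"
    for F :: "'n \<Rightarrow> 'n \<Rightarrow> 'n \<Rightarrow> complex"
  proof -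
    have "(\<Sum>a'\<in>UNIV. \<Sum>b'\<in>UNIV. \<Sum>c'\<in>UNIV. F a' b' c' *\<^sub>C z a b c ((f i j k)(0 := a', Suc 0 := b', Suc (Suc 0) := c')))
      = (\<Sum>a'\<in>UNIV. \<Sum>b'\<in>UNIV. \<Sum>c'\<in>UNIV. if c' = c then (if b' = b then if a' = a then F a' b' c' else 0 else 0) else 0)"
      by (intro sum.cong refl) (auto simp: z_def scaleC_complex_def numeral_2_eq_2)
    then show ?thesis by (simp add: sum.delta)
  qed
  show "braid_left A B C i j k a b c = opL 0 A (opL (Suc 0) B (opL 0 C (z a b c))) (f i j k)"
    unfolding opL_braid_left ext by (simp add: f_def)
  show "braid_right A B C i j k a b c = opL (Suc 0) A (opL 0 B (opL (Suc 0) C (z a b c))) (f i j k)"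
    unfolding opL_braid_right ext by (simp add: f_def)
qed

text \<open>
  Crossings only permute the three indices or keep them, with factors that depend on their order, so that
  the relation is a polynomial identity for each relative order of three indices.
\<close>

lemma heckeR_braid:
  fixes pos :: "'n::finite \<Rightarrow> nat"
  assumes h: "h \<noteq> 0" and inj: "inj pos"
  shows "braid_left (heckeR pos h) (heckeR pos h) (heckeR pos h) =
    braid_right (heckeR pos h) (heckeR pos h) (heckeR pos h)"
proof -
  let ?R = "heckeR pos h"
  have eq: "pos a = pos b \<longleftrightarrow> a = b" for a b using inj by (auto dest: injD)
  define u where "u = 1 / h"
  define al where "al a b = (if a = b then 1 else u)" for a b :: 'n
  define be where "be a b = (if pos b < pos a then 1 - u * u else 0)" for a b :: 'n
  define r1 where "r1 Z i j k = al i j * Z j i k + be i j * Z i j k" for Z :: "'n \<Rightarrow> 'n \<Rightarrow> 'n \<Rightarrow> complex" and i j k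
  define r2 where "r2 Z i j k = al j k * Z i k j + be j k * Z i j k" for Z :: "'n \<Rightarrow> 'n \<Rightarrow> 'n \<Rightarrow> complex" and i j k
  have op1: "opL 0 ?R (\<lambda>g. Z (g 0) (g (Suc 0)) (g (Suc (Suc 0)))) = (\<lambda>g. r1 Z (g 0) (g (Suc 0)) (g (Suc (Suc 0))))" for Z
    by (rule ext, subst opL_heckeR)
      (simp add: r1_def al_def be_def u_def scaleC_complex_def power2_eq_square)
  have op2: "opL (Suc 0) ?R (\<lambda>g. Z (g 0) (g (Suc 0)) (g (Suc (Suc 0)))) = (\<lambda>g. r2 Z (g 0) (g (Suc 0)) (g (Suc (Suc 0))))" for Z
    by (rule ext, subst opL_heckeR)
      (simp add: r2_def al_def be_def u_def scaleC_complex_def power2_eq_square)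
  have yb: "r1 (r2 (r1 Z)) i j k = r2 (r1 (r2 Z)) i j k" for Z i j k
  proof -
    have al_same: "al a a = 1" and al_ne: "pos a < pos b \<Longrightarrow> al a b = u" "pos a < pos b \<Longrightarrow> al b a = u" for a b
      by (auto simp: al_def)
    have be_le: "be a a = 0" "pos a < pos b \<Longrightarrow> be a b = 0" "pos a < pos b \<Longrightarrow> be b a = 1 - u * u" for a b
      by (auto simp: be_def)
    have tri: "a = b \<or> pos a < pos b \<or> pos b < pos a" for a b using eq[of a b] by linarith
    show ?thesis
      using tri[of i j] tri[of j k] tri[of i k]
      by (elim disjE; (linarith | (simp add: r1_def r2_def al_same al_ne be_le, (simp add: algebra_simps)?)))
  qed
  have key: "opL 0 ?R (opL (Suc 0) ?R (opL 0 ?R (\<lambda>g. Z (g 0) (g (Suc 0)) (g (Suc (Suc 0)))))) f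
    = opL (Suc 0) ?R (opL 0 ?R (opL (Suc 0) ?R (\<lambda>g. Z (g 0) (g (Suc 0)) (g (Suc (Suc 0)))))) f"
    for Z :: "'n \<Rightarrow> 'n \<Rightarrow> 'n \<Rightarrow> complex" and f
    by (simp only: op1 op2 yb)
  show ?thesis
  proof (intro ext)
    fix i j k a b c
    show "braid_left ?R ?R ?R i j k a b c = braid_right ?R ?R ?R i j k a b c"
      unfolding braid_left_eq_opL
      using key[of "\<lambda>x y z. if x = a \<and> y = b \<and> z = c then 1 else 0"]
      by (simp add: numeral_2_eq_2)
  qed
qed

lemma geo_sum_pos:
  fixes pos :: "'n::finite \<Rightarrow> nat" and u :: complex
  assumes bij: "bij_betw pos UNIV {..<CARD('n)}"
  shows "(1 - u) * (\<Sum>a\<in>UNIV. if pos a < pos b then u ^ pos a else 0) = 1 - u ^ pos b"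
    and "pos b < pos d \<Longrightarrow> (1 - u) * (\<Sum>a\<in>UNIV. if pos b < pos a \<and> pos a < pos d then u ^ pos a else 0) = u ^ Suc (pos b) - u ^ pos d"
proof -
  have lt: "pos a < CARD('n)" for a using bij by (auto simp: bij_betw_def)
  have re: "(\<Sum>a\<in>UNIV. g (pos a)) = (\<Sum>k<CARD('n). g k)" for g :: "nat \<Rightarrow> complex"
    using sum.reindex_bij_betw[OF bij, of g] .
  have r1: "(\<Sum>a\<in>UNIV. if pos a < m then u ^ pos a else 0) = (\<Sum>k<m. u ^ k)" if "m \<le> CARD('n)" for m
  proof -
    have "(\<Sum>a\<in>UNIV. if pos a < m then u ^ pos a else 0) = (\<Sum>k<CARD('n). if k < m then u ^ k else 0)"
      by (rule re)
    also have "\<dots> = (\<Sum>k<m. u ^ k)"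
      using that by (intro sum.mono_neutral_cong_right) auto
    finally show ?thesis .
  qed
  have g: "(1 - u) * (\<Sum>k<m. u ^ k) = 1 - u ^ m" for m
    by (simp add: one_diff_power_eq)
  show "(1 - u) * (\<Sum>a\<in>UNIV. if pos a < pos b then u ^ pos a else 0) = 1 - u ^ pos b"
    using r1[of "pos b"] g[of "pos b"] lt[of b] by simp
  assume bd: "pos b < pos d"
  have "(\<Sum>a\<in>UNIV. if pos b < pos a \<and> pos a < pos d then u ^ pos a else 0)
     = (\<Sum>a\<in>UNIV. if pos a < pos d then u ^ pos a else 0) - (\<Sum>a\<in>UNIV. if pos a < Suc (pos b) then u ^ pos a else 0)"
    unfolding sum_subtractf[symmetric] using bd by (intro sum.cong refl) auto
  then show "(1 - u) * (\<Sum>a\<in>UNIV. if pos b < pos a \<and> pos a < pos d then u ^ pos a else 0) = u ^ Suc (pos b) - u ^ pos d"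
    using r1[of "pos d"] r1[of "Suc (pos b)"] lt[of b] lt[of d] g[of "pos d"] g[of "Suc (pos b)"]
    by (simp add: right_diff_distrib)
qed

text \<open>
  Only \<open>i = b\<close>, \<open>d = g\<close> gives a sum of more than one term.  Off the diagonal there the sum consists of two boundary
  terms and a geometric series over the positions strictly between \<open>b\<close> and \<open>d\<close>, and these telescope to zero.
\<close>

lemma heckeR_cross:
  fixes pos :: "'n::finite \<Rightarrow> nat"
  assumes h: "h \<noteq> 0" and bij: "bij_betw pos UNIV {..<CARD('n)}"
  shows "(\<Sum>a\<in>UNIV. \<Sum>c\<in>UNIV. (1 / h\<^sup>2) ^ pos a * heckeRi pos h $ (i, a) $ (b, c) * dualK (heckeR pos h) $ (c, a) $ (d, g))
        = (if b = d \<and> i = g then (1 / h\<^sup>2) ^ pos b else 0)"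
proof (cases "i = b \<and> d = g")
  case False
  have inj: "inj pos" using bij by (simp add: bij_betw_def)
  have "(\<Sum>a\<in>UNIV. \<Sum>c\<in>UNIV. (1 / h\<^sup>2) ^ pos a * heckeRi pos h $ (i, a) $ (b, c) * dualK (heckeR pos h) $ (c, a) $ (d, g))
    = (\<Sum>a\<in>UNIV. \<Sum>c\<in>UNIV. if c = i then if a = b then (if b = d \<and> i = g then (1 / h\<^sup>2) ^ pos b else 0) else 0 else 0)"
  proof (intro sum.cong refl)
    fix a c
    have entry: "heckeRi pos h $ (i, a) $ (b, c) * dualK (heckeR pos h) $ (c, a) $ (d, g) =
      (if c = i \<and> a = b \<and> b = d \<and> i = g then 1 else 0)"
    proof (cases "c = i \<and> a = b")
      case True
      then show ?thesis using False h
        by (cases "b = d"; cases "i = g"; cases "b = i"; simp add: heckeRi_entry[OF h inj] dualK_entry heckeR_entry)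
    next
      case ne: False
      show ?thesis
      proof (cases "i = b \<and> a = c")
        case True
        then show ?thesis using False ne
          by (auto simp add: heckeRi_entry[OF h inj] dualK_entry heckeR_entry)
      next
        case False
        have "\<not> (i = c \<and> a = b)" "\<not> (i = b \<and> a = c \<and> pos b < pos c)"
          using False ne by blast+
        then have "heckeRi pos h $ (i, a) $ (b, c) = 0"
          unfolding heckeRi_entry[OF h inj] by (simp only: if_False add_0_right)
        then show ?thesis using ne by (simp only: mult_zero_left) auto
      qed
    qed
    show "(1 / h\<^sup>2) ^ pos a * heckeRi pos h $ (i, a) $ (b, c) * dualK (heckeR pos h) $ (c, a) $ (d, g)
      = (if c = i then if a = b then (if b = d \<and> i = g then (1 / h\<^sup>2) ^ pos b else 0) else 0 else 0)"
      unfolding mult.assoc entry by (cases "c = i"; cases "a = b"; cases "b = d"; cases "i = g") simp_all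
  qed
  then show ?thesis by (simp add: sum.delta)
next
  case True
  have inj: "inj pos" using bij by (simp add: bij_betw_def)
  let ?u = "1 / h\<^sup>2"
  have "(\<Sum>a\<in>UNIV. \<Sum>c\<in>UNIV. ?u ^ pos a * heckeRi pos h $ (i, a) $ (b, c) * dualK (heckeR pos h) $ (c, a) $ (d, g))
    = (\<Sum>a\<in>UNIV. \<Sum>c\<in>UNIV. if c = a then ?u ^ pos a *
        ((if a = b then 1 else 0) + (if pos b < pos a then 1 - h\<^sup>2 else 0)) *
        ((if a = d then 1 else 0) + (if pos a < pos d then 1 - ?u else 0)) else 0)"
    using True by (intro sum.cong refl) (auto simp: heckeRi_entry[OF h inj] dualK_entry heckeR_entry)
  also have "\<dots> = (\<Sum>a\<in>UNIV. ?u ^ pos a *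
        ((if a = b then 1 else 0) + (if pos b < pos a then 1 - h\<^sup>2 else 0)) *
        ((if a = d then 1 else 0) + (if pos a < pos d then 1 - ?u else 0)))"
    by (simp add: sum.delta)
  also have "\<dots> = (\<Sum>a\<in>UNIV. (if a = b then ?u ^ pos b * ((if b = d then 1 else 0) + (if pos b < pos d then 1 - ?u else 0)) else 0)
     + (if a = d then ?u ^ pos d * (if pos b < pos d then 1 - h\<^sup>2 else 0) else 0)
     + (1 - h\<^sup>2) * (1 - ?u) * (if pos b < pos a \<and> pos a < pos d then ?u ^ pos a else 0))"
    by (intro sum.cong refl) auto
  also have "\<dots> = ?u ^ pos b * ((if b = d then 1 else 0) + (if pos b < pos d then 1 - ?u else 0))
     + ?u ^ pos d * (if pos b < pos d then 1 - h\<^sup>2 else 0)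
     + (1 - h\<^sup>2) * ((1 - ?u) * (\<Sum>a\<in>UNIV. if pos b < pos a \<and> pos a < pos d then ?u ^ pos a else 0))"
    by (simp add: sum.distrib sum.delta sum_distrib_left mult.assoc)
  also have "\<dots> = (if b = d then ?u ^ pos b else 0)"
  proof (cases "pos b < pos d")
    case True
    then have geo: "(1 - ?u) * (\<Sum>a\<in>UNIV. if pos b < pos a \<and> pos a < pos d then ?u ^ pos a else 0) = ?u ^ Suc (pos b) - ?u ^ pos d"
      using geo_sum_pos(2)[OF bij] by blast
    have tele: "X * (1 - v) + Y * (1 - H) + (1 - H) * (v * X - Y) = 0" if "H * v = 1" for X Y H v :: complex
      using that by algebra
    have "b \<noteq> d" using True by auto
    moreover have "h\<^sup>2 * ?u = 1" using h by simp
    ultimately show ?thesis unfolding geo power_Suc using True tele[of "h\<^sup>2" ?u "?u ^ pos b" "?u ^ pos d"] by simp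
  next
    case False
    then have "(if pos b < pos a \<and> pos a < pos d then ?u ^ pos a else 0) = 0" for a by auto
    with False show ?thesis by simp
  qed
  finally show ?thesis using True by auto
qed

text \<open>
  The invertibility of \<open>K\<close> and both crossing identities reduce to \<open>heckeR_cross\<close>: \<open>dualM\<close> is defined as the matrix that
  this identity exhibits as an inverse, and the identity for \<open>Rs\<close> follows because \<open>R\<close> preserves weights.
\<close>

lemma heckeR_braided_legs:
  fixes pos :: "'n::finite \<Rightarrow> nat"
  assumes h: "h \<noteq> 0" and bij: "bij_betw pos UNIV {..<CARD('n)}"
  shows "braided_legs (heckeR pos h) (heckeRi pos h) (dualRs (heckeR pos h)) (dualRs (heckeRi pos h))
    (dualK (heckeR pos h)) (dualM pos h) (\<lambda>a. (1 / h\<^sup>2) ^ pos a) (h\<^sup>2)"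
proof -
  have inj: "inj pos" using bij by (simp add: bij_betw_def)
  let ?R = "heckeR pos h" and ?Ri = "heckeRi pos h" and ?e = "\<lambda>a. (1 / h\<^sup>2) ^ pos a"
  have e0: "?e a \<noteq> 0" for a using h by simp
  have RiR: "?Ri ** ?R = mat 1"
  proof -
    have eq: "pos a = pos b \<longleftrightarrow> a = b" for a b using inj by (auto dest: injD)
    have "(?Ri ** ?R) $ (i, j) $ (a, b) = mat 1 $ (i, j) $ (a, b)" for i j a b
    proof -
      have "(?Ri ** ?R) $ (i, j) $ (a, b) = (\<Sum>c\<in>UNIV. \<Sum>d\<in>UNIV.
          (if d = i then if c = j then (if i = j then 1 else h) * ?R $ (j, i) $ (a, b) else 0 else 0)
        + (if d = j then if c = i then (if pos i < pos j then 1 - h\<^sup>2 else 0) * ?R $ (i, j) $ (a, b) else 0 else 0))"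
        unfolding matrix_matrix_mult_def sum_pair_UNIV vec_lambda_beta
        by (intro sum.cong refl) (auto simp: heckeRi_entry[OF h inj])
      also have "\<dots> = (if i = j then 1 else h) * ?R $ (j, i) $ (a, b) + (if pos i < pos j then 1 - h\<^sup>2 else 0) * ?R $ (i, j) $ (a, b)"
        by (simp add: sum.distrib sum.delta)
      also have "\<dots> = mat 1 $ (i, j) $ (a, b)"
        using h by (cases "pos i" "pos j" rule: linorder_cases; cases "a = i"; cases "b = j"; cases "a = j"; cases "b = i")
          (auto simp: heckeR_entry mat_def eq field_simps power2_eq_square)
      finally show ?thesis .
    qed
    then show ?thesis by (simp add: vec_eq_iff split_paired_All)
  qed
  have MK: "dualM pos h ** dualK ?R = mat 1"
  proof -
    have "(dualM pos h ** dualK ?R) $ (b, i) $ (d, g) = mat 1 $ (b, i) $ (d, g)" for b i d g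
    proof -
      have "(dualM pos h ** dualK ?R) $ (b, i) $ (d, g) =
        (\<Sum>c\<in>UNIV. \<Sum>a\<in>UNIV. ?e a / ?e b * ?Ri $ (i, a) $ (b, c) * dualK ?R $ (c, a) $ (d, g))"
        by (simp add: matrix_matrix_mult_def sum_pair_UNIV dualM_def)
      also have "\<dots> = (\<Sum>a\<in>UNIV. \<Sum>c\<in>UNIV. ?e a * ?Ri $ (i, a) $ (b, c) * dualK ?R $ (c, a) $ (d, g)) / ?e b"
        by (subst sum.swap) (simp add: sum_divide_distrib)
      also have "\<dots> = (if b = d \<and> i = g then 1 else 0)"
        using e0 by (simp only: heckeR_cross[OF h bij]) simp
      finally show ?thesis by (simp add: mat_def)
    qed
    then show ?thesis by (simp add: vec_eq_iff split_paired_All)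
  qed
  show ?thesis
  proof
    show "h\<^sup>2 \<noteq> 0" using h by simp
    show "?Ri ** ?R = mat 1" by fact
    show "dualRs ?Ri ** dualRs ?R = mat 1"
    proof -
      have RRi: "?R ** ?Ri = mat 1" using RiR matrix_left_right_inverse by blast
      have "(dualRs ?Ri ** dualRs ?R) $ (a, b) $ (c, d) = mat 1 $ (a, b) $ (c, d)" for a b c d
      proof -
        have "(dualRs ?Ri ** dualRs ?R) $ (a, b) $ (c, d) = (\<Sum>u\<in>UNIV. \<Sum>v\<in>UNIV. ?Ri $ (v, u) $ (b, a) * ?R $ (d, c) $ (v, u))"
          by (simp add: matrix_matrix_mult_def sum_pair_UNIV dualRs_entry)
        also have "\<dots> = (\<Sum>v\<in>UNIV. \<Sum>u\<in>UNIV. ?R $ (d, c) $ (v, u) * ?Ri $ (v, u) $ (b, a))"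
          by (subst sum.swap) (simp add: mult.commute)
        also have "\<dots> = (?R ** ?Ri) $ (d, c) $ (b, a)"
          by (simp add: matrix_matrix_mult_def sum_pair_UNIV)
        finally show ?thesis by (auto simp: RRi mat_def)
      qed
      then show ?thesis by (simp add: vec_eq_iff split_paired_All)
    qed
    show "dualM pos h ** dualK ?R = mat 1" by fact
    then show "dualK ?R ** dualM pos h = mat 1" using matrix_left_right_inverse by blast
    show "?Ri $ x $ y = h\<^sup>2 * ?R $ x $ y + (1 - h\<^sup>2) * (if x = y then 1 else 0)" for x y
      by (simp add: heckeRi_def)
    show "dualRs ?Ri $ x $ y = h\<^sup>2 * dualRs ?R $ x $ y + (1 - h\<^sup>2) * (if x = y then 1 else 0)" for x y
      by (cases x; cases y) (auto simp: dualRs_entry heckeRi_def)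
    show "braid_left ?R ?R ?R = braid_right ?R ?R ?R" by (rule heckeR_braid[OF h inj])
    show "(\<Sum>a\<in>UNIV. \<Sum>c\<in>UNIV. ?e a * ?Ri $ (i, a) $ (b, c) * dualK ?R $ (c, a) $ (d, g))
        = (if b = d \<and> i = g then ?e b else 0)" for i b d g
      by (rule heckeR_cross[OF h bij])
    show "(\<Sum>a\<in>UNIV. \<Sum>b\<in>UNIV. ?e a * dualRs ?Ri $ (a, l) $ (b, c) * dualK ?R $ (a, b) $ (d, g))
        = (if g = c \<and> l = d then ?e g else 0)" for l c d g
    proof -
      have wt: "?e a * ?Ri $ (c, b) $ (l, a) = ?e c / ?e l * (?e b * ?Ri $ (c, b) $ (l, a))" for a b
        using e0 h by (auto simp: heckeRi_entry[OF h inj] field_simps)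
      have "(\<Sum>a\<in>UNIV. \<Sum>b\<in>UNIV. ?e a * dualRs ?Ri $ (a, l) $ (b, c) * dualK ?R $ (a, b) $ (d, g))
        = (\<Sum>a\<in>UNIV. \<Sum>b\<in>UNIV. ?e c / ?e l * (?e b * ?Ri $ (c, b) $ (l, a) * dualK ?R $ (a, b) $ (d, g)))"
        by (simp only: dualRs_entry wt mult.assoc)
      also have "\<dots> = ?e c / ?e l * (\<Sum>b\<in>UNIV. \<Sum>a\<in>UNIV. ?e b * ?Ri $ (c, b) $ (l, a) * dualK ?R $ (a, b) $ (d, g))"
        by (subst sum.swap) (simp only: sum_distrib_left)
      also have "\<dots> = (if g = c \<and> l = d then ?e g else 0)"
        using e0 by (simp only: heckeR_cross[OF h bij]) auto
      finally show ?thesis .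
    qed
    show "(\<Sum>a\<in>UNIV. ?e a * dualK ?R $ (a, a) $ (b, c)) = (if b = c then 1 else 0)" for b c
    proof (cases "b = c")
      case True
      have "(\<Sum>a\<in>UNIV. ?e a * dualK ?R $ (a, a) $ (b, c)) =
         (\<Sum>a\<in>UNIV. (if a = b then ?e b else 0) + (1 - 1 / h\<^sup>2) * (if pos a < pos b then ?e a else 0))"
        using True by (intro sum.cong refl) (auto simp: dualK_entry heckeR_entry)
      also have "\<dots> = ?e b + (1 - ?e b)"
        by (simp add: sum.distrib sum.delta sum_distrib_left[symmetric] geo_sum_pos(1)[OF bij] del: power_one_over)
      finally show ?thesis using True by simp
    next
      case False
      then have "dualK ?R $ (a, a) $ (b, c) = 0" for a by (auto simp: dualK_entry heckeR_entry)
      with False show ?thesis by simp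
    qed
    show "?e a * ?e b * ?R $ (a, b) $ (c, d) = ?e c * ?e d * ?R $ (a, b) $ (c, d)" for a b c d
      by (auto simp: heckeR_entry)
  qed (simp_all add: dualK_entry dualRs_entry)
qed

section \<open>Modules that are chains of weight vectors\<close>

lemma matrix_inv_eqI:
  fixes A B :: "complex ^ 'n::finite ^ 'n"
  assumes "A ** B = mat 1"
  shows "matrix_inv A = B" "invertible A"
proof -
  have BA: "B ** A = mat 1" using assms matrix_left_right_inverse by blast
  show inv: "invertible A" unfolding invertible_def using assms BA by blast
  then have "A ** matrix_inv A = mat 1 \<and> matrix_inv A ** A = mat 1"
    unfolding matrix_inv_def invertible_def by (rule someI_ex)
  then have "matrix_inv A ** (A ** B) = B" by (simp add: matrix_mul_assoc)
  then show "matrix_inv A = B" by (simp add: assms)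
qed

lemma matrix_inv_cancel:
  fixes A :: "complex ^ 'n::finite ^ 'n"
  assumes "invertible A"
  shows "A ** matrix_inv A = mat 1" "matrix_inv A ** A = mat 1"
proof -
  have "A ** matrix_inv A = mat 1 \<and> matrix_inv A ** A = mat 1"
    unfolding matrix_inv_def using assms unfolding invertible_def by (rule someI_ex)
  then show "A ** matrix_inv A = mat 1" "matrix_inv A ** A = mat 1" by blast+
qed

lemma wform_simple_root:
  assumes "i \<in> {1..r}" shows "wform r (simple_root i) x = x i - x (i + 1)"
proof -
  have "wform r (simple_root i) x = (\<Sum>k = 1..r+1. (if k = i then x k else 0) - (if k = i + 1 then x k else 0))"
    unfolding wform_def simple_root_def by (intro sum.cong refl) auto
  also have "\<dots> = x i - x (i + 1)" using assms by (simp add: sum_subtractf sum.delta)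
  finally show ?thesis .
qed

lemma cartan_entry:
  assumes "i \<in> {1..r}" "j \<in> {1..r}"
  shows "wform r (simple_root i) (simple_root j) =
    (if i = j then 2 else if i = j + 1 \<or> j = i + 1 then - 1 else 0)"
  using assms by (simp add: wform_simple_root) (simp add: simple_root_def)

lemma wform_simple_fundamental:
  assumes "i \<in> {1..r}" "j \<in> {1..r}"
  shows "wform r (simple_root i) (fundamental_weight r j) = (if i = j then 1 else 0)"
  using assms by (simp add: wform_simple_root) (auto simp add: fundamental_weight_def)

text \<open>
  The exponent of the eigenvalue of \<open>K\<^sub>i\<close> on the vector at position \<open>k\<close>.
\<close>

definition kexp :: "(nat \<Rightarrow> nat) \<Rightarrow> nat \<Rightarrow> nat \<Rightarrow> real" where
  "kexp \<tau> i k = (if Suc k = \<tau> i then 1 else if k = \<tau> i then - 1 else 0)"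

text \<open>
  The matrices of a representation in which \<open>F\<^sub>i\<close> steps from position \<open>\<tau> i - 1\<close> to position \<open>\<tau> i\<close> and \<open>E\<^sub>i\<close> steps back,
  with the basis being the coordinate axes in the order given by \<open>pos\<close>, highest weight first.  For \<open>\<tau> = id\<close>
  this is \<open>V(\<omega>\<^sub>1)\<close>, and for the reversal it is \<open>V(\<omega>\<^sub>r)\<close>.  The basis vectors are fixed only up to scalars,
  hence the free factors \<open>c i\<close>.
\<close>

definition chain_module :: "nat \<Rightarrow> real \<Rightarrow> 'n::finite uq_action \<Rightarrow> ('n \<Rightarrow> nat) \<Rightarrow> (nat \<Rightarrow> nat) \<Rightarrow> (nat \<Rightarrow> complex) \<Rightarrow> bool" where
  "chain_module r q X pos \<tau> c \<longleftrightarrow>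
     bij_betw pos UNIV {..r} \<and> ((\<forall>i\<in>{1..r}. \<tau> i = i) \<or> (\<forall>i\<in>{1..r}. \<tau> i = r + 1 - i)) \<and>
     (\<forall>i\<in>{1..r}. c i \<noteq> 0 \<and>
        (\<forall>a b. actK X i $ a $ b = (if a = b then qpow q (kexp \<tau> i (pos a)) else 0) \<and>
               actE X i $ a $ b = (if Suc (pos a) = \<tau> i \<and> pos b = \<tau> i then c i else 0) \<and>
               actF X i $ a $ b = (if pos a = \<tau> i \<and> Suc (pos b) = \<tau> i then 1 / c i else 0)))"

lemma qpow_0 [simp]: "q > 0 \<Longrightarrow> qpow q 0 = 1"
  and qpow_1 [simp]: "q > 0 \<Longrightarrow> qpow q 1 = complex_of_real q"
  and qpow_add: "qpow q (x + y) = qpow q x * qpow q y"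
  and qpow_nz [simp]: "q > 0 \<Longrightarrow> qpow q x \<noteq> 0"
  and qpow_minus: "qpow q (- x) = 1 / qpow q x"
  and qpow_neg1 [simp]: "q > 0 \<Longrightarrow> qpow q (- 1) = 1 / complex_of_real q"
  and qpow_2: "q > 0 \<Longrightarrow> qpow q 2 = (complex_of_real q)\<^sup>2"
  by (simp_all add: qpow_def powr_add powr_minus field_simps)

lemma qpow_inj: "0 < q \<Longrightarrow> q < 1 \<Longrightarrow> qpow q x = qpow q y \<longleftrightarrow> x = y"
  by (auto simp: qpow_def powr_inj)

lemma tau_facts:
  fixes \<tau> :: "nat \<Rightarrow> nat"
  assumes "(\<forall>i\<in>{1..r}. \<tau> i = i) \<or> (\<forall>i\<in>{1..r}. \<tau> i = r + 1 - i)"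
  shows "\<And>i. i \<in> {1..r} \<Longrightarrow> \<tau> i \<in> {1..r}" "\<And>i. i \<in> {1..r} \<Longrightarrow> \<tau> (\<tau> i) = i"
    "\<And>i j. i \<in> {1..r} \<Longrightarrow> j \<in> {1..r} \<Longrightarrow> (i = j + 1 \<or> j = i + 1) = (\<tau> i = \<tau> j + 1 \<or> \<tau> j = \<tau> i + 1)"
    "\<And>i j. i \<in> {1..r} \<Longrightarrow> j \<in> {1..r} \<Longrightarrow> \<tau> i = \<tau> j \<longleftrightarrow> i = j"
proof -
  have t: "\<tau> i \<in> {1..r} \<and> \<tau> (\<tau> i) = i" if "i \<in> {1..r}" for i
    using assms
  proof
    assume "\<forall>i\<in>{1..r}. \<tau> i = i" then show ?thesis using that by simp
  next
    assume *: "\<forall>i\<in>{1..r}. \<tau> i = r + 1 - i"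
    then have "\<tau> i = r + 1 - i" using that by blast
    moreover have "r + 1 - i \<in> {1..r}" using that by auto
    ultimately show ?thesis using that * by simp
  qed
  show "i \<in> {1..r} \<Longrightarrow> \<tau> i \<in> {1..r}" for i using t by blast
  show "i \<in> {1..r} \<Longrightarrow> \<tau> (\<tau> i) = i" for i
    using t[of i] by blast
  show "(i = j + 1 \<or> j = i + 1) = (\<tau> i = \<tau> j + 1 \<or> \<tau> j = \<tau> i + 1)" if "i \<in> {1..r}" "j \<in> {1..r}" for i j
    using assms
  proof
    assume "\<forall>i\<in>{1..r}. \<tau> i = i" then show ?thesis using that by simp
  next
    assume "\<forall>i\<in>{1..r}. \<tau> i = r + 1 - i"
    then have "\<tau> i = r + 1 - i" "\<tau> j = r + 1 - j" using that by blast+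
    then show ?thesis using that by auto
  qed
  show "\<tau> i = \<tau> j \<longleftrightarrow> i = j" if "i \<in> {1..r}" "j \<in> {1..r}" for i j
    using assms
  proof
    assume "\<forall>i\<in>{1..r}. \<tau> i = i" then show ?thesis using that by simp
  next
    assume "\<forall>i\<in>{1..r}. \<tau> i = r + 1 - i"
    then have "\<tau> i = r + 1 - i" "\<tau> j = r + 1 - j" using that by blast+
    then show ?thesis using that by auto
  qed
qed

locale chain =
  fixes r q and X :: "'n::finite uq_action" and pos \<tau> c
  assumes q0: "0 < q" and q1: "q < 1" and r1: "r \<ge> 1" and chain_module: "chain_module r q X pos \<tau> c"
begin

lemma bij: "bij_betw pos UNIV {..r}" and tau: "(\<forall>i\<in>{1..r}. \<tau> i = i) \<or> (\<forall>i\<in>{1..r}. \<tau> i = r + 1 - i)"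
  using chain_module by (auto simp: chain_module_def)
lemma c_nz: "i \<in> {1..r} \<Longrightarrow> c i \<noteq> 0"
  and K_entry: "i \<in> {1..r} \<Longrightarrow> actK X i $ a $ b = (if a = b then qpow q (kexp \<tau> i (pos a)) else 0)"
  and E_entry: "i \<in> {1..r} \<Longrightarrow> actE X i $ a $ b = (if Suc (pos a) = \<tau> i \<and> pos b = \<tau> i then c i else 0)"
  and F_entry: "i \<in> {1..r} \<Longrightarrow> actF X i $ a $ b = (if pos a = \<tau> i \<and> Suc (pos b) = \<tau> i then 1 / c i else 0)"
  using chain_module by (simp_all add: chain_module_def)
lemma pos_eq: "pos a = pos b \<longleftrightarrow> a = b" using bij by (auto simp: bij_betw_def dest: injD)
lemma pos_le: "pos a \<le> r" using bij by (auto simp: bij_betw_def)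
lemmas tau_range = tau_facts(1)[OF tau] and tau_tau = tau_facts(2)[OF tau] and tau_adj = tau_facts(3)[OF tau]
  and tau_inj = tau_facts(4)[OF tau]

definition vx :: "nat \<Rightarrow> 'n" where "vx k = (THE a. pos a = k)"
lemma pos_vx: "k \<le> r \<Longrightarrow> pos (vx k) = k"
proof -
  assume "k \<le> r"
  then have "k \<in> range pos" using bij by (simp add: bij_betw_def)
  then obtain a where "pos a = k" by (auto simp: image_iff)
  then show ?thesis unfolding vx_def by (metis (mono_tags, lifting) pos_eq theI)
qed
lemma vx_pos: "vx (pos a) = a" using pos_vx[OF pos_le[of a]] pos_eq by blast

definition lo where "lo i = vx (\<tau> i)"
definition up where "up i = vx (\<tau> i - 1)"

lemma pos_lo: "i \<in> {1..r} \<Longrightarrow> pos (lo i) = \<tau> i" using tau_range[of i] by (simp add: lo_def pos_vx)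
lemma pos_up: "i \<in> {1..r} \<Longrightarrow> Suc (pos (up i)) = \<tau> i"
  using tau_range[of i] pos_vx[of "\<tau> i - 1"] by (simp add: up_def del: One_nat_def) linarith
lemma lo_up: "i \<in> {1..r} \<Longrightarrow> lo i \<noteq> up i" using pos_lo pos_up by (metis n_not_Suc_n)

lemma K_entry': "i \<in> {1..r} \<Longrightarrow> actK X i $ a $ b = (if a = b then (if a = up i then complex_of_real q else if a = lo i then 1 / complex_of_real q else 1) else 0)"
  using pos_up[of i] pos_lo[of i] pos_eq[of a "up i"] pos_eq[of a "lo i"] q0 by (auto simp: K_entry kexp_def)
lemma E_entry': "i \<in> {1..r} \<Longrightarrow> actE X i $ a $ b = (if a = up i \<and> b = lo i then c i else 0)"
  using pos_up[of i] pos_lo[of i] pos_eq[of a "up i"] pos_eq[of b "lo i"] by (auto simp: E_entry)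
lemma F_entry': "i \<in> {1..r} \<Longrightarrow> actF X i $ a $ b = (if a = lo i \<and> b = up i then 1 / c i else 0)"
  using pos_up[of i] pos_lo[of i] pos_eq[of b "up i"] pos_eq[of a "lo i"] by (auto simp: F_entry)

lemma matrix_inv_K: "i \<in> {1..r} \<Longrightarrow> matrix_inv (actK X i) = (\<chi> a b. if a = b then 1 / actK X i $ a $ a else 0)"
  and invertible_K: "i \<in> {1..r} \<Longrightarrow> invertible (actK X i)"
proof -
  assume i: "i \<in> {1..r}"
  have "actK X i ** (\<chi> a b. if a = b then 1 / actK X i $ a $ a else 0) = mat 1"
    unfolding vec_eq_iff
  proof (intro allI)
    fix a b
    have "(actK X i ** (\<chi> a b. if a = b then 1 / actK X i $ a $ a else 0)) $ a $ b =
      (\<Sum>k\<in>UNIV. if k = b then actK X i $ a $ k * (1 / actK X i $ b $ b) else 0)"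
      unfolding matrix_matrix_mult_def vec_lambda_beta by (intro sum.cong refl) auto
    then show "(actK X i ** (\<chi> a b. if a = b then 1 / actK X i $ a $ a else 0)) $ a $ b = mat 1 $ a $ b"
      using q0 by (simp add: sum.delta mat_def K_entry[OF i])
  qed
  then show "matrix_inv (actK X i) = (\<chi> a b. if a = b then 1 / actK X i $ a $ a else 0)" "invertible (actK X i)"
    by (rule matrix_inv_eqI)+
qed

text \<open>
  Dualising reverses the order of the weights, so the class of chains is closed under it.  The antipode contributes the factor
  \<open>- q\<close>.
\<close>

lemma dual_chain: "chain_module r q (dual_action X) (\<lambda>a. r - pos a) (\<lambda>i. r + 1 - \<tau> i) (\<lambda>i. - complex_of_real q * c i)"
  unfolding chain_module_def
proof (intro conjI ballI allI)
  have "bij_betw (\<lambda>k. r - k) {..r} {..r}"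
    by (rule bij_betw_byWitness[where f' = "\<lambda>k. r - k"]) auto
  from bij_betw_trans[OF bij this] show "bij_betw (\<lambda>a. r - pos a) UNIV {..r}" by (simp add: comp_def)
  show "(\<forall>i\<in>{1..r}. r + 1 - \<tau> i = i) \<or> (\<forall>i\<in>{1..r}. r + 1 - \<tau> i = r + 1 - i)"
    using tau by auto
  fix i assume i: "i \<in> {1..r}"
  show "- complex_of_real q * c i \<noteq> 0" using c_nz[OF i] q0 by simp
  fix a b
  note t = tau_range[OF i]
  have ke: "kexp (\<lambda>i. r + 1 - \<tau> i) i (r - pos a) = - kexp \<tau> i (pos a)" for a
    using t pos_le[of a] by (auto simp: kexp_def)
  show "actK (dual_action X) i $ a $ b = (if a = b then qpow q (kexp (\<lambda>i. r + 1 - \<tau> i) i (r - pos a)) else 0)"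
    unfolding ke by (simp add: dual_action_def transpose_def matrix_inv_K[OF i] K_entry[OF i] qpow_minus)
  have pe: "Suc (r - pos a) = r + 1 - \<tau> i \<longleftrightarrow> pos a = \<tau> i" "r - pos a = r + 1 - \<tau> i \<longleftrightarrow> Suc (pos a) = \<tau> i" for a
    using t pos_le[of a] by auto
  have EK: "(actE X i ** matrix_inv (actK X i)) $ b $ a = actE X i $ b $ a / actK X i $ a $ a" for a b
  proof -
    have "(actE X i ** matrix_inv (actK X i)) $ b $ a = (\<Sum>k\<in>UNIV. if k = a then actE X i $ b $ a / actK X i $ a $ a else 0)"
      unfolding matrix_matrix_mult_def vec_lambda_beta matrix_inv_K[OF i] by (intro sum.cong refl) auto
    then show ?thesis by (simp add: sum.delta)
  qed
  have KF: "(actK X i ** actF X i) $ b $ a = actK X i $ b $ b * actF X i $ b $ a" for a b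
  proof -
    have "(actK X i ** actF X i) $ b $ a = (\<Sum>k\<in>UNIV. if k = b then actK X i $ b $ b * actF X i $ b $ a else 0)"
      unfolding matrix_matrix_mult_def vec_lambda_beta by (intro sum.cong refl) (auto simp: K_entry[OF i])
    then show ?thesis by (simp add: sum.delta)
  qed
  show "actE (dual_action X) i $ a $ b = (if Suc (r - pos a) = r + 1 - \<tau> i \<and> r - pos b = r + 1 - \<tau> i then - complex_of_real q * c i else 0)"
    unfolding pe using q0 by (auto simp: dual_action_def transpose_def EK E_entry[OF i] K_entry[OF i] kexp_def)
  show "actF (dual_action X) i $ a $ b = (if r - pos a = r + 1 - \<tau> i \<and> Suc (r - pos b) = r + 1 - \<tau> i then 1 / (- complex_of_real q * c i) else 0)"
    unfolding pe using q0 by (auto simp: dual_action_def transpose_def KF F_entry[OF i] K_entry[OF i] kexp_def)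
qed

definition su :: "complex \<Rightarrow> 'n \<Rightarrow> 'n \<Rightarrow> complex ^ 'n ^ 'n" where
  "su x a b = (\<chi> i j. if i = a \<and> j = b then x else 0)"

lemma su_mult: "su x a b ** su y a' b' = (if b = a' then su (x * y) a b' else 0)"
proof (subst vec_eq_iff, intro allI, subst vec_eq_iff, intro allI)
  fix i j
  have "(su x a b ** su y a' b') $ i $ j = (\<Sum>k\<in>UNIV. if k = b then (if i = a \<and> b = a' \<and> j = b' then x * y else 0) else 0)"
    unfolding matrix_matrix_mult_def vec_lambda_beta su_def by (intro sum.cong refl) auto
  then show "(su x a b ** su y a' b') $ i $ j = (if b = a' then su (x * y) a b' else 0) $ i $ j"
    by (simp add: sum.delta su_def)
qed

lemma su_entry: "su x a b $ i $ j = (if i = a \<and> j = b then x else 0)" by (simp add: su_def)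

lemma E_su: "i \<in> {1..r} \<Longrightarrow> actE X i = su (c i) (up i) (lo i)"
  by (simp add: vec_eq_iff su_entry E_entry')
lemma F_su: "i \<in> {1..r} \<Longrightarrow> actF X i = su (1 / c i) (lo i) (up i)"
  by (simp add: vec_eq_iff su_entry F_entry')

definition kd where "kd i a = qpow q (kexp \<tau> i (pos a))"
lemma kd_nz [simp]: "kd i a \<noteq> 0" using q0 by (simp add: kd_def)

lemma K_mult:
  assumes "i \<in> {1..r}"
  shows "(actK X i ** A) $ a $ b = kd i a * A $ a $ b" "(A ** actK X i) $ a $ b = A $ a $ b * kd i b"
    "(matrix_inv (actK X i) ** A) $ a $ b = A $ a $ b / kd i a" "(A ** matrix_inv (actK X i)) $ a $ b = A $ a $ b / kd i b"
proof -
  have "(actK X i ** A) $ a $ b = (\<Sum>k\<in>UNIV. if k = a then kd i a * A $ a $ b else 0)"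
    "(A ** actK X i) $ a $ b = (\<Sum>k\<in>UNIV. if k = b then A $ a $ b * kd i b else 0)"
    "(matrix_inv (actK X i) ** A) $ a $ b = (\<Sum>k\<in>UNIV. if k = a then A $ a $ b / kd i a else 0)"
    "(A ** matrix_inv (actK X i)) $ a $ b = (\<Sum>k\<in>UNIV. if k = b then A $ a $ b / kd i b else 0)"
    unfolding matrix_matrix_mult_def vec_lambda_beta matrix_inv_K[OF assms] K_entry[OF assms]
    by (intro sum.cong refl; auto simp: kd_def)+
  then show "(actK X i ** A) $ a $ b = kd i a * A $ a $ b" "(A ** actK X i) $ a $ b = A $ a $ b * kd i b"
    "(matrix_inv (actK X i) ** A) $ a $ b = A $ a $ b / kd i a" "(A ** matrix_inv (actK X i)) $ a $ b = A $ a $ b / kd i b"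
    by (simp_all add: sum.delta)
qed

lemma up_eq: "i \<in> {1..r} \<Longrightarrow> j \<in> {1..r} \<Longrightarrow> up i = up j \<longleftrightarrow> i = j"
  and lo_eq: "i \<in> {1..r} \<Longrightarrow> j \<in> {1..r} \<Longrightarrow> lo i = lo j \<longleftrightarrow> i = j"
  and lo_eq_up: "i \<in> {1..r} \<Longrightarrow> j \<in> {1..r} \<Longrightarrow> lo i = up j \<longleftrightarrow> \<tau> j = \<tau> i + 1"
  using pos_up pos_lo tau_inj pos_eq by (metis Suc_eq_plus1 nat.inject)+

lemma kexp_up_lo: "i \<in> {1..r} \<Longrightarrow> j \<in> {1..r} \<Longrightarrow>
   kexp \<tau> i (pos (up j)) - kexp \<tau> i (pos (lo j)) = wform r (simple_root i) (simple_root j)"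
proof -
  assume ij: "i \<in> {1..r}" "j \<in> {1..r}"
  have "wform r (simple_root i) (simple_root j) = (if \<tau> i = \<tau> j then 2 else if \<tau> i = \<tau> j + 1 \<or> \<tau> j = \<tau> i + 1 then - 1 else 0)"
    unfolding cartan_entry[OF ij] tau_adj[OF ij] tau_inj[OF ij] ..
  moreover obtain y where y: "\<tau> j = Suc y" "pos (up j) = y" "pos (lo j) = Suc y"
    using pos_up[OF ij(2)] pos_lo[OF ij(2)] by metis
  ultimately show ?thesis unfolding kexp_def y by simp
qed

text \<open>
  All relations are checked on matrix units.  A product of two operators \<open>E\<close>, or of two operators \<open>F\<close>, is non-zero
  only for neighbouring steps in the right order, and any product of three in the Serre relations vanishes.
\<close>

lemma uq_module: "uq_module r q X"
  unfolding uq_module_def Let_def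
proof (intro conjI ballI impI)
  fix i assume "i \<in> {1..r}" then show "invertible (actK X i)" by (rule invertible_K)
next
  fix i j assume i: "i \<in> {1..r}" and j: "j \<in> {1..r}"
  let ?c = "wform r (simple_root i) (simple_root j)"
  show "actK X i ** actK X j = actK X j ** actK X i"
    by (auto simp: vec_eq_iff K_mult[OF i] K_mult[OF j] K_entry[OF i] K_entry[OF j] kd_def)
  have kud: "kd i (up j) / kd i (lo j) = qpow q ?c" "kd i (lo j) / kd i (up j) = qpow q (- ?c)"
    unfolding kd_def kexp_up_lo[OF i j, symmetric] using q0
    by (simp_all add: qpow_def powr_diff)
  show "actK X i ** actE X j ** matrix_inv (actK X i) = (q powr ?c) *\<^sub>R actE X j"
    using kud(1) unfolding qpow_def by (simp add: vec_eq_iff K_mult[OF i] E_su[OF j] su_entry) (simp add: scaleR_conv_of_real field_simps)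
  show "actK X i ** actF X j ** matrix_inv (actK X i) = (q powr (- ?c)) *\<^sub>R actF X j"
    using kud(2) unfolding qpow_def by (simp add: vec_eq_iff K_mult[OF i] F_su[OF j] su_entry) (simp add: scaleR_conv_of_real field_simps)
  have ul: "up i = lo j \<longleftrightarrow> \<tau> i = \<tau> j + 1" "up j = lo i \<longleftrightarrow> \<tau> j = \<tau> i + 1" "up i = lo i \<longleftrightarrow> False"
    using lo_eq_up[OF i j] lo_eq_up[OF j i] lo_up[OF i] by metis+
  have qq: "complex_of_real q - 1 / complex_of_real q \<noteq> 0"
  proof
    assume "complex_of_real q - 1 / complex_of_real q = 0"
    then have "q - 1 / q = 0" by (metis of_real_1 of_real_diff of_real_divide of_real_eq_0_iff)
    then have "q * q = 1" using q0 by (simp add: field_simps)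
    then show False using q0 q1 by (metis less_irrefl mult_strict_mono' mult.right_neutral order_less_imp_le)
  qed
  show "actE X i ** actF X j - actF X j ** actE X i =
      (if i = j then inverse (q - inverse q) *\<^sub>R (actK X i - matrix_inv (actK X i)) else 0)"
  proof (cases "i = j")
    case False
    then show ?thesis by (simp add: E_su[OF i] F_su[OF j] su_mult up_eq[OF i j] up_eq[OF j i] lo_eq[OF i j])
  next
    case True
    have "inverse (q - inverse q) * (q - 1 / q) = 1"
      using qq by (metis inverse_eq_divide left_inverse of_real_0 of_real_1 of_real_diff of_real_divide)
    then have inv: "complex_of_real (inverse (q - inverse q)) * (complex_of_real q - 1 / complex_of_real q) = 1"
      by (metis of_real_1 of_real_diff of_real_divide of_real_mult)
    have "complex_of_real (inverse (q - inverse q)) * (1 / complex_of_real q - complex_of_real q)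
        = - (complex_of_real (inverse (q - inverse q)) * (complex_of_real q - 1 / complex_of_real q))"
      by (simp only: mult_minus_right[symmetric] minus_diff_eq)
    then have inv2: "complex_of_real (inverse (q - inverse q)) * (1 / complex_of_real q - complex_of_real q) = - 1"
      by (simp only: inv)
    have "(actE X i ** actF X i - actF X i ** actE X i) $ a $ b =
        complex_of_real (inverse (q - inverse q)) * (actK X i - matrix_inv (actK X i)) $ a $ b" for a b
    proof -
      have "(actE X i ** actF X i - actF X i ** actE X i) $ a $ b =
        (if a = b then if a = up i then 1 else if a = lo i then - 1 else 0 else 0)"
        using c_nz[OF i] lo_up[OF i] by (auto simp: E_su[OF i] F_su[OF i] su_mult su_entry)
      also have "\<dots> = complex_of_real (inverse (q - inverse q)) * (if a = b then if a = up i then complex_of_real q - 1 / complex_of_real q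
          else if a = lo i then - (complex_of_real q - 1 / complex_of_real q) else 0 else 0)"
        using inv inv2 by (simp del: of_real_inverse)
      also have "\<dots> = complex_of_real (inverse (q - inverse q)) * (actK X i - matrix_inv (actK X i)) $ a $ b"
        using lo_up[OF i] by (auto simp: matrix_inv_K[OF i] K_entry'[OF i])
      finally show ?thesis .
    qed
    then show ?thesis unfolding True[symmetric] by (simp add: vec_eq_iff) (simp add: scaleR_conv_of_real)
  qed
  show "actE X i ** actE X j = actE X j ** actE X i" if "?c = 0"
    using that unfolding cartan_entry[OF i j] tau_adj[OF i j] by (auto simp: E_su[OF i] E_su[OF j] su_mult lo_eq_up[OF i j] lo_eq_up[OF j i] lo_eq_up[OF i i] split: if_splits)
  show "actF X i ** actF X j = actF X j ** actF X i" if "?c = 0"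
    using that unfolding cartan_entry[OF i j] tau_adj[OF i j] by (auto simp: F_su[OF i] F_su[OF j] su_mult ul split: if_splits)
  show "actE X i ** actE X i ** actE X j - (q + inverse q) *\<^sub>R (actE X i ** actE X j ** actE X i) +
     actE X j ** actE X i ** actE X i = 0"
    by (auto simp: E_su[OF i] E_su[OF j] su_mult lo_eq_up[OF i j] lo_eq_up[OF j i] lo_eq_up[OF i i])
  show "actF X i ** actF X i ** actF X j - (q + inverse q) *\<^sub>R (actF X i ** actF X j ** actF X i) +
     actF X j ** actF X i ** actF X i = 0"
    by (auto simp: F_su[OF i] F_su[OF j] su_mult ul)
qed

lemma su_vec: "su x a b *v w = (x * w $ b) *s axis a 1"
proof -
  have "(su x a b *v w) $ i = (\<Sum>j\<in>UNIV. if j = b then (if i = a then x * w $ b else 0) else 0)" for i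
    unfolding matrix_vector_mult_def vec_lambda_beta su_def by (intro sum.cong refl) auto
  then show ?thesis by (simp add: vec_eq_iff sum.delta axis_def)
qed

lemma vec_expand: "(x :: complex ^ 'm::finite) = (\<Sum>a\<in>UNIV. (x $ a) *s axis a 1)"
proof -
  have "(\<Sum>a\<in>UNIV. (x $ a) *s axis a 1) $ i = (\<Sum>a\<in>UNIV. if a = i then x $ i else 0)" for i
    unfolding sum_component by (intro sum.cong refl) (auto simp: axis_def)
  then show ?thesis by (simp add: vec_eq_iff sum.delta)
qed

lemma lo_tau: "k < r \<Longrightarrow> lo (\<tau> (Suc k)) = vx (Suc k)" and up_tau: "k < r \<Longrightarrow> up (\<tau> (Suc k)) = vx k"
  by (simp_all add: lo_def up_def tau_tau)

lemma all_axes: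
  assumes E: "\<And>k. k < r \<Longrightarrow> P (vx (Suc k)) \<Longrightarrow> P (vx k)" and F: "\<And>k. k < r \<Longrightarrow> P (vx k) \<Longrightarrow> P (vx (Suc k))"
    and P: "P b"
  shows "P a"
proof -
  have up: "P (vx 0)" if "k \<le> r" "P (vx k)" for k using that by (induction k) (auto dest!: Suc_le_lessD intro: E)
  have down: "P (vx 0) \<Longrightarrow> k \<le> r \<Longrightarrow> P (vx k)" for k by (induction k) (auto dest!: Suc_le_lessD intro: F)
  show ?thesis using up[OF pos_le[of b]] down[OF _ pos_le[of a]] P by (simp add: vx_pos)
qed

text \<open>
  Every non-zero vector is mapped by a suitable step to a multiple of a single axis, and the steps connect
  all axes.
\<close>

lemma simple_module: "simple_module r X"
  unfolding simple_module_def
proof (intro allI impI)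
  fix W :: "(complex ^ 'n) set"
  assume W: "vec.subspace W \<and> (\<forall>i\<in>{1..r}. \<forall>v\<in>W. actK X i *v v \<in> W \<and> matrix_inv (actK X i) *v v \<in> W \<and>
                          actE X i *v v \<in> W \<and> actF X i *v v \<in> W)"
  have sc: "axis a 1 \<in> W" if "x *s axis a 1 \<in> W" "x \<noteq> 0" for x and a :: 'n
    using vec.subspace_scale[of W "x *s axis a 1" "1 / x"] W that by simp
  have E: "axis (vx k) 1 \<in> W" if "k < r" "v \<in> W" "v $ vx (Suc k) \<noteq> 0" for k v
  proof -
    have i: "\<tau> (Suc k) \<in> {1..r}" using that(1) by (intro tau_range) simp
    then have "actE X (\<tau> (Suc k)) *v v \<in> W" using W that(2) by blast
    then show ?thesis using that(1,3) c_nz[OF i] by (auto simp: E_su[OF i] su_vec lo_tau up_tau intro: sc)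
  qed
  have F: "axis (vx (Suc k)) 1 \<in> W" if "k < r" "v \<in> W" "v $ vx k \<noteq> 0" for k v
  proof -
    have i: "\<tau> (Suc k) \<in> {1..r}" using that(1) by (intro tau_range) simp
    then have "actF X (\<tau> (Suc k)) *v v \<in> W" using W that(2) by blast
    then show ?thesis using that(1,3) c_nz[OF i] by (auto simp: F_su[OF i] su_vec lo_tau up_tau intro: sc)
  qed
  show "W = {0} \<or> W = UNIV"
  proof (rule disjCI)
    assume "W \<noteq> UNIV"
    show "W = {0}"
    proof (rule ccontr)
      assume "W \<noteq> {0}"
      then obtain w where w: "w \<in> W" "w \<noteq> 0" using W vec.subspace_0 by blast
      then obtain b where b: "w $ b \<noteq> 0" by (auto simp: vec_eq_iff)
      have "\<exists>b'. axis b' 1 \<in> W"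
      proof (cases "pos b")
        case 0
        then show ?thesis using F[of 0 w] w b r1 vx_pos[of b] by auto
      next
        case (Suc k)
        then show ?thesis using E[of k w] w b vx_pos[of b] pos_le[of b] by auto
      qed
      then obtain b' :: 'n where "axis b' 1 \<in> W" by blast
      moreover have "axis (vx k) 1 \<in> W" if "k < r" "axis (vx (Suc k)) 1 \<in> W" for k
        by (rule E[OF that]) simp
      moreover have "axis (vx (Suc k)) 1 \<in> W" if "k < r" "axis (vx k) 1 \<in> W" for k
        by (rule F[OF that]) simp
      ultimately have ax: "axis a 1 \<in> W" for a :: 'n
        using all_axes[where P = "\<lambda>a. axis a 1 \<in> W" and b = b'] by blast
      have "x \<in> W" for x
        by (subst vec_expand) (use W ax in \<open>auto intro!: vec.subspace_sum vec.subspace_scale\<close>)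
      then show False using \<open>W \<noteq> UNIV\<close> by blast
    qed
  qed
qed

lemma K_vec: "i \<in> {1..r} \<Longrightarrow> (actK X i *v w) $ a = kd i a * w $ a"
proof -
  assume i: "i \<in> {1..r}"
  have "(actK X i *v w) $ a = (\<Sum>j\<in>UNIV. if j = a then kd i a * w $ a else 0)"
    unfolding matrix_vector_mult_def vec_lambda_beta K_entry[OF i] by (intro sum.cong refl) (auto simp: kd_def)
  then show ?thesis by (simp add: sum.delta)
qed

lemma K_axis: "i \<in> {1..r} \<Longrightarrow> actK X i *v axis a 1 = kd i a *s axis a 1"
  by (simp add: vec_eq_iff K_vec) (simp add: axis_def)
lemma tau1: "\<tau> 1 \<in> {1..r}" using tau_range[of 1] r1 by simp

lemma kexp_0: "i \<in> {1..r} \<Longrightarrow> kexp \<tau> i 0 = (if i = \<tau> 1 then 1 else 0)"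
  using tau_range[of i] tau_tau[of i] tau_tau[of 1] r1 by (auto simp: kexp_def)
lemma kexp_r: "i \<in> {1..r} \<Longrightarrow> kexp \<tau> i r = (if i = r + 1 - \<tau> 1 then - 1 else 0)"
proof -
  assume i: "i \<in> {1..r}"
  have "\<tau> i = r \<longleftrightarrow> i = r + 1 - \<tau> 1" using tau
  proof
    assume *: "\<forall>i\<in>{1..r}. \<tau> i = i"
    then show ?thesis using i r1 * by (auto simp: Ball_def)
  next
    assume *: "\<forall>i\<in>{1..r}. \<tau> i = r + 1 - i"
    have "\<tau> i = r + 1 - i" "\<tau> 1 = r + 1 - 1" using i r1 * by auto
    then show ?thesis using i by auto
  qed
  then show ?thesis using tau_range[OF i] by (auto simp: kexp_def)
qed

lemma fundamental_in_lattice: "j \<in> {1..r} \<Longrightarrow> fundamental_weight r j \<in> weight_lattice r"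
proof -
  assume j: "j \<in> {1..r}"
  have "fundamental_weight r j = (\<lambda>k. \<Sum>i = 1..r. of_int (if i = j then 1 else 0) * fundamental_weight r i k)"
  proof
    fix k
    have "(\<Sum>i = 1..r. of_int (if i = j then 1 else 0) * fundamental_weight r i k) = (\<Sum>i = 1..r. if i = j then fundamental_weight r j k else 0)"
      by (intro sum.cong refl) auto
    then show "fundamental_weight r j k = (\<Sum>i = 1..r. of_int (if i = j then 1 else 0) * fundamental_weight r i k)"
      using j by (simp add: sum.delta)
  qed
  then show ?thesis unfolding weight_lattice_def mem_Collect_eq
    by (intro exI[of _ "\<lambda>i. if i = j then 1 else 0"] conjI TrueI)
qed

text \<open>
  The braiding is pinned down by its values on all pairs of highest and lowest weight vectors of modules that are known to be simple; the next lemmas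
  determine these vectors, and the highest weight itself, for a chain.
\<close>

lemma highest_exists: "highest_weight_vector r q X (fundamental_weight r (\<tau> 1)) (axis (vx 0) 1)"
  unfolding highest_weight_vector_def weight_vector_def
proof (intro conjI ballI)
  show "axis (vx 0) (1::complex) \<noteq> 0" by (simp add: axis_eq_0_iff)
  fix i assume i: "i \<in> {1..r}"
  show "actK X i *v axis (vx 0) 1 = qpow q (wform r (simple_root i) (fundamental_weight r (\<tau> 1))) *s axis (vx 0) 1"
    by (simp add: K_axis[OF i] kd_def pos_vx kexp_0[OF i] wform_simple_fundamental[OF i tau1] del: One_nat_def)
  have "lo i \<noteq> vx 0" using pos_lo[OF i] tau_range[OF i] pos_vx[of 0] by auto
  then show "actE X i *v axis (vx 0) 1 = 0" by (simp add: E_su[OF i] su_vec axis_def)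
qed

lemma is_simple: "is_simple_type1 r q X (fundamental_weight r (\<tau> 1))"
  unfolding is_simple_type1_def using uq_module simple_module fundamental_in_lattice[OF tau1] highest_exists by blast

lemma highest_unique:
  assumes "highest_weight_vector r q X l v" and "l \<in> weight_lattice r"
  shows "l = fundamental_weight r (\<tau> 1)" "v = v $ vx 0 *s axis (vx 0) 1"
proof -
  have v0: "v \<noteq> 0" and K: "\<And>i. i \<in> {1..r} \<Longrightarrow> actK X i *v v = qpow q (wform r (simple_root i) l) *s v"
    and E: "\<And>i. i \<in> {1..r} \<Longrightarrow> actE X i *v v = 0"
    using assms(1) by (auto simp: highest_weight_vector_def weight_vector_def)
  have z: "v $ vx (Suc k) = 0" if "k < r" for k
  proof -
    have i: "\<tau> (Suc k) \<in> {1..r}" using that by (intro tau_range) simp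
    show ?thesis using E[OF i] c_nz[OF i] that by (simp add: E_su[OF i] su_vec lo_tau vec_eq_iff axis_def split: if_splits)
  qed
  have z': "v $ a = 0" if "a \<noteq> vx 0" for a
    using z[of "pos a - 1"] that vx_pos[of a] pos_le[of a] by (cases "pos a") auto
  show v: "v = v $ vx 0 *s axis (vx 0) 1" using z' by (auto simp: vec_eq_iff axis_def)
  then have vn: "v $ vx 0 \<noteq> 0" using v0 by auto
  have w: "wform r (simple_root i) l = (if i = \<tau> 1 then 1 else 0)" if i: "i \<in> {1..r}" for i
  proof -
    have "kd i (vx 0) * v $ vx 0 = qpow q (wform r (simple_root i) l) * v $ vx 0"
      using K[OF i] K_vec[OF i, of v "vx 0"] by (metis vector_smult_component)
    then have "qpow q (kexp \<tau> i 0) = qpow q (wform r (simple_root i) l)" using vn by (simp add: kd_def pos_vx)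
    then show ?thesis using qpow_inj[OF q0 q1] kexp_0[OF i] by simp
  qed
  obtain n where l: "l = (\<lambda>k. \<Sum>i = 1..r. of_int (n i) * fundamental_weight r i k)"
    using assms(2) by (auto simp: weight_lattice_def)
  have "real_of_int (n i) = (if i = \<tau> 1 then 1 else 0)" if i: "i \<in> {1..r}" for i
  proof -
    have "wform r (simple_root i) l = (\<Sum>j = 1..r. of_int (n j) * wform r (simple_root i) (fundamental_weight r j))"
      unfolding wform_simple_root[OF i] l by (simp add: sum_subtractf right_diff_distrib)
    also have "\<dots> = (\<Sum>j = 1..r. if j = i then of_int (n j) else 0)"
      by (intro sum.cong refl) (simp add: wform_simple_fundamental[OF i])
    also have "\<dots> = of_int (n i)" using i by (simp add: sum.delta)
    finally show ?thesis using w[OF i] by simp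
  qed
  then have "l k = (\<Sum>i = 1..r. if i = \<tau> 1 then fundamental_weight r (\<tau> 1) k else 0)" for k
    unfolding l by (intro sum.cong refl) auto
  then show "l = fundamental_weight r (\<tau> 1)" using tau1 by (simp add: sum.delta fun_eq_iff)
qed

lemma lowest_form:
  assumes "lowest_weight_vector r q X l v"
  shows "v = v $ vx r *s axis (vx r) 1"
proof -
  have F: "\<And>i. i \<in> {1..r} \<Longrightarrow> actF X i *v v = 0"
    using assms(1) by (auto simp: lowest_weight_vector_def)
  have z: "v $ vx k = 0" if "k < r" for k
  proof -
    have i: "\<tau> (Suc k) \<in> {1..r}" using that by (intro tau_range) simp
    show ?thesis using F[OF i] c_nz[OF i] that by (simp add: F_su[OF i] su_vec up_tau vec_eq_iff axis_def split: if_splits)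
  qed
  have z': "v $ a = 0" if "a \<noteq> vx r" for a
    using z[of "pos a"] that vx_pos[of a] pos_le[of a] by (cases "pos a = r") auto
  show v: "v = v $ vx r *s axis (vx r) 1" using z' by (auto simp: vec_eq_iff axis_def)
qed

lemma lowest_exists:
  assumes j: "j \<in> {1..r}" "j = \<tau> 1"
  shows "lowest_weight_vector r q X (longest r (fundamental_weight r j)) (axis (vx r) 1)"
  unfolding lowest_weight_vector_def weight_vector_def
proof (intro conjI ballI)
  show "axis (vx r) (1::complex) \<noteq> 0" by (simp add: axis_eq_0_iff)
  fix i assume i: "i \<in> {1..r}"
  have "wform r (simple_root i) (longest r (fundamental_weight r j)) = (if i = r + 1 - j then - 1 else 0)"
    unfolding wform_simple_root[OF i] longest_def fundamental_weight_def using i j(1) by auto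
  then show "actK X i *v axis (vx r) 1 = qpow q (wform r (simple_root i) (longest r (fundamental_weight r j))) *s axis (vx r) 1"
    using q0 by (simp add: K_axis[OF i] kd_def pos_vx kexp_r[OF i] j(2))
  have "up i \<noteq> vx r" using pos_up[OF i] tau_range[OF i] pos_vx[of r] by auto
  then show "actF X i *v axis (vx r) 1 = 0" by (simp add: F_su[OF i] su_vec axis_def)
qed

end

section \<open>The vector representation and its dual are chains\<close>

lemma scaleR_complex: "x *\<^sub>R (z :: complex) = complex_of_real x * z"
  by (rule scaleR_conv_of_real)

lemma matrix_vector_scaleR: "((x::real) *\<^sub>R A) *v w = complex_of_real x *s (A *v (w :: complex ^ 'n::finite))"
  by (simp add: vec_eq_iff matrix_vector_mult_def sum_distrib_left) (simp add: scaleR_complex mult.assoc)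

lemma matrix_axis_entry: "((A :: complex ^ 'n::finite ^ 'm::finite) *v axis a 1) $ b = A $ b $ a"
proof -
  have "(A *v axis a 1) $ b = (\<Sum>j\<in>UNIV. if j = a then A $ b $ a else 0)"
    unfolding matrix_vector_mult_def vec_lambda_beta by (intro sum.cong refl) (auto simp: axis_def)
  then show ?thesis by (simp add: sum.delta)
qed

text \<open>
  The vectors \<open>v\<^sub>0\<close> (highest) and \<open>v\<^sub>k\<^sub>+\<^sub>1 = F v\<^sub>k\<close>, with the only \<open>F\<close> that can act, are non-zero for
  \<open>k \<le> r\<close> because \<open>E F - F E\<close> is the identity on \<open>v\<^sub>k\<close>.  Their \<open>r + 1 = dim V\<close> weights are distinct, so they exhaust the weights of \<open>V\<close>, every
  coordinate axis spans a weight space, and \<open>E\<close> and \<open>F\<close> can connect only axes whose weights differ by the right simple root.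
\<close>

theorem simple_module_chain:
  fixes V :: "'n::finite uq_action" and wt :: "'n \<Rightarrow> weight"
  assumes r1: "r \<ge> 1" and q0: "0 < q" and q1: "q < 1" and s: "s \<in> {1, r}" and card: "CARD('n) = r + 1"
    and simp: "is_simple_type1 r q V (fundamental_weight r s)"
    and wv: "\<And>i. weight_vector r q V (wt i) (axis i 1)"
  defines "\<tau> \<equiv> (\<lambda>i. if s = 1 then i else r + 1 - i)"
  shows "\<exists>pos c. chain_module r q V pos \<tau> c \<and>
    (\<forall>a. \<forall>i\<in>{1..r}. wform r (simple_root i) (wt a) = kexp \<tau> i (pos a))"
proof -
  have tau: "(\<forall>i\<in>{1..r}. \<tau> i = i) \<or> (\<forall>i\<in>{1..r}. \<tau> i = r + 1 - i)"
    by (auto simp: \<tau>_def)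
  note tau_range = tau_facts(1)[OF tau] and tau_tau = tau_facts(2)[OF tau] and tau_adj = tau_facts(3)[OF tau]
    and tau_inj = tau_facts(4)[OF tau]
  have sr: "s \<in> {1..r}" and ts: "\<tau> s = 1" using s r1 by (auto simp: \<tau>_def)
  let ?K = "actK V" and ?E = "actE V" and ?F = "actF V"
  let ?w = "\<lambda>i j. wform r (simple_root i) (simple_root j)"
  have uq: "uq_module r q V" using simp by (simp add: is_simple_type1_def)
  have Kinv: "invertible (?K i)" if "i \<in> {1..r}" for i
    using uq that unfolding uq_module_def Let_def by blast
  have KEK: "?K i ** ?E j ** matrix_inv (?K i) = (q powr ?w i j) *\<^sub>R ?E j"
    and KFK: "?K i ** ?F j ** matrix_inv (?K i) = (q powr (- ?w i j)) *\<^sub>R ?F j"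
    and EF: "?E i ** ?F j - ?F j ** ?E i =
          (if i = j then inverse (q - inverse q) *\<^sub>R (?K i - matrix_inv (?K i)) else 0)"
    if "i \<in> {1..r}" "j \<in> {1..r}" for i j
    using uq that unfolding uq_module_def Let_def by blast+
  have KE: "?K i ** ?E j = (q powr ?w i j) *\<^sub>R (?E j ** ?K i)" if "i \<in> {1..r}" "j \<in> {1..r}" for i j
  proof -
    have "?K i ** ?E j ** matrix_inv (?K i) ** ?K i = ((q powr ?w i j) *\<^sub>R ?E j) ** ?K i" by (simp only: KEK[OF that])
    then show ?thesis
      by (simp add: matrix_mul_assoc[symmetric] matrix_inv_cancel[OF Kinv[OF that(1)]] scalar_matrix_assoc)
  qed
  have KF: "?K i ** ?F j = (q powr (- ?w i j)) *\<^sub>R (?F j ** ?K i)" if "i \<in> {1..r}" "j \<in> {1..r}" for i j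
  proof -
    have "?K i ** ?F j ** matrix_inv (?K i) ** ?K i = ((q powr (- ?w i j)) *\<^sub>R ?F j) ** ?K i" by (simp only: KFK[OF that])
    then show ?thesis
      by (simp add: matrix_mul_assoc[symmetric] matrix_inv_cancel[OF Kinv[OF that(1)]] scalar_matrix_assoc)
  qed
  obtain v0 where hw: "highest_weight_vector r q V (fundamental_weight r s) v0"
    using simp by (auto simp: is_simple_type1_def)
  define v where "v = rec_nat v0 (\<lambda>k w. ?F (\<tau> (Suc k)) *v w)"
  have v_0: "v 0 = v0" and v_Suc: "v (Suc k) = ?F (\<tau> (Suc k)) *v v k" for k by (simp_all add: v_def)
  have qq: "complex_of_real (q - inverse q) \<noteq> 0"
  proof
    assume "complex_of_real (q - inverse q) = 0"
    then have "q - inverse q = 0" by (metis of_real_eq_0_iff)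
    then have "q * q = 1" using q0 by (simp add: field_simps)
    then show False using q0 q1 by (metis less_irrefl mult_strict_mono' mult.right_neutral order_less_imp_le)
  qed
  \<comment> \<open>the last conjunct makes the term \<open>F E\<close> vanish in the commutator at the next step\<close>
  have main: "k \<le> r \<Longrightarrow> v k \<noteq> 0 \<and> (\<forall>i\<in>{1..r}. ?K i *v v k = qpow q (kexp \<tau> i k) *s v k) \<and>
      (\<forall>i\<in>{1..r}. \<tau> i > k \<longrightarrow> ?E i *v v k = 0)" for k
  proof (induction k)
    case 0
    have "kexp \<tau> i 0 = wform r (simple_root i) (fundamental_weight r s)" if i: "i \<in> {1..r}" for i
      using wform_simple_fundamental[OF i sr] tau_inj[OF i sr] tau_range[OF i] ts by (auto simp: kexp_def)
    then show ?case using hw by (auto simp: v_0 highest_weight_vector_def weight_vector_def)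
  next
    case (Suc k)
    then have IH: "v k \<noteq> 0" "\<And>i. i \<in> {1..r} \<Longrightarrow> ?K i *v v k = qpow q (kexp \<tau> i k) *s v k"
      "\<And>i. i \<in> {1..r} \<Longrightarrow> \<tau> i > k \<Longrightarrow> ?E i *v v k = 0" by simp_all
    define j where "j = \<tau> (Suc k)"
    have j: "j \<in> {1..r}" and tj: "\<tau> j = Suc k" using Suc.prems tau_range[of "Suc k"] tau_tau[of "Suc k"] by (simp_all add: j_def)
    have vS: "v (Suc k) = ?F j *v v k" by (simp add: v_Suc j_def)
    have "?K i *v v (Suc k) = qpow q (kexp \<tau> i (Suc k)) *s v (Suc k)" if i: "i \<in> {1..r}" for i
    proof -
      have "?K i *v v (Suc k) = (?K i ** ?F j) *v v k" by (simp add: vS matrix_vector_mul_assoc)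
      also have "\<dots> = qpow q (- ?w i j) *s (?F j *v (?K i *v v k))"
        by (simp add: KF[OF i j] matrix_vector_scaleR matrix_vector_mul_assoc qpow_def)
      also have "\<dots> = qpow q (- ?w i j + kexp \<tau> i k) *s v (Suc k)"
        by (simp add: IH(2)[OF i] vS qpow_add[symmetric] vector_scalar_commute vector_smult_assoc)
      also have "- ?w i j + kexp \<tau> i k = kexp \<tau> i (Suc k)"
        unfolding cartan_entry[OF i j] tau_adj[OF i j] tau_inj[OF i j, symmetric] tj kexp_def by auto
      finally show ?thesis .
    qed
    moreover have "?E i *v v (Suc k) = 0" if i: "i \<in> {1..r}" and ti: "\<tau> i > Suc k" for i
    proof -
      have ij: "i \<noteq> j" using ti tj by auto
      have "?E i ** ?F j = ?F j ** ?E i" using EF[OF i j] ij by simp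
      then have "?E i *v v (Suc k) = ?F j *v (?E i *v v k)" by (simp add: vS matrix_vector_mul_assoc)
      then show ?thesis using IH(3)[OF i] ti by simp
    qed
    moreover have "v (Suc k) \<noteq> 0"
    proof
      assume z: "v (Suc k) = 0"
      have "(?E j ** ?F j - ?F j ** ?E j) *v v k = ?E j *v v (Suc k) - ?F j *v (?E j *v v k)"
        by (simp add: vS matrix_vector_mul_assoc matrix_vector_mult_diff_rdistrib)
      then have zero: "(?E j ** ?F j - ?F j ** ?E j) *v v k = 0" using z IH(3)[OF j] tj by simp
      have K1: "?K j *v v k = complex_of_real q *s v k" using IH(2)[OF j] tj q0 by (simp add: kexp_def)
      have "matrix_inv (?K j) *v (?K j *v v k) = v k"
        by (simp add: matrix_vector_mul_assoc matrix_inv_cancel[OF Kinv[OF j]])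
      then have "complex_of_real q *s (matrix_inv (?K j) *v v k) = v k" by (simp add: K1 vector_scalar_commute)
      then have K2: "matrix_inv (?K j) *v v k = (1 / complex_of_real q) *s v k"
        using q0 by (metis (no_types, lifting) nonzero_eq_divide_eq of_real_eq_0_iff order_less_irrefl vector_smult_assoc vector_smult_lid)
      have "(?E j ** ?F j - ?F j ** ?E j) *v v k =
        complex_of_real (inverse (q - inverse q)) *s (complex_of_real q *s v k - (1 / complex_of_real q) *s v k)"
        using EF[OF j j] by (simp add: matrix_vector_scaleR matrix_vector_mult_diff_rdistrib K1 K2 del: of_real_inverse)
      also have "\<dots> = (inverse (complex_of_real (q - inverse q)) * complex_of_real (q - inverse q)) *s v k"
        by (simp only: of_real_inverse vector_sub_rdistrib[symmetric] vector_smult_assoc) (simp add: inverse_eq_divide)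
      also have "\<dots> = v k" by (simp only: left_inverse[OF qq] vector_smult_lid)
      finally show False using zero IH(1) by simp
    qed
    ultimately show ?case by blast
  qed
  define \<mu> where "\<mu> i a = qpow q (wform r (simple_root i) (wt a))" for i a
  have Kax: "?K i $ b $ a = (if b = a then \<mu> i a else 0)" if "i \<in> {1..r}" for i a b
  proof -
    have "?K i *v axis a 1 = \<mu> i a *s axis a 1" using wv[of a] that by (simp add: weight_vector_def \<mu>_def)
    then have "(?K i *v axis a 1) $ b = (\<mu> i a *s axis a 1) $ b" by simp
    then show ?thesis unfolding matrix_axis_entry by (simp add: axis_def split: if_splits)
  qed
  have Kv: "(?K i *v x) $ a = \<mu> i a * x $ a" if "i \<in> {1..r}" for i a x
  proof -
    have "(?K i *v x) $ a = (\<Sum>j\<in>UNIV. if j = a then \<mu> i a * x $ a else 0)"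
      unfolding matrix_vector_mult_def vec_lambda_beta Kax[OF that] by (intro sum.cong refl) auto
    then show ?thesis by (simp add: sum.delta)
  qed
  \<comment> \<open>an axis that occurs in \<open>v k\<close>, which therefore has the same weight; \<open>pos\<close> is the inverse of this assignment\<close>
  define g where "g k = (SOME a. v k $ a \<noteq> 0)" for k
  have g: "\<mu> i (g k) = qpow q (kexp \<tau> i k)" if "k \<le> r" "i \<in> {1..r}" for i k
  proof -
    have "\<exists>a. v k $ a \<noteq> 0" using main[OF that(1)] by (auto simp: vec_eq_iff)
    then have nz: "v k $ g k \<noteq> 0" unfolding g_def by (rule someI_ex)
    have "?K i *v v k = qpow q (kexp \<tau> i k) *s v k" using main[OF that(1)] that(2) by blast
    then have "\<mu> i (g k) * v k $ g k = qpow q (kexp \<tau> i k) * v k $ g k"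
      using Kv[OF that(2), of "v k" "g k"] by (metis vector_smult_component)
    then show ?thesis using nz by simp
  qed
  have kexp_sep: "k = l" if "k \<le> r" "l \<le> r" "\<forall>i\<in>{1..r}. kexp \<tau> i k = kexp \<tau> i l" for k l
  proof -
    have aux: "\<not> (k < l \<and> l \<le> r \<and> (\<forall>i\<in>{1..r}. kexp \<tau> i k = kexp \<tau> i l))" for k l
    proof
      assume *: "k < l \<and> l \<le> r \<and> (\<forall>i\<in>{1..r}. kexp \<tau> i k = kexp \<tau> i l)"
      have j: "\<tau> (Suc k) \<in> {1..r}" "\<tau> (\<tau> (Suc k)) = Suc k"
        using * tau_range[of "Suc k"] tau_tau[of "Suc k"] by auto
      then have "kexp \<tau> (\<tau> (Suc k)) k = kexp \<tau> (\<tau> (Suc k)) l" using * by blast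
      then show False using * j by (auto simp: kexp_def split: if_splits)
    qed
    show ?thesis using aux[of k l] aux[of l k] that by (metis linorder_neqE_nat)
  qed
  have g_inj: "inj_on g {..r}"
  proof (rule inj_onI)
    fix k l assume kl: "k \<in> {..r}" "l \<in> {..r}" "g k = g l"
    show "k = l" using kl g[of k] g[of l] by (intro kexp_sep) (auto simp: qpow_inj[OF q0 q1] dest: sym)
  qed
  have g_bij: "bij_betw g {..r} UNIV"
    using g_inj card by (simp add: bij_betw_def card_image card_subset_eq[symmetric])
       (metis card_atMost card_image card_subset_eq finite_code subset_UNIV Suc_eq_plus1)
  define pos where "pos = the_inv_into {..r} g"
  have pos_bij: "bij_betw pos UNIV {..r}" unfolding pos_def by (rule bij_betw_the_inv_into[OF g_bij])
  have gpos: "g (pos a) = a" for a unfolding pos_def using f_the_inv_into_f_bij_betw[OF g_bij] by simp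
  have pos_le: "pos a \<le> r" for a using pos_bij by (auto simp: bij_betw_def)
  have pos_eq: "pos a = pos b \<longleftrightarrow> a = b" for a b using gpos by metis
  have mu: "\<mu> i a = qpow q (kexp \<tau> i (pos a))" if "i \<in> {1..r}" for i a
    using g[OF pos_le[of a] that] by (simp add: gpos)
  have Kmul: "(?K i ** A) $ a $ b = \<mu> i a * A $ a $ b" "(A ** ?K i) $ a $ b = A $ a $ b * \<mu> i b"
    if "i \<in> {1..r}" for i a b A
  proof -
    have "(?K i ** A) $ a $ b = (\<Sum>k\<in>UNIV. if k = a then \<mu> i a * A $ a $ b else 0)"
      "(A ** ?K i) $ a $ b = (\<Sum>k\<in>UNIV. if k = b then A $ a $ b * \<mu> i b else 0)"
      unfolding matrix_matrix_mult_def vec_lambda_beta Kax[OF that] by (intro sum.cong refl; auto)+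
    then show "(?K i ** A) $ a $ b = \<mu> i a * A $ a $ b" "(A ** ?K i) $ a $ b = A $ a $ b * \<mu> i b"
      by (simp_all add: sum.delta)
  qed
  have Ez: "?E j $ a $ b = 0" if j: "j \<in> {1..r}" and n: "\<not> (Suc (pos a) = \<tau> j \<and> pos b = \<tau> j)" for j a b
  proof (rule ccontr)
    assume nz: "?E j $ a $ b \<noteq> 0"
    have "\<mu> j a * ?E j $ a $ b = qpow q 2 * (?E j $ a $ b * \<mu> j b)"
      using arg_cong[OF KE[OF j j], of "\<lambda>A. A $ a $ b"]
      by (simp add: Kmul[OF j] cartan_entry[OF j j] scaleR_complex qpow_def)
    then have "qpow q (kexp \<tau> j (pos a)) = qpow q (2 + kexp \<tau> j (pos b))"
      using nz by (simp add: mu[OF j] qpow_add)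
    then have "kexp \<tau> j (pos a) = 2 + kexp \<tau> j (pos b)" by (simp add: qpow_inj[OF q0 q1])
    then show False using n by (auto simp: kexp_def split: if_splits)
  qed
  have Fz: "?F j $ a $ b = 0" if j: "j \<in> {1..r}" and n: "\<not> (pos a = \<tau> j \<and> Suc (pos b) = \<tau> j)" for j a b
  proof (rule ccontr)
    assume nz: "?F j $ a $ b \<noteq> 0"
    have "\<mu> j a * ?F j $ a $ b = qpow q (- 2) * (?F j $ a $ b * \<mu> j b)"
      using arg_cong[OF KF[OF j j], of "\<lambda>A. A $ a $ b"]
      by (simp add: Kmul[OF j] cartan_entry[OF j j] scaleR_complex qpow_def)
    then have "qpow q (kexp \<tau> j (pos a)) = qpow q (- 2 + kexp \<tau> j (pos b))"
      using nz by (simp add: mu[OF j] qpow_add[symmetric])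
    then have "kexp \<tau> j (pos a) = - 2 + kexp \<tau> j (pos b)" by (simp add: qpow_inj[OF q0 q1])
    then show False using n by (auto simp: kexp_def split: if_splits)
  qed
  define c where "c j = ?E j $ g (\<tau> j - 1) $ g (\<tau> j)" for j
  have cf: "c j * ?F j $ g (\<tau> j) $ g (\<tau> j - 1) = 1" if j: "j \<in> {1..r}" for j
  proof -
    have tj: "\<tau> j \<in> {1..r}" by (rule tau_range[OF j])
    have pg: "pos (g k) = k" if "k \<le> r" for k
      unfolding pos_def using the_inv_into_f_f[OF g_inj] that by simp
    define x y where "x = g (\<tau> j - 1)" and "y = g (\<tau> j)"
    have px: "Suc (pos x) = \<tau> j" and py: "pos y = \<tau> j" using tj pg[of "\<tau> j - 1"] pg[of "\<tau> j"] by (auto simp: x_def y_def)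
    have cj: "c j = ?E j $ x $ y" by (simp only: c_def x_def y_def)
    have Ex: "?E j $ x $ k = 0" if "k \<noteq> y" for k
      using that py pos_eq[of k y] by (intro Ez[OF j]) auto
    have EFx: "(?E j ** ?F j) $ x $ x = c j * ?F j $ y $ x"
    proof -
      have "(?E j ** ?F j) $ x $ x = (\<Sum>k\<in>UNIV. if k = y then c j * ?F j $ y $ x else 0)"
        unfolding matrix_matrix_mult_def vec_lambda_beta
        using Ex cj by (intro sum.cong refl) auto
      then show ?thesis by (simp add: sum.delta)
    qed
    have FEx: "(?F j ** ?E j) $ x $ x = 0"
      unfolding matrix_matrix_mult_def vec_lambda_beta
      using Fz[OF j, of x] px by (intro sum.neutral) auto
    have inv: "matrix_inv (?K j) $ x $ x = 1 / complex_of_real q"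
    proof -
      have "(matrix_inv (?K j) ** ?K j) $ x $ x = 1" by (simp add: matrix_inv_cancel[OF Kinv[OF j]] mat_def)
      then have "matrix_inv (?K j) $ x $ x * complex_of_real q = 1"
        using px q0 by (simp add: Kmul[OF j] mu[OF j] kexp_def)
      then show ?thesis using q0 by (simp add: field_simps)
    qed
    have "c j * ?F j $ y $ x = complex_of_real (inverse (q - inverse q)) * (complex_of_real q - 1 / complex_of_real q)"
      using arg_cong[OF EF[OF j j], of "\<lambda>A. A $ x $ x"] px q0
      by (simp add: EFx FEx inv Kax[OF j] mu[OF j] kexp_def scaleR_complex del: of_real_inverse)
    also have "\<dots> = inverse (complex_of_real (q - inverse q)) * complex_of_real (q - inverse q)"
      by (simp add: inverse_eq_divide)
    also have "\<dots> = 1" by (rule left_inverse[OF qq])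
    finally show ?thesis by (simp only: x_def y_def)
  qed
  have "chain_module r q V pos \<tau> c"
    unfolding chain_module_def
  proof (intro conjI pos_bij tau ballI allI)
    fix j assume j: "j \<in> {1..r}"
    show "c j \<noteq> 0" using cf[OF j] by auto
    fix a b
    show "?K j $ a $ b = (if a = b then qpow q (kexp \<tau> j (pos a)) else 0)" by (simp add: Kax[OF j] mu[OF j])
    show "?E j $ a $ b = (if Suc (pos a) = \<tau> j \<and> pos b = \<tau> j then c j else 0)"
    proof (cases "Suc (pos a) = \<tau> j \<and> pos b = \<tau> j")
      case True
      then have "\<tau> j - 1 = pos a" "\<tau> j = pos b" by auto
      then have "g (\<tau> j - 1) = a" "g (\<tau> j) = b" using gpos by metis+
      then show ?thesis using True by (simp only: c_def) simp
    qed (use Ez[OF j, of a b] in auto)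
    show "?F j $ a $ b = (if pos a = \<tau> j \<and> Suc (pos b) = \<tau> j then 1 / c j else 0)"
    proof (cases "pos a = \<tau> j \<and> Suc (pos b) = \<tau> j")
      case True
      then have "\<tau> j - 1 = pos b" "\<tau> j = pos a" by auto
      then have "g (\<tau> j - 1) = b" "g (\<tau> j) = a" using gpos by metis+
      then have "c j * ?F j $ a $ b = 1" using cf[OF j] by simp
      then have "?F j $ a $ b = 1 / c j" by (metis mult_zero_left nonzero_mult_div_cancel_left zero_neq_one)
      then show ?thesis using True by simp
    qed (use Fz[OF j, of a b] in auto)
  qed
  moreover have "\<forall>a. \<forall>i\<in>{1..r}. wform r (simple_root i) (wt a) = kexp \<tau> i (pos a)"
    using mu qpow_inj[OF q0 q1] by (simp add: \<mu>_def)
  ultimately show ?thesis by blast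
qed

section \<open>Module maps out of a product of two chains\<close>

lemma kron_vtensor: "kron A B *v vtensor v u = vtensor (A *v v) (B *v u)"
proof (subst vec_eq_iff, intro allI)
  fix x :: "'a \<times> 'b"
  have "(kron A B *v vtensor v u) $ x = (\<Sum>a\<in>UNIV. \<Sum>b\<in>UNIV. (A $ fst x $ a * v $ a) * (B $ snd x $ b * u $ b))"
    by (simp add: matrix_vector_mult_def kron_def vtensor_def sum_pair_UNIV mult_ac)
  then show "(kron A B *v vtensor v u) $ x = vtensor (A *v v) (B *v u) $ x"
    by (simp add: vtensor_def matrix_vector_mult_def sum_product)
qed

lemma vtensor_scale: "vtensor (x *s v) u = x *s vtensor v u" "vtensor v (x *s u) = x *s vtensor v u"
  by (simp_all add: vtensor_def vec_eq_iff)
lemma vtensor_zero [simp]: "vtensor 0 u = 0" "vtensor v 0 = 0"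
  by (simp_all add: vtensor_def vec_eq_iff)
lemma vtensor_axis: "vtensor (axis a 1) (axis b 1) = axis (a, b) 1"
  by (auto simp: vtensor_def vec_eq_iff axis_def)

lemma tensor_action_simps:
  "actK (tensor_action X Y) i *v vtensor v u = vtensor (actK X i *v v) (actK Y i *v u)"
  "actE (tensor_action X Y) i *v vtensor v u = vtensor (actE X i *v v) (actK Y i *v u) + vtensor v (actE Y i *v u)"
  "actF (tensor_action X Y) i *v vtensor v u = vtensor (actF X i *v v) u + vtensor (matrix_inv (actK X i) *v v) (actF Y i *v u)"
  by (simp_all add: tensor_action_def matrix_vector_mult_add_rdistrib kron_vtensor)

lemma matrix_diff_distrib:
  fixes A B :: "complex ^ 'm::finite ^ 'k::finite" and C :: "complex ^ 'l::finite ^ 'm" and D :: "complex ^ 'k ^ 'l"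
  shows "(A - B) ** C = A ** C - B ** C" "D ** (A - B) = D ** A - D ** B"
  by (simp_all add: vec_eq_iff matrix_matrix_mult_def left_diff_distrib right_diff_distrib sum_subtractf)

lemma matrix_eq_zero_axes:
  assumes "\<And>x. (A :: complex ^ 'm::finite ^ 'k::finite) *v axis x 1 = 0" shows "A = 0"
  using assms by (simp add: vec_eq_iff matrix_axis_entry[symmetric] del: zero_index)

locale two_chains = X: chain r q X pos \<tau> c + Y: chain r q Y pos' \<tau>' c'
  for r q and X :: "'i::finite uq_action" and pos \<tau> c and Y :: "'j::finite uq_action" and pos' \<tau>' c'
begin

text \<open>
  The vector (highest) \<open>\<otimes>\<close> (lowest) generates the tensor product.  The operators \<open>F\<close> kill the lowest vector and thus
  move the first factor alone through all axes; then the operators \<open>E\<close> raise the second factor, modulo vectors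
  whose second factor is lower and which have been dealt with before.
\<close>

lemma module_map_zero:
  assumes D: "module_map r (tensor_action X Y) Z D" and zero: "D *v vtensor (axis (X.vx 0) 1) (axis (Y.vx r) 1) = 0"
  shows "D = 0"
proof -
  have 1: "D *v vtensor (axis a 1) (axis (Y.vx r) 1) = 0" for a
  proof -
    have "D *v vtensor (axis (X.vx k) 1) (axis (Y.vx r) 1) = 0" if "k \<le> r" for k using that
    proof (induction k)
      case (Suc k)
      let ?i = "\<tau> (Suc k)" and ?v = "axis (X.vx k) (1::complex)" and ?u = "axis (Y.vx r) (1::complex)"
      have i: "?i \<in> {1..r}" using Suc.prems by (intro X.tau_range) simp
      have Fu: "actF Y ?i *v ?u = 0" using Y.lowest_exists[OF Y.tau1] i by (auto simp: lowest_weight_vector_def)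
      have Fv: "actF X ?i *v ?v = (1 / c ?i) *s axis (X.vx (Suc k)) 1"
        using Suc.prems by (simp add: X.F_su[OF i] X.su_vec X.up_tau X.lo_tau)
      have "D *v (actF (tensor_action X Y) ?i *v vtensor ?v ?u) = actF Z ?i *v (D *v vtensor ?v ?u)"
        using D i by (simp add: module_map_def matrix_vector_mul_assoc)
      then have "(1 / c ?i) *s (D *v vtensor (axis (X.vx (Suc k)) 1) ?u) = 0"
        using Suc by (simp add: tensor_action_simps Fu Fv vtensor_scale vector_scalar_commute)
      then show ?case using X.c_nz[OF i] by simp
    qed (use zero in simp)
    then show ?thesis using X.vx_pos[of a] X.pos_le[of a] by metis
  qed
  have 2: "D *v vtensor (axis a 1) (axis (Y.vx (r - k)) 1) = 0" if "k \<le> r" for k a using that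
  proof (induction k arbitrary: a)
    case (Suc k)
    obtain l where l: "r - k = Suc l" "r - Suc k = l" "l < r"
      using Suc.prems by (metis Suc_diff_Suc Suc_le_lessD diff_less_Suc less_trans_Suc not_less_eq)
    let ?i = "\<tau>' (Suc l)" and ?v = "axis a (1::complex)" and ?u = "axis (Y.vx (Suc l)) (1::complex)"
    have i: "?i \<in> {1..r}" using l by (intro Y.tau_range) simp
    have Ku: "actK Y ?i *v ?u = Y.kd ?i (Y.vx (Suc l)) *s ?u" by (rule Y.K_axis[OF i])
    have Eu: "actE Y ?i *v ?u = c' ?i *s axis (Y.vx l) 1"
      by (simp add: Y.E_su[OF i] Y.su_vec Y.lo_tau[OF l(3)] Y.up_tau[OF l(3)])
    have IH: "D *v vtensor (axis b 1) ?u = 0" for b using Suc by (simp add: l(1))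
    have Ev: "actE X ?i *v ?v = (c ?i * (axis a 1) $ X.lo ?i) *s axis (X.up ?i) 1"
      by (simp add: X.E_su[OF i] X.su_vec)
    have "D *v (actE (tensor_action X Y) ?i *v vtensor ?v ?u) = actE Z ?i *v (D *v vtensor ?v ?u)"
      using D i by (simp add: module_map_def matrix_vector_mul_assoc)
    then have "c' ?i *s (D *v vtensor ?v (axis (Y.vx l) 1)) = 0"
      by (simp add: tensor_action_simps Ku Eu Ev vtensor_scale vector_scalar_commute IH matrix_vector_right_distrib)
    then show ?case using Y.c_nz[OF i] by (simp add: l(2))
  qed (use 1 in simp)
  have 3: "D *v axis (a, b) 1 = 0" for a b
    using 2[of "r - pos' b" a] Y.vx_pos[of b] Y.pos_le[of b] by (simp add: vtensor_axis)
  show ?thesis by (rule matrix_eq_zero_axes) (use 3 in \<open>auto simp: split_paired_All\<close>)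
qed

text \<open>
  Two candidates for the braiding differ by a module map that vanishes on the generator.  The unique existence
  is needed since the braiding is given by a definite description.
\<close>

lemma braiding_eqI:
  assumes M: "module_map r (tensor_action X Y) (tensor_action Y X) M"
    and val: "M *v vtensor (axis (X.vx 0) 1) (axis (Y.vx r) 1) =
      qpow q (wform r (fundamental_weight r (\<tau> 1)) (longest r (fundamental_weight r (\<tau>' 1)))) *s
        vtensor (axis (Y.vx r) 1) (axis (X.vx 0) 1)"
  shows "braiding r q X Y = M"
  unfolding braiding_def
proof (rule the_equality)
  show "module_map r (tensor_action X Y) (tensor_action Y X) M \<and>
     (\<forall>l m v u. is_simple_type1 r q X l \<and> is_simple_type1 r q Y m \<and>
        highest_weight_vector r q X l v \<and> lowest_weight_vector r q Y (longest r m) u \<longrightarrow>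
        M *v vtensor v u = qpow q (wform r l (longest r m)) *s vtensor u v)"
  proof (intro conjI M allI impI)
    fix l m v u
    assume *: "is_simple_type1 r q X l \<and> is_simple_type1 r q Y m \<and>
        highest_weight_vector r q X l v \<and> lowest_weight_vector r q Y (longest r m) u"
    have l: "l = fundamental_weight r (\<tau> 1)" and v: "v = v $ X.vx 0 *s axis (X.vx 0) 1"
      using X.highest_unique[of l v] * by (auto simp: is_simple_type1_def)
    obtain v' where "highest_weight_vector r q Y m v'" using * by (auto simp: is_simple_type1_def)
    then have m: "m = fundamental_weight r (\<tau>' 1)"
      using Y.highest_unique[of m v'] * by (auto simp: is_simple_type1_def)
    have u: "u = u $ Y.vx r *s axis (Y.vx r) 1" using Y.lowest_form * by blast
    show "M *v vtensor v u = qpow q (wform r l (longest r m)) *s vtensor u v"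
      by (subst (1 2) v, subst (1 2) u) (simp add: vtensor_scale vector_scalar_commute val l m vector_smult_assoc mult_ac)
  qed
next
  fix N
  assume N: "module_map r (tensor_action X Y) (tensor_action Y X) N \<and>
     (\<forall>l m v u. is_simple_type1 r q X l \<and> is_simple_type1 r q Y m \<and>
        highest_weight_vector r q X l v \<and> lowest_weight_vector r q Y (longest r m) u \<longrightarrow>
        N *v vtensor v u = qpow q (wform r l (longest r m)) *s vtensor u v)"
  then have "N *v vtensor (axis (X.vx 0) 1) (axis (Y.vx r) 1) =
      qpow q (wform r (fundamental_weight r (\<tau> 1)) (longest r (fundamental_weight r (\<tau>' 1)))) *s
        vtensor (axis (Y.vx r) 1) (axis (X.vx 0) 1)"
    using X.is_simple Y.is_simple X.highest_exists Y.lowest_exists[OF Y.tau1 refl] by blast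
  then have "(N - M) *v vtensor (axis (X.vx 0) 1) (axis (Y.vx r) 1) = 0"
    using val by (simp add: matrix_vector_mult_diff_rdistrib)
  moreover have "module_map r (tensor_action X Y) (tensor_action Y X) (N - M)"
    using M N by (simp add: module_map_def matrix_diff_distrib)
  ultimately have "N - M = 0" by (intro module_map_zero)
  then show "N = M" by simp
qed

end

lemma heckeR_mult:
  "(heckeR pos h ** A) $ (i, j) $ y = (if i = j then 1 else 1 / h) * A $ (j, i) $ y + (if pos j < pos i then 1 - 1 / h\<^sup>2 else 0) * A $ (i, j) $ y"
  "(A ** heckeR pos h) $ x $ (a, b) = (if a = b then 1 else 1 / h) * A $ x $ (b, a) + (if pos b < pos a then 1 - 1 / h\<^sup>2 else 0) * A $ x $ (a, b)"
proof -
  have "(heckeR pos h ** A) $ (i, j) $ y = (\<Sum>c\<in>UNIV. \<Sum>d\<in>UNIV.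
      (if d = i then if c = j then (if i = j then 1 else 1 / h) * A $ (j, i) $ y else 0 else 0)
    + (if d = j then if c = i then (if pos j < pos i then 1 - 1 / h\<^sup>2 else 0) * A $ (i, j) $ y else 0 else 0))"
    unfolding matrix_matrix_mult_def sum_pair_UNIV vec_lambda_beta
    by (intro sum.cong refl) (auto simp: heckeR_entry)
  then show "(heckeR pos h ** A) $ (i, j) $ y = (if i = j then 1 else 1 / h) * A $ (j, i) $ y + (if pos j < pos i then 1 - 1 / h\<^sup>2 else 0) * A $ (i, j) $ y"
    by (simp add: sum.distrib sum.delta)
  have "(A ** heckeR pos h) $ x $ (a, b) = (\<Sum>c\<in>UNIV. \<Sum>d\<in>UNIV.
      (if d = a then if c = b then (if a = b then 1 else 1 / h) * A $ x $ (b, a) else 0 else 0)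
    + (if d = b then if c = a then (if pos b < pos a then 1 - 1 / h\<^sup>2 else 0) * A $ x $ (a, b) else 0 else 0))"
    unfolding matrix_matrix_mult_def sum_pair_UNIV vec_lambda_beta
    by (intro sum.cong refl) (auto simp: heckeR_entry)
  then show "(A ** heckeR pos h) $ x $ (a, b) = (if a = b then 1 else 1 / h) * A $ x $ (b, a) + (if pos b < pos a then 1 - 1 / h\<^sup>2 else 0) * A $ x $ (a, b)"
    by (simp add: sum.distrib sum.delta)
qed

context chain
begin

lemma pos_lo_up:
  assumes "i \<in> {1..r}"
  shows "pos (up i) < pos (lo i)" "m \<noteq> up i \<Longrightarrow> m \<noteq> lo i \<Longrightarrow> pos m < pos (lo i) \<longleftrightarrow> pos m < pos (up i)"
    "m \<noteq> up i \<Longrightarrow> m \<noteq> lo i \<Longrightarrow> pos (lo i) < pos m \<longleftrightarrow> pos (up i) < pos m"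
    "m \<noteq> up i \<Longrightarrow> m \<noteq> lo i \<Longrightarrow> pos m < pos (up i) \<or> pos (up i) < pos m"
  using pos_up[OF assms] pos_lo[OF assms] pos_eq[of m "up i"] pos_eq[of m "lo i"] by linarith+

text \<open>
  The following commutations say that \<open>R\<close> is a module map.  \<open>K\<close> is clear by weights; for \<open>E\<close> and \<open>F\<close> only the two
  axes of a single step are involved, and the remaining axes matter through their position relative
  to this pair, which is the same for both of its members.
\<close>

lemma heckeR_K: "i \<in> {1..r} \<Longrightarrow> heckeR pos h ** kron (actK X i) (actK X i) = kron (actK X i) (actK X i) ** heckeR pos h"
  by (auto simp: vec_eq_iff split_paired_All heckeR_mult kron_def K_entry)

lemma heckeR_E:
  assumes i: "i \<in> {1..r}"
  defines "h \<equiv> complex_of_real q"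
  shows "heckeR pos h ** actE (tensor_action X X) i = actE (tensor_action X X) i ** heckeR pos h"
proof -
  define u l where "u = up i" and "l = lo i"
  have h0: "h \<noteq> 0" using q0 by (simp add: h_def)
  have ul: "u \<noteq> l" "l \<noteq> u" using lo_up[OF i] by (auto simp: u_def l_def)
  note P = pos_lo_up[OF i, folded u_def l_def]
  define A where "A = actE (tensor_action X X) i"
  define k where "k a = (if a = u then h else if a = l then 1 / h else 1)" for a
  have A: "A $ (x, y) $ (a, b) = (if x = u \<and> a = l then c i else 0) * (if y = b then k b else 0) + (if x = a then 1 else 0) * (if y = u \<and> b = l then c i else 0)" for x y a b
    by (simp add: A_def tensor_action_def kron_def E_entry'[OF i] K_entry'[OF i] u_def l_def k_def h_def mat_def)
  have hh: "h * (1 / h) = 1" using h0 by simp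
  have "(heckeR pos h ** A) $ (x, y) $ (a, b) = (A ** heckeR pos h) $ (x, y) $ (a, b)" for x y a b
  proof -
    consider "x = u" "a = l" | "x = u" "b = l" "a \<noteq> l" | "y = u" "a = l" "x \<noteq> u" | "y = u" "b = l" "x \<noteq> u" "a \<noteq> l" | "x \<noteq> u" "y \<noteq> u" | "a \<noteq> l" "b \<noteq> l"
      by blast
    then show ?thesis
    proof cases
      case 1
      then show ?thesis unfolding heckeR_mult A k_def using ul P h0
        by (cases "y = u"; cases "y = l"; cases "b = u"; cases "b = l"; cases "y = b"; cases "pos y < pos u")
         (auto simp: field_simps power2_eq_square)
    next
      case 2
      then show ?thesis unfolding heckeR_mult A k_def using ul P h0
        by (cases "y = u"; cases "y = l"; cases "a = u"; cases "y = a"; cases "pos y < pos u")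
         (auto simp: field_simps power2_eq_square)
    next
      case 3
      then show ?thesis unfolding heckeR_mult A k_def using ul P h0
        by (cases "x = l"; cases "b = u"; cases "b = l"; cases "x = b"; cases "pos x < pos u")
         (auto simp: field_simps power2_eq_square)
    next
      case 4
      then show ?thesis unfolding heckeR_mult A k_def using ul P h0
        by (cases "x = l"; cases "a = u"; cases "x = a"; cases "pos x < pos u")
         (auto simp: field_simps power2_eq_square)
    qed (auto simp: heckeR_mult A)
  qed
  then show ?thesis by (simp add: A_def vec_eq_iff split_paired_All)
qed

lemma heckeR_F:
  assumes i: "i \<in> {1..r}"
  defines "h \<equiv> complex_of_real q"
  shows "heckeR pos h ** actF (tensor_action X X) i = actF (tensor_action X X) i ** heckeR pos h"
proof -
  define u l where "u = up i" and "l = lo i"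
  have h0: "h \<noteq> 0" using q0 by (simp add: h_def)
  have ul: "u \<noteq> l" "l \<noteq> u" using lo_up[OF i] by (auto simp: u_def l_def)
  note P = pos_lo_up[OF i, folded u_def l_def]
  define A where "A = actF (tensor_action X X) i"
  define d where "d = 1 / c i"
  define k where "k a = (if a = u then 1 / h else if a = l then h else 1)" for a
  have Ki: "matrix_inv (actK X i) $ a $ b = (if a = b then k a else 0)" for a b
    by (cases "a = u"; cases "a = l") (simp_all add: matrix_inv_K[OF i] K_entry'[OF i] u_def[symmetric] l_def[symmetric] k_def h_def)
  have Fe: "actF X i $ a $ b = (if a = l \<and> b = u then d else 0)" for a b
    by (simp only: F_entry'[OF i] u_def l_def d_def)
  have A: "A $ (x, y) $ (a, b) = (if x = l \<and> a = u then d else 0) * (if y = b then 1 else 0) + (if x = a then k x else 0) * (if y = l \<and> b = u then d else 0)" for x y a b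
    by (simp add: A_def tensor_action_def kron_def Fe Ki mat_def)
  have "(heckeR pos h ** A) $ (x, y) $ (a, b) = (A ** heckeR pos h) $ (x, y) $ (a, b)" for x y a b
  proof -
    consider "x = l" "a = u" | "x = l" "b = u" "a \<noteq> u" | "y = l" "a = u" "x \<noteq> l" | "y = l" "b = u" "x \<noteq> l" "a \<noteq> u" | "x \<noteq> l" "y \<noteq> l" | "a \<noteq> u" "b \<noteq> u"
      by blast
    then show ?thesis
    proof cases
      case 1
      then show ?thesis unfolding heckeR_mult A k_def using ul P h0
        by (cases "y = u"; cases "y = l"; cases "b = u"; cases "b = l"; cases "y = b"; cases "pos y < pos u")
         (auto simp: field_simps power2_eq_square)
    next
      case 2
      then show ?thesis unfolding heckeR_mult A k_def using ul P h0
        by (cases "y = u"; cases "y = l"; cases "a = l"; cases "y = a"; cases "pos y < pos u")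
         (auto simp: field_simps power2_eq_square)
    next
      case 3
      then show ?thesis unfolding heckeR_mult A k_def using ul P h0
        by (cases "x = u"; cases "b = u"; cases "b = l"; cases "x = b"; cases "pos x < pos u")
         (auto simp: field_simps power2_eq_square)
    next
      case 4
      then show ?thesis unfolding heckeR_mult A k_def using ul P h0
        by (cases "x = u"; cases "a = l"; cases "x = a"; cases "pos x < pos u")
         (auto simp: field_simps power2_eq_square)
    qed (auto simp: heckeR_mult A)
  qed
  then show ?thesis by (simp add: A_def vec_eq_iff split_paired_All)
qed

lemma heckeR_module_map: "module_map r (tensor_action X X) (tensor_action X X) (heckeR pos (complex_of_real q))"
  unfolding module_map_def using heckeR_E heckeR_F heckeR_K by (auto simp: tensor_action_def)

end

section \<open>The mixed module map\<close>

context chain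
begin

text \<open>
  \<open>dualK R\<close> arises from the module map \<open>R\<close> of \<open>X \<otimes> X\<close> by partial transposition, which is how duals turn a map
  of \<open>X \<otimes> X\<close> into one from \<open>X\<^sup>* \<otimes> X\<close> to \<open>X \<otimes> X\<^sup>*\<close>.  In coordinates the required identity is the one for \<open>R\<close> with the
  four sums \<open>S1, ..., S4\<close> rearranged and the weights \<open>k\<close> moved across by weight preservation of \<open>R\<close>.
\<close>

lemma dualK_module_map: "module_map r (tensor_action (dual_action X) X) (tensor_action X (dual_action X))
    (dualK (heckeR pos (complex_of_real q)))"
  unfolding module_map_def
proof (intro ballI conjI)
  fix i assume i: "i \<in> {1..r}"
  let ?h = "complex_of_real q"
  let ?R = "heckeR pos ?h"
  interpret D: chain r q "dual_action X" "\<lambda>a. r - pos a" "\<lambda>i. r + 1 - \<tau> i" "\<lambda>i. - complex_of_real q * c i"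
    using dual_chain q0 q1 r1 by unfold_locales
  define k where "k a = kd i a" for a
  have k0: "k a \<noteq> 0" for a by (simp add: k_def)
  define E where "E = actE X i"
  define F where "F = actF X i"
  have K: "actK X i $ a $ b = (if a = b then k a else 0)" for a b by (simp add: K_entry[OF i] k_def kd_def)
  have Kd: "actK (dual_action X) i $ a $ b = (if a = b then 1 / k a else 0)" for a b
    by (simp add: dual_action_def transpose_def matrix_inv_K[OF i] K)
  have Kdi: "matrix_inv (actK (dual_action X) i) $ a $ b = (if a = b then k a else 0)" for a b
    by (simp add: D.matrix_inv_K[OF i] Kd)
  have Ki: "matrix_inv (actK X i) $ a $ b = (if a = b then 1 / k a else 0)" for a b
    by (simp add: matrix_inv_K[OF i] K)
  have Ed: "actE (dual_action X) i $ a $ b = - E $ b $ a / k a" for a b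
    by (simp add: dual_action_def transpose_def K_mult[OF i] E_def k_def)
  have Fd: "actF (dual_action X) i $ a $ b = - k b * F $ b $ a" for a b
    by (simp add: dual_action_def transpose_def K_mult[OF i] F_def k_def)
  have wt: "k a * k c * ?R $ (a, c) $ (b, d) = k b * k d * ?R $ (a, c) $ (b, d)" for a b c d
    by (auto simp: heckeR_entry)
  have mm: "(A ** B) $ p $ z = (\<Sum>x\<in>UNIV. \<Sum>y\<in>UNIV. A $ p $ (x, y) * B $ (x, y) $ z)"
    for A B :: "complex ^ ('n \<times> 'n) ^ ('n \<times> 'n)" and p z
    by (simp add: matrix_matrix_mult_def sum_pair_UNIV)
  have sumA: "(\<Sum>x\<in>UNIV. \<Sum>y\<in>UNIV. G x y * ((if y = b then A x else 0) + (if x = a then B y else 0))) =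
      (\<Sum>x\<in>UNIV. G x b * A x) + (\<Sum>y\<in>UNIV. G a y * B y)"
    and sumB: "(\<Sum>x\<in>UNIV. \<Sum>y\<in>UNIV. ((if b = y then A x else 0) + (if a = x then B y else 0)) * G x y) =
      (\<Sum>x\<in>UNIV. A x * G x b) + (\<Sum>y\<in>UNIV. B y * G a y)"
    and sumC: "(\<Sum>x\<in>UNIV. \<Sum>y\<in>UNIV. G x y * (if x = a \<and> y = b then z else 0)) = G a b * z"
    and sumD: "(\<Sum>x\<in>UNIV. \<Sum>y\<in>UNIV. (if a = x \<and> b = y then z else 0) * G x y) = z * G a b"
    for G :: "'n \<Rightarrow> 'n \<Rightarrow> complex" and A B a b z
  proof -
    have "(\<Sum>x\<in>UNIV. \<Sum>y\<in>UNIV. G x y * ((if y = b then A x else 0) + (if x = a then B y else 0))) =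
      (\<Sum>x\<in>UNIV. \<Sum>y\<in>UNIV. if y = b then G x y * A x else 0) + (\<Sum>x\<in>UNIV. \<Sum>y\<in>UNIV. if x = a then G x y * B y else 0)"
      unfolding sum.distrib[symmetric] by (intro sum.cong refl) (auto simp: distrib_left)
    also have "(\<Sum>x\<in>UNIV. \<Sum>y\<in>UNIV. if x = a then G x y * B y else 0) = (\<Sum>y\<in>UNIV. G a y * B y)"
      by (subst sum.swap) (simp add: sum.delta)
    finally show A: "(\<Sum>x\<in>UNIV. \<Sum>y\<in>UNIV. G x y * ((if y = b then A x else 0) + (if x = a then B y else 0))) =
      (\<Sum>x\<in>UNIV. G x b * A x) + (\<Sum>y\<in>UNIV. G a y * B y)" by (simp add: sum.delta)
    show "(\<Sum>x\<in>UNIV. \<Sum>y\<in>UNIV. ((if b = y then A x else 0) + (if a = x then B y else 0)) * G x y) =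
      (\<Sum>x\<in>UNIV. A x * G x b) + (\<Sum>y\<in>UNIV. B y * G a y)"
      using A by (simp only: mult.commute[of _ "G _ _"] eq_commute[of a] eq_commute[of b])
    have "(\<Sum>x\<in>UNIV. \<Sum>y\<in>UNIV. G x y * (if x = a \<and> y = b then z else 0)) =
      (\<Sum>x\<in>UNIV. \<Sum>y\<in>UNIV. if y = b then if x = a then G a b * z else 0 else 0)"
      by (intro sum.cong refl) auto
    then show C: "(\<Sum>x\<in>UNIV. \<Sum>y\<in>UNIV. G x y * (if x = a \<and> y = b then z else 0)) = G a b * z" by (simp add: sum.delta)
    have "(\<Sum>x\<in>UNIV. \<Sum>y\<in>UNIV. (if a = x \<and> b = y then z else 0) * G x y) =
      (\<Sum>x\<in>UNIV. \<Sum>y\<in>UNIV. if y = b then if x = a then z * G a b else 0 else 0)"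
      by (intro sum.cong refl) auto
    then show "(\<Sum>x\<in>UNIV. \<Sum>y\<in>UNIV. (if a = x \<and> b = y then z else 0) * G x y) = z * G a b" by (simp add: sum.delta)
  qed
  note te = tensor_action_def kron_def mat_def
  have KT: "actK (tensor_action X (dual_action X)) i $ (x, y) $ (a, b) = (if x = a \<and> y = b then k x / k y else 0)"
    and KT': "actK (tensor_action (dual_action X) X) i $ (x, y) $ (a, b) = (if x = a \<and> y = b then k b / k a else 0)"
    and ET: "actE (tensor_action X (dual_action X)) i $ (x, y) $ (a, b) = (if y = b then E $ x $ a / k y else 0) + (if x = a then - E $ b $ y / k y else 0)"
    and ET': "actE (tensor_action (dual_action X) X) i $ (x, y) $ (a, b) = (if y = b then - E $ a $ x / k x * k b else 0) + (if x = a then E $ y $ b else 0)"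
    and EV: "actE (tensor_action X X) i $ (x, y) $ (a, b) = (if y = b then E $ x $ a * k y else 0) + (if x = a then E $ y $ b else 0)"
    and FT: "actF (tensor_action X (dual_action X)) i $ (x, y) $ (a, b) = (if y = b then F $ x $ a else 0) + (if x = a then - (k b * F $ b $ y / k x) else 0)"
    and FT': "actF (tensor_action (dual_action X) X) i $ (x, y) $ (a, b) = (if y = b then - k a * F $ a $ x else 0) + (if x = a then k a * F $ y $ b else 0)"
    and FV: "actF (tensor_action X X) i $ (x, y) $ (a, b) = (if y = b then F $ x $ a else 0) + (if x = a then F $ y $ b / k x else 0)"
    and EV': "actE (tensor_action X X) i $ (x, y) $ (a, b) = (if y = b then E $ x $ a * k b else 0) + (if x = a then E $ y $ b else 0)"
    and FV': "actF (tensor_action X X) i $ (x, y) $ (a, b) = (if y = b then F $ x $ a else 0) + (if x = a then F $ y $ b / k a else 0)"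
    for x y a b
    by (auto simp: te K Kd Ed Fd Ki Kdi E_def[symmetric] F_def[symmetric])
  show "dualK ?R ** actK (tensor_action (dual_action X) X) i = actK (tensor_action X (dual_action X)) i ** dualK ?R"
  proof -
    have "(dualK ?R ** actK (tensor_action (dual_action X) X) i) $ (c, d) $ (a, b) =
      (actK (tensor_action X (dual_action X)) i ** dualK ?R) $ (c, d) $ (a, b)" for c d a b
      unfolding mm KT KT' sumC sumD dualK_entry using wt[of a c b d] k0 by (auto simp: field_simps)
    then show ?thesis by (simp add: vec_eq_iff split_paired_All)
  qed
  show "dualK ?R ** actE (tensor_action (dual_action X) X) i = actE (tensor_action X (dual_action X)) i ** dualK ?R"
  proof -
    have "(dualK ?R ** actE (tensor_action (dual_action X) X) i) $ (c, d) $ (a, b) =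
      (actE (tensor_action X (dual_action X)) i ** dualK ?R) $ (c, d) $ (a, b)" for c d a b
    proof -
      define S1 where "S1 = (\<Sum>x\<in>UNIV. ?R $ (a, c) $ (x, d) * E $ x $ b)"
      define S2 where "S2 = (\<Sum>x\<in>UNIV. ?R $ (a, c) $ (b, x) * E $ x $ d)"
      define S3 where "S3 = (\<Sum>x\<in>UNIV. ?R $ (x, c) $ (b, d) * (E $ a $ x / k x))"
      define S4 where "S4 = (\<Sum>x\<in>UNIV. E $ c $ x * ?R $ (a, x) $ (b, d))"
      have L: "(dualK ?R ** actE (tensor_action (dual_action X) X) i) $ (c, d) $ (a, b) = - (k b * S3) + S1"
        unfolding S1_def S3_def mm ET' sumA dualK_entry sum_distrib_left sum_negf[symmetric]
        by (intro arg_cong2[where f = "(+)"] sum.cong refl) (simp add: mult_ac)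
      have Rt: "(actE (tensor_action X (dual_action X)) i ** dualK ?R) $ (c, d) $ (a, b) = S4 / k d - S2 / k d"
        unfolding S2_def S4_def mm ET sumB dualK_entry sum_divide_distrib diff_conv_add_uminus sum_negf[symmetric]
        by (intro arg_cong2[where f = "(+)"] sum.cong refl) (simp_all add: mult_ac)
      have "(?R ** actE (tensor_action X X) i) $ (a, c) $ (b, d) = S1 * k d + S2"
        unfolding S1_def S2_def mm EV' sumA sum_distrib_right
        by (intro arg_cong2[where f = "(+)"] sum.cong refl) (simp_all add: mult_ac)
      moreover have "(actE (tensor_action X X) i ** ?R) $ (a, c) $ (b, d) = k b * k d * S3 + S4"
        unfolding S3_def S4_def mm EV sumB sum_distrib_left
        by (intro arg_cong2[where f = "(+)"] sum.cong refl) (use wt[of _ c b d] k0 in \<open>auto simp: field_simps\<close>)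
      ultimately have "S1 * k d + S2 = k b * k d * S3 + S4" using heckeR_E[OF i] by metis
      then show ?thesis unfolding L Rt using k0[of d] by (simp add: field_simps)
    qed
    then show ?thesis by (simp add: vec_eq_iff split_paired_All)
  qed
  show "dualK ?R ** actF (tensor_action (dual_action X) X) i = actF (tensor_action X (dual_action X)) i ** dualK ?R"
  proof -
    have "(dualK ?R ** actF (tensor_action (dual_action X) X) i) $ (c, d) $ (a, b) =
      (actF (tensor_action X (dual_action X)) i ** dualK ?R) $ (c, d) $ (a, b)" for c d a b
    proof -
      define S1 where "S1 = (\<Sum>x\<in>UNIV. ?R $ (a, c) $ (x, d) * F $ x $ b)"
      define S2 where "S2 = (\<Sum>x\<in>UNIV. ?R $ (a, c) $ (b, x) * F $ x $ d)"
      define S3 where "S3 = (\<Sum>x\<in>UNIV. F $ a $ x * ?R $ (x, c) $ (b, d))"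
      define S4 where "S4 = (\<Sum>x\<in>UNIV. F $ c $ x * ?R $ (a, x) $ (b, d))"
      have L: "(dualK ?R ** actF (tensor_action (dual_action X) X) i) $ (c, d) $ (a, b) = - (k a * S3) + k a * S1"
        unfolding S1_def S3_def mm FT' sumA dualK_entry sum_distrib_left sum_negf[symmetric]
        by (intro arg_cong2[where f = "(+)"] sum.cong refl) (simp_all add: mult_ac)
      have Rt: "(actF (tensor_action X (dual_action X)) i ** dualK ?R) $ (c, d) $ (a, b) = S4 + - (k a / k b * S2)"
        unfolding S2_def S4_def mm FT sumB dualK_entry sum_distrib_left sum_negf[symmetric]
        by (intro arg_cong2[where f = "(+)"] sum.cong refl) (use wt[of a c b] k0 in \<open>auto simp: field_simps\<close>, metis mult.commute)
      have "(?R ** actF (tensor_action X X) i) $ (a, c) $ (b, d) = S1 + S2 / k b"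
        unfolding S1_def S2_def mm FV' sumA sum_divide_distrib
        by (intro arg_cong2[where f = "(+)"] sum.cong refl) (simp_all add: mult_ac)
      moreover have "(actF (tensor_action X X) i ** ?R) $ (a, c) $ (b, d) = S3 + S4 / k a"
        unfolding S3_def S4_def mm FV sumB sum_divide_distrib
        by (intro arg_cong2[where f = "(+)"] sum.cong refl) (simp_all add: mult_ac)
      ultimately have eq: "S1 + S2 / k b = S3 + S4 / k a" using heckeR_F[OF i] by metis
      have "k a * S1 + k a / k b * S2 = k a * (S1 + S2 / k b)" by (simp add: distrib_left)
      also have "\<dots> = k a * S3 + S4" unfolding eq using k0[of a] by (simp add: distrib_left)
      finally show ?thesis unfolding L Rt by (simp add: algebra_simps)
    qed
    then show ?thesis by (simp add: vec_eq_iff split_paired_All)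
  qed
qed

end

section \<open>The three braidings\<close>

definition scalM :: "complex \<Rightarrow> complex ^ 'a::finite ^ 'b::finite \<Rightarrow> complex ^ 'a ^ 'b" where
  "scalM x A = (\<chi> i j. x * A $ i $ j)"

lemma scalM_mult: "scalM x A ** B = scalM x (A ** B)" "A ** scalM x B = scalM x (A ** B)"
  by (simp_all add: scalM_def vec_eq_iff matrix_matrix_mult_def sum_distrib_left mult_ac)
lemma scalM_vec: "scalM x A *v v = x *s (A *v v)"
  by (simp add: scalM_def vec_eq_iff matrix_vector_mult_def sum_distrib_left mult_ac)
lemma scalM_scalM: "scalM x (scalM y A) = scalM (x * y) A" "scalM 1 A = A"
  by (simp_all add: scalM_def vec_eq_iff)
lemma scalM_module_map: "module_map r X Y M \<Longrightarrow> module_map r X Y (scalM x M)"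
  by (simp add: module_map_def scalM_mult)

lemma longest_fundamental:
  assumes "j \<in> {1..r}"
  shows "longest r (fundamental_weight r j) = (\<lambda>k. - fundamental_weight r (r + 1 - j) k)"
proof
  fix k
  have "real (r + 1 - j) = real (r + 1) - real j" using assms by simp
  then have *: "real (r + 1 - j) / real (r + 1) = 1 - real j / real (r + 1)" by (simp add: diff_divide_distrib)
  show "longest r (fundamental_weight r j) k = - fundamental_weight r (r + 1 - j) k"
  proof (cases "k \<in> {1..r+1}")
    case True
    have "r + 2 - k \<in> {1..r+1}" using True by auto
    moreover have "r + 2 - k \<le> j \<longleftrightarrow> \<not> k \<le> r + 1 - j" using True assms by auto
    ultimately show ?thesis using True unfolding longest_def fundamental_weight_def * by auto
  qed (auto simp: longest_def fundamental_weight_def)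
qed

lemma wform_uminus: "wform r x (\<lambda>k. - y k) = - wform r x y"
  by (simp add: wform_def sum_negf)

lemma wform_fundamental:
  assumes r: "r \<ge> 1" and s: "s = 1 \<or> s = r"
  shows "wform r (fundamental_weight r s) (fundamental_weight r s) = 1 - 1 / real (r + 1)"
    and "wform r (fundamental_weight r s) (fundamental_weight r (r + 1 - s)) = 1 / real (r + 1)"
proof -
  define n where "n = real (r + 1)"
  have n0: "n \<noteq> 0" by (simp add: n_def)
  have f1: "fundamental_weight r 1 k = (if k = 1 then 1 else 0) - 1 / n" if "k \<in> {1..r+1}" for k
    using that by (auto simp: fundamental_weight_def n_def)
  have rn: "real r / n = 1 - 1 / n" using n0 by (simp add: n_def field_simps)
  have fr: "fundamental_weight r r k = 1 / n - (if k = r + 1 then 1 else 0)" if "k \<in> {1..r+1}" for k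
    using that rn unfolding n_def[symmetric] fundamental_weight_def by auto
  have sn: "(\<Sum>k = 1..r+1. z) = n * z" for z :: real by (simp add: n_def)
  have d1: "(\<Sum>k = 1..r+1. if k = 1 then z else 0) = z" and dr: "(\<Sum>k = 1..r+1. if k = r + 1 then z else 0) = z" for z :: real
    by (simp_all add: sum.delta)
  have 11: "wform r (fundamental_weight r 1) (fundamental_weight r 1) = 1 - 1 / n"
  proof -
    have "wform r (fundamental_weight r 1) (fundamental_weight r 1) = (\<Sum>k = 1..r+1. (if k = 1 then 1 - 2 / n else 0) + 1 / (n * n))"
      unfolding wform_def by (intro sum.cong refl) (simp only: f1, simp add: algebra_simps)
    also have "\<dots> = 1 - 2 / n + n * (1 / (n * n))" unfolding sum.distrib sn d1 ..
    finally show ?thesis using n0 by (simp add: field_simps)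
  qed
  have rr: "wform r (fundamental_weight r r) (fundamental_weight r r) = 1 - 1 / n"
  proof -
    have "wform r (fundamental_weight r r) (fundamental_weight r r) = (\<Sum>k = 1..r+1. (if k = r + 1 then 1 - 2 / n else 0) + 1 / (n * n))"
      unfolding wform_def by (intro sum.cong refl) (simp only: fr, simp add: algebra_simps)
    also have "\<dots> = 1 - 2 / n + n * (1 / (n * n))" unfolding sum.distrib sn dr ..
    finally show ?thesis using n0 by (simp add: field_simps)
  qed
  have 1: "wform r (fundamental_weight r 1) (fundamental_weight r r) = 1 / n"
  proof -
    have "wform r (fundamental_weight r 1) (fundamental_weight r r) = (\<Sum>k = 1..r+1. (if k = 1 then 1 / n else 0) + (if k = r + 1 then 1 / n else 0) + (- 1 / (n * n)))"
      unfolding wform_def using r by (intro sum.cong refl) (simp only: fr f1, simp add: algebra_simps)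
    also have "\<dots> = 1 / n + 1 / n + n * (- 1 / (n * n))" unfolding sum.distrib sn dr d1 ..
    finally show ?thesis using n0 by (simp add: field_simps)
  qed
  have 2: "wform r (fundamental_weight r r) (fundamental_weight r 1) = 1 / n"
    unfolding 1[symmetric] unfolding wform_def by (intro sum.cong refl mult.commute)
  show "wform r (fundamental_weight r s) (fundamental_weight r s) = 1 - 1 / real (r + 1)"
    using s 11 rr unfolding n_def by blast
  show "wform r (fundamental_weight r s) (fundamental_weight r (r + 1 - s)) = 1 / real (r + 1)"
    using s
  proof
    assume "s = 1" then show ?thesis using 1 unfolding n_def by simp
  next
    assume "s = r" then show ?thesis using 2 unfolding n_def by simp
  qed
qed

lemma two_rho_entry:
  assumes "k \<in> {1..r+1}" shows "two_rho r k = real r + 2 - 2 * real k"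
proof -
  have "(\<Sum>i = 1..r. fundamental_weight r i k) = (\<Sum>i = 1..r. if k \<le> i then 1 else 0) - (\<Sum>i = 1..r. real i / real (r + 1))"
    using assms by (simp add: fundamental_weight_def sum_subtractf)
  also have "(\<Sum>i = 1..r. if k \<le> i then 1 else 0 :: real) = (\<Sum>i = k..r. 1)"
    using assms by (intro sum.mono_neutral_cong_right) auto
  also have "\<dots> = real (r + 1) - real k" using assms by auto
  also have "(\<Sum>i = 1..r. real i / real (r + 1)) = real r / 2"
  proof -
    have "(\<Sum>i = 1..r. real i) = real r * (real r + 1) / 2" by (induction r) (auto simp: field_simps)
    then show ?thesis by (simp add: sum_divide_distrib[symmetric] field_simps)
  qed
  finally show ?thesis by (simp add: two_rho_def field_simps)
qed

text \<open>
  Summation by parts, since \<open>2\<rho>\<close> is the combination of the simple roots with coefficients \<open>j (r + 1 - j)\<close>.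
\<close>

lemma wform_two_rho: "wform r x (two_rho r) = (\<Sum>j = 1..r. real j * (real r + 1 - real j) * wform r (simple_root j) x)"
proof -
  define C where "C k = real k * (real r + 1 - real k)" for k
  have Abel: "(\<Sum>k = 1..n. (C k - C (k - 1)) * x k) = C n * x n + (\<Sum>k = 1..<n. C k * (x k - x (k + 1)))" if "n \<ge> 1" for n
    using that
  proof (induction n rule: nat_induct_at_least)
    case base
    then show ?case by (simp add: C_def)
  next
    case (Suc n)
    then show ?case by (simp add: algebra_simps)
  qed
  have "wform r x (two_rho r) = (\<Sum>k = 1..r+1. (C k - C (k - 1)) * x k)"
    unfolding wform_def
  proof (intro sum.cong refl)
    fix k assume k: "k \<in> {1..r+1}"
    then have "real (k - 1) = real k - 1" by auto
    then have "C k - C (k - 1) = two_rho r k" unfolding two_rho_entry[OF k] C_def by (simp add: algebra_simps)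
    then show "x k * two_rho r k = (C k - C (k - 1)) * x k" by simp
  qed
  also have "\<dots> = (\<Sum>k = 1..<r+1. C k * (x k - x (k + 1)))"
    by (subst Abel) (simp_all add: C_def)
  also have "\<dots> = (\<Sum>j = 1..r. C j * wform r (simple_root j) x)"
    by (intro sum.cong) (auto simp: wform_simple_root)
  finally show ?thesis by (simp add: C_def)
qed

lemma vtensor_axis_entry: "((A :: complex ^ ('a::finite \<times> 'b::finite) ^ 'c::finite) *v vtensor (axis a 1) (axis b 1)) $ c = A $ c $ (a, b)"
  unfolding vtensor_axis matrix_axis_entry ..

lemma vtensor_axis_at: "vtensor (axis a 1) (axis b 1) $ (c, d) = (if c = a \<and> d = b then 1 else 0)"
  by (auto simp: vtensor_def axis_def)

context chain
begin

text \<open>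
  Only the two simple roots next to position \<open>p\<close> contribute, so the sum is a difference of the coefficients of \<open>2\<rho>\<close>, which
  are symmetric under the reversal of the diagram.
\<close>

lemma kexp_two_rho:
  assumes x: "\<And>j. j \<in> {1..r} \<Longrightarrow> wform r (simple_root j) x = kexp \<tau> j p" and p: "p \<le> r"
  shows "wform r x (two_rho r) = real r - 2 * real p"
proof -
  define C where "C k = real k * (real r + 1 - real k)" for k
  have Ctau: "C (\<tau> j) = C j" if "j \<in> {1..r}" for j
    using tau that by (auto simp: C_def of_nat_diff)
  have inj: "inj_on \<tau> {1..r}" by (rule inj_onI) (use tau_inj in blast)
  have im: "\<tau> ` {1..r} = {1..r}"
  proof
    show "\<tau> ` {1..r} \<subseteq> {1..r}" using tau_range by blast
    show "{1..r} \<subseteq> \<tau> ` {1..r}"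
    proof
      fix j assume "j \<in> {1..r}"
      then show "j \<in> \<tau> ` {1..r}" using tau_range[of j] tau_tau[of j] by (intro image_eqI[of _ _ "\<tau> j"]) auto
    qed
  qed
  have "wform r x (two_rho r) = (\<Sum>j = 1..r. C (\<tau> j) * kexp (\<lambda>i. i) (\<tau> j) p)"
    unfolding wform_two_rho using x Ctau by (intro sum.cong refl) (simp add: C_def kexp_def)
  also have "\<dots> = (\<Sum>j = 1..r. C j * kexp (\<lambda>i. i) j p)"
    using sum.reindex[OF inj, of "\<lambda>j. C j * kexp (\<lambda>i. i) j p"] by (simp add: im del: One_nat_def)
  also have "\<dots> = (\<Sum>j = 1..r. (if j = Suc p then C (Suc p) else 0) - (if j = p then C p else 0))"
    by (intro sum.cong refl) (auto simp: kexp_def)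
  also have "\<dots> = C (Suc p) - C p"
  proof -
    have "(\<Sum>j = 1..r. if j = Suc p then C (Suc p) else 0) = C (Suc p)"
      using p by (cases "p = r") (auto simp: sum.delta C_def)
    moreover have "(\<Sum>j = 1..r. if j = p then C p else 0) = C p"
      using p by (cases "p = 0") (auto simp: sum.delta C_def)
    ultimately show ?thesis by (simp add: sum_subtractf)
  qed
  finally show ?thesis by (simp add: C_def algebra_simps)
qed

lemma tau1_cases: "\<tau> 1 = 1 \<or> \<tau> 1 = r" using tau r1 by auto

definition wgt where "wgt = wform r (fundamental_weight r (\<tau> 1)) (fundamental_weight r (\<tau> 1))"

lemma braiding_VV: "braiding r q X X = scalM (qpow q wgt) (heckeR pos (complex_of_real q))"
proof -
  interpret XX: two_chains r q X pos \<tau> c X pos \<tau> c by unfold_locales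
  show ?thesis
  proof (rule XX.braiding_eqI)
    show "module_map r (tensor_action X X) (tensor_action X X) (scalM (qpow q wgt) (heckeR pos (complex_of_real q)))"
      by (rule scalM_module_map[OF heckeR_module_map])
    have "wform r (fundamental_weight r (\<tau> 1)) (longest r (fundamental_weight r (\<tau> 1))) = wgt + (- 1)"
      using wform_fundamental[OF r1 tau1_cases] unfolding wgt_def longest_fundamental[OF tau1] wform_uminus by simp
    then have qw: "qpow q (wform r (fundamental_weight r (\<tau> 1)) (longest r (fundamental_weight r (\<tau> 1)))) = qpow q wgt * (1 / complex_of_real q)"
      using q0 by (simp only: qpow_add qpow_neg1)
    have ne: "vx 0 \<noteq> vx r" using pos_vx[of 0] pos_vx[of r] r1 by auto
    show "scalM (qpow q wgt) (heckeR pos (complex_of_real q)) *v vtensor (axis (vx 0) 1) (axis (vx r) 1) =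
      qpow q (wform r (fundamental_weight r (\<tau> 1)) (longest r (fundamental_weight r (\<tau> 1)))) *s vtensor (axis (vx r) 1) (axis (vx 0) 1)"
      unfolding qw scalM_vec vec_eq_iff split_paired_All vector_smult_component vtensor_axis_entry heckeR_entry
      using ne pos_vx[of 0] by (auto simp: vtensor_axis_at)
  qed
qed

lemma braiding_dual: "braiding r q (dual_action X) (dual_action X) = scalM (qpow q wgt) (dualRs (heckeR pos (complex_of_real q)))"
proof -
  interpret D: chain r q "dual_action X" "\<lambda>a. r - pos a" "\<lambda>i. r + 1 - \<tau> i" "\<lambda>i. - complex_of_real q * c i"
    using dual_chain q0 q1 r1 by unfold_locales
  have "D.wgt = wgt"
    unfolding D.wgt_def wgt_def using wform_fundamental(1)[OF r1 tau1_cases] wform_fundamental(1)[OF r1 D.tau1_cases] by simp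
  moreover have "heckeR (\<lambda>a. r - pos a) h = dualRs (heckeR pos h)" for h
  proof -
    have "r - pos b < r - pos a \<longleftrightarrow> pos a < pos b" for a b using pos_le[of a] pos_le[of b] by linarith
    then show ?thesis unfolding vec_eq_iff split_paired_All heckeR_entry dualRs_entry by auto
  qed
  ultimately show ?thesis using D.braiding_VV by simp
qed

lemma pos_bij_less: "CARD('n) = r + 1 \<Longrightarrow> bij_betw pos UNIV {..<CARD('n)}"
  using bij by (simp add: lessThan_Suc_atMost)

text \<open>
  \<open>dualK\<close> is a module map in the opposite direction, so its inverse is one in the direction of the braiding.
\<close>

lemma braiding_mixed:
  assumes card: "CARD('n) = r + 1"
  shows "braiding r q X (dual_action X) = scalM (qpow q (- wgt)) (dualM pos (complex_of_real q))"
proof -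
  interpret D: chain r q "dual_action X" "\<lambda>a. r - pos a" "\<lambda>i. r + 1 - \<tau> i" "\<lambda>i. - complex_of_real q * c i"
    using dual_chain q0 q1 r1 by unfold_locales
  interpret XD: two_chains r q X pos \<tau> c "dual_action X" "\<lambda>a. r - pos a" "\<lambda>i. r + 1 - \<tau> i" "\<lambda>i. - complex_of_real q * c i"
    by unfold_locales
  let ?h = "complex_of_real q"
  have h0: "?h \<noteq> 0" using q0 by simp
  interpret B: braided_legs "heckeR pos ?h" "heckeRi pos ?h" "dualRs (heckeR pos ?h)" "dualRs (heckeRi pos ?h)"
    "dualK (heckeR pos ?h)" "dualM pos ?h" "\<lambda>a. (1 / ?h\<^sup>2) ^ pos a" "?h\<^sup>2"
    by (rule heckeR_braided_legs[OF h0 pos_bij_less[OF card]])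
  have Dvx: "D.vx r = vx 0"
  proof -
    have "pos (D.vx r) = 0" using D.pos_vx[of r] pos_le[of "D.vx r"] by linarith
    then show ?thesis using vx_pos[of "D.vx r"] by simp
  qed
  show ?thesis
  proof (rule XD.braiding_eqI)
    have inv: "dualM pos ?h ** B = A ** dualM pos ?h" if "dualK (heckeR pos ?h) ** A = B ** dualK (heckeR pos ?h)" for A B
    proof -
      have "dualM pos ?h ** B = dualM pos ?h ** (B ** dualK (heckeR pos ?h)) ** dualM pos ?h"
        by (simp add: matrix_mul_assoc[symmetric] B.KM)
      also have "\<dots> = A ** dualM pos ?h"
        by (simp add: that[symmetric] matrix_mul_assoc B.MK)
      finally show ?thesis .
    qed
    have "module_map r (tensor_action X (dual_action X)) (tensor_action (dual_action X) X) (dualM pos ?h)"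
      using dualK_module_map unfolding module_map_def by (auto intro: inv)
    then show "module_map r (tensor_action X (dual_action X)) (tensor_action (dual_action X) X) (scalM (qpow q (- wgt)) (dualM pos ?h))"
      by (rule scalM_module_map)
    have "r + 1 - (r + 1 - \<tau> 1) = \<tau> 1" using tau1 by simp
    then have qw: "wform r (fundamental_weight r (\<tau> 1)) (longest r (fundamental_weight r (r + 1 - \<tau> 1))) = - wgt"
      using longest_fundamental[OF D.tau1] unfolding wgt_def by (simp add: wform_uminus del: One_nat_def)
    show "scalM (qpow q (- wgt)) (dualM pos ?h) *v vtensor (axis (vx 0) 1) (axis (D.vx r) 1) =
      qpow q (wform r (fundamental_weight r (\<tau> 1)) (longest r (fundamental_weight r (r + 1 - \<tau> 1)))) *s vtensor (axis (D.vx r) 1) (axis (vx 0) 1)"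
    proof -
      have inj: "inj pos" using bij by (simp add: bij_betw_def)
      have "dualM pos ?h $ (a, b) $ (vx 0, vx 0) = (if a = vx 0 \<and> b = vx 0 then 1 else 0)" for a b
        using pos_vx[of 0] h0 by (auto simp: dualM_def heckeRi_entry[OF h0 inj])
      then show ?thesis
        unfolding qw scalM_vec vec_eq_iff split_paired_All vector_smult_component vtensor_axis_entry Dvx
        by (auto simp: vtensor_axis_at)
    qed
  qed
qed

end

text \<open>
  The position function serves both to describe the braidings and to express the weights in \<open>E'\<close>, and this common
  choice is what links the traces of the calculus to the R-matrix.
\<close>

theorem braidings_explicit:
  fixes r s :: nat and q :: real and V :: "'n::finite uq_action" and wt :: "'n \<Rightarrow> weight"
  assumes r1: "r \<ge> 1" and q0: "0 < q" and q1: "q < 1" and s: "s \<in> {1, r}" and card: "CARD('n) = r + 1"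
    and simp: "is_simple_type1 r q V (fundamental_weight r s)"
    and wv: "\<And>i. weight_vector r q V (wt i) (axis i 1)"
  defines "w \<equiv> wform r (fundamental_weight r s) (fundamental_weight r s)"
    and "m \<equiv> wform r (fundamental_weight r s) (two_rho r)"
    and "h \<equiv> complex_of_real q"
  shows "\<exists>pos. bij_betw pos UNIV {..<CARD('n)} \<and>
    braiding r q V V = scalM (qpow q w) (heckeR pos h) \<and>
    braiding r q (dual_action V) (dual_action V) = scalM (qpow q w) (dualRs (heckeR pos h)) \<and>
    braiding r q V (dual_action V) = scalM (qpow q (- w)) (dualM pos h) \<and>
    (\<forall>a. qpow q (wform r (wt a) (two_rho r)) = qpow q m * (1 / h\<^sup>2) ^ pos a)"
proof -
  define \<tau> where "\<tau> = (\<lambda>i. if s = 1 then i else r + 1 - i)"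
  obtain pos c where ch: "chain_module r q V pos \<tau> c"
    and wt: "\<forall>a. \<forall>i\<in>{1..r}. wform r (simple_root i) (wt a) = kexp \<tau> i (pos a)"
    using simple_module_chain[OF r1 q0 q1 s card simp wv] unfolding \<tau>_def by blast
  interpret chain r q V pos \<tau> c by unfold_locales (use q0 q1 r1 ch in auto)
  have t1: "\<tau> 1 = s" using s by (auto simp: \<tau>_def)
  have w: "wgt = w" unfolding wgt_def w_def t1 ..
  have "wform r (wt a) (two_rho r) = real r - 2 * real (pos a)" for a
    using kexp_two_rho[of "wt a" "pos a"] wt pos_le by blast
  moreover have "m = real r"
  proof -
    have "wform r (simple_root j) (fundamental_weight r s) = kexp \<tau> j 0" if "j \<in> {1..r}" for j
      using kexp_0[OF that] wform_simple_fundamental[OF that tau1] unfolding t1 by simp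
    then show ?thesis using kexp_two_rho[of "fundamental_weight r s" 0] by (simp add: m_def)
  qed
  moreover have "qpow q (real r - 2 * real p) = qpow q (real r) * (1 / h\<^sup>2) ^ p" for p
  proof (induction p)
    case (Suc p)
    have "qpow q (real r - 2 * real (Suc p)) = qpow q (real r - 2 * real p) * qpow q (- 2)"
      by (simp only: qpow_add[symmetric]) (simp add: algebra_simps)
    moreover have "qpow q (- 2) = 1 / h\<^sup>2" unfolding qpow_minus qpow_2[OF q0] h_def ..
    ultimately show ?case unfolding Suc by simp
  qed simp
  ultimately have "\<forall>a. qpow q (wform r (wt a) (two_rho r)) = qpow q m * (1 / h\<^sup>2) ^ pos a" by simp
  then show ?thesis
    using braiding_VV braiding_dual braiding_mixed[OF card] pos_bij_less[OF card] unfolding w h_def by blast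
qed

section \<open>Linear maps out of presented spaces and the universal calculus\<close>

text \<open>
  Complex linearity as a plain conjunction, which is easier to feed to the simplifier than the locale predicate.
\<close>

definition clin :: "('a::complex_vector \<Rightarrow> 'b::complex_vector) \<Rightarrow> bool" where
  "clin f \<longleftrightarrow> (\<forall>x y. f (x + y) = f x + f y) \<and> (\<forall>c x. f (c *\<^sub>C x) = c *\<^sub>C f x)"

lemma linear_clin: "Vector_Spaces.linear scaleC scaleC f \<longleftrightarrow> clin f"
  by (simp add: clin_def Vector_Spaces.linear_iff complex_vector.vector_space_axioms)

lemma clin_add: "clin f \<Longrightarrow> f (x + y) = f x + f y"
  and clin_scale: "clin f \<Longrightarrow> f (c *\<^sub>C x) = c *\<^sub>C f x"
  by (simp_all add: clin_def)

lemma scaleC_zero_left [simp]: "0 *\<^sub>C (x :: 'a::complex_vector) = 0"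
  by (rule complex_vector.scale_zero_left)
lemma scaleC_minus_one: "(- 1) *\<^sub>C (x :: 'a::complex_vector) = - x"
  by (metis complex_vector.scale_minus_left scaleC_one)

lemma clin_0: "clin f \<Longrightarrow> f 0 = 0"
  by (metis clin_scale scaleC_zero_left)
lemma clin_minus: "clin f \<Longrightarrow> f (- x) = - f x"
  by (metis clin_scale scaleC_minus_one)
lemma clin_diff: "clin f \<Longrightarrow> f (x - y) = f x - f y"
  using clin_add[of f x "- y"] by (simp add: clin_minus)
lemma clin_sum: "clin f \<Longrightarrow> f (sum g A) = (\<Sum>i\<in>A. f (g i))"
  by (induction A rule: infinite_finite_induct) (simp_all add: clin_0 clin_add)
lemma clin_compose: "clin f \<Longrightarrow> clin g \<Longrightarrow> clin (\<lambda>x. f (g x))"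
  by (simp add: clin_def)
lemma clin_plus: "clin f \<Longrightarrow> clin g \<Longrightarrow> clin (\<lambda>x. f x + g x)"
  by (simp add: clin_def scaleC_add_right algebra_simps)
lemma clin_sub: "clin f \<Longrightarrow> clin g \<Longrightarrow> clin (\<lambda>x. f x - g x)"
  by (simp add: clin_def complex_vector.scale_right_diff_distrib algebra_simps)
lemma clin_scaleC: "clin (\<lambda>x. c *\<^sub>C x)"
  by (simp add: clin_def scaleC_add_right scaleC_scaleC mult.commute)

lemma lookup_scaleC: "Poly_Mapping.lookup (c *\<^sub>C x) k = c *\<^sub>C Poly_Mapping.lookup x k"
  by (simp add: scaleC_poly_mapping_def Poly_Mapping.map.rep_eq when_def)

lemma free_eval_superset:
  assumes "finite S" "Poly_Mapping.keys x \<subseteq> S"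
  shows "free_eval f x = (\<Sum>g\<in>S. Poly_Mapping.lookup x g *\<^sub>C f g)"
  unfolding free_eval_def using assms
  by (intro sum.mono_neutral_left) (auto simp: in_keys_iff)

lemma clin_free_eval:
  fixes f :: "'g \<Rightarrow> 'm::complex_vector"
  shows "clin (free_eval f)"
  unfolding clin_def
proof (intro conjI allI)
  fix x y :: "'g \<Rightarrow>\<^sub>0 complex"
  let ?S = "Poly_Mapping.keys x \<union> Poly_Mapping.keys y"
  have "free_eval f (x + y) = (\<Sum>g\<in>?S. Poly_Mapping.lookup (x + y) g *\<^sub>C f g)"
    by (rule free_eval_superset) (simp_all add: Poly_Mapping.keys_add)
  also have "\<dots> = free_eval f x + free_eval f y"
    by (simp add: free_eval_superset[of ?S] lookup_add scaleC_add_left sum.distrib)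
  finally show "free_eval f (x + y) = free_eval f x + free_eval f y" .
next
  fix c and x :: "'g \<Rightarrow>\<^sub>0 complex"
  have "free_eval f (c *\<^sub>C x) = (\<Sum>g\<in>Poly_Mapping.keys x. Poly_Mapping.lookup (c *\<^sub>C x) g *\<^sub>C f g)"
    by (rule free_eval_superset) (auto simp: in_keys_iff lookup_scaleC)
  also have "\<dots> = c *\<^sub>C free_eval f x"
    by (simp add: free_eval_def lookup_scaleC scaleC_complex_def scaleC_scaleC complex_vector.scale_sum_right)
  finally show "free_eval f (c *\<^sub>C x) = c *\<^sub>C free_eval f x" .
qed

lemma free_eval_single: "free_eval f (Poly_Mapping.single g c) = c *\<^sub>C f g"
  by (simp add: free_eval_def)

lemma clin_free_eval_comp: "clin L \<Longrightarrow> L (free_eval f x) = free_eval (\<lambda>g. L (f g)) x"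
  by (simp add: free_eval_def clin_sum clin_scale)

text \<open>
  A map prescribed on generators by \<open>lin_lift\<close> is meaningful only if all linear relations among the generators are respected; the
  hypothesis on kernels is that condition in each of the uses below.
\<close>

lemma lin_lift_free_eval:
  assumes "\<And>x. free_eval e x = 0 \<Longrightarrow> free_eval f x = 0"
  shows "lin_lift e f (free_eval e x) = free_eval f x"
proof -
  define y where "y = (SOME y. free_eval e y = free_eval e x)"
  have "free_eval e y = free_eval e x" unfolding y_def by (rule someI[of _ x]) simp
  then have "free_eval e (y - x) = 0" by (simp add: clin_diff[OF clin_free_eval])
  then have "free_eval f (y - x) = 0" by (rule assms)
  then show ?thesis by (simp add: lin_lift_def clin_diff[OF clin_free_eval] y_def)
qed

lemma lin_lift_gen:
  assumes "\<And>x. free_eval e x = 0 \<Longrightarrow> free_eval f x = 0"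
  shows "lin_lift e f (e g) = f g"
  using lin_lift_free_eval[where x = "Poly_Mapping.single g 1", OF assms] by (simp add: free_eval_single scaleC_one)

lemma clin_lin_lift:
  assumes ker: "\<And>x. free_eval e x = 0 \<Longrightarrow> free_eval f x = 0" and surj: "surj (free_eval e)"
  shows "clin (lin_lift e f)"
  unfolding clin_def
proof (intro conjI allI)
  fix x y c
  obtain x' y' where x: "x = free_eval e x'" and y: "y = free_eval e y'" using surj by (meson surjD)
  show "lin_lift e f (x + y) = lin_lift e f x + lin_lift e f y"
    using lin_lift_free_eval[where x = "x' + y'", OF ker]
    by (simp add: x y clin_add[OF clin_free_eval] lin_lift_free_eval[OF ker])
  show "lin_lift e f (c *\<^sub>C x) = c *\<^sub>C lin_lift e f x"
    using lin_lift_free_eval[where x = "c *\<^sub>C x'", OF ker]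
    by (simp add: x clin_scale[OF clin_free_eval] lin_lift_free_eval[OF ker])
qed

lemma clin_eq_on_gen:
  assumes "clin f" "clin g" "surj (free_eval e)" "\<And>i. f (e i) = g (e i)"
  shows "f x = g x"
proof -
  obtain x' where "x = free_eval e x'" using assms(3) by (meson surjD)
  then show ?thesis by (simp add: clin_free_eval_comp assms)
qed

definition balanced where
  "balanced ra la f \<longleftrightarrow> (\<forall>y. clin (\<lambda>x. f x y)) \<and> (\<forall>x. clin (f x)) \<and> (\<forall>x b y. f (ra x b) y = f x (la b y))"

lemma balancedD:
  assumes "balanced ra la f"
  shows "clin (\<lambda>x. f x y)" "clin (f x)" "f (ra x b) y = f x (la b y)"
  using assms by (auto simp: balanced_def)

lemma tensor_product_balanced:
  assumes tp: "is_tensor_product ra la tn" shows "balanced ra la tn"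
proof -
  have ker: "free_eval (case_prod tn) x = 0" if "x \<in> balanced_relators ra la" for x
    using tp that complex_vector.span_base[of x] by (auto simp: is_tensor_product_def)
  note fe = clin_diff[OF clin_free_eval] clin_add[OF clin_free_eval] free_eval_single scaleC_one
  have 1: "tn (x + y) z = tn x z + tn y z" for x y z
  proof -
    have "Poly_Mapping.single (x + y, z) 1 - Poly_Mapping.single (x, z) 1 - Poly_Mapping.single (y, z) 1 \<in> balanced_relators ra la"
      unfolding balanced_relators_def by blast
    from ker[OF this] show ?thesis by (simp add: fe algebra_simps)
  qed
  have 2: "tn x (y + z) = tn x y + tn x z" for x y z
  proof -
    have "Poly_Mapping.single (x, y + z) 1 - Poly_Mapping.single (x, y) 1 - Poly_Mapping.single (x, z) 1 \<in> balanced_relators ra la"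
      unfolding balanced_relators_def by blast
    from ker[OF this] show ?thesis by (simp add: fe algebra_simps)
  qed
  have 3: "tn (c *\<^sub>C x) y = c *\<^sub>C tn x y" for c x y
  proof -
    have "Poly_Mapping.single (c *\<^sub>C x, y) 1 - Poly_Mapping.single (x, y) c \<in> balanced_relators ra la"
      unfolding balanced_relators_def by blast
    from ker[OF this] show ?thesis by (simp add: fe)
  qed
  have 4: "tn x (c *\<^sub>C y) = c *\<^sub>C tn x y" for c x y
  proof -
    have "Poly_Mapping.single (x, c *\<^sub>C y) 1 - Poly_Mapping.single (x, y) c \<in> balanced_relators ra la"
      unfolding balanced_relators_def by blast
    from ker[OF this] show ?thesis by (simp add: fe)
  qed
  have 5: "tn (ra x b) y = tn x (la b y)" for x b y
  proof -
    have "Poly_Mapping.single (ra x b, y) 1 - Poly_Mapping.single (x, la b y) 1 \<in> balanced_relators ra la"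
      unfolding balanced_relators_def by blast
    from ker[OF this] show ?thesis by (simp add: fe)
  qed
  show ?thesis unfolding balanced_def clin_def using 1 2 3 4 5 by blast
qed

text \<open>
  The universal property of the balanced tensor product: its relations are spanned by the balancing relations, and these
  hold for any balanced bilinear map.
\<close>

lemma tensor_product_kernel:
  assumes tp: "is_tensor_product ra la tn" and f: "balanced ra la f" and x: "free_eval (case_prod tn) x = 0"
  shows "free_eval (case_prod f) x = 0"
proof -
  have "x \<in> complex_vector.span (balanced_relators ra la)" using tp x by (auto simp: is_tensor_product_def)
  moreover have "complex_vector.subspace {x. free_eval (case_prod f) x = 0}"
    unfolding complex_vector.subspace_def
    by (simp add: clin_0[OF clin_free_eval] clin_add[OF clin_free_eval] clin_scale[OF clin_free_eval])
  moreover have "balanced_relators ra la \<subseteq> {x. free_eval (case_prod f) x = 0}"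
    using f unfolding balanced_relators_def balanced_def clin_def
    by (auto simp: clin_diff[OF clin_free_eval] free_eval_single scaleC_one)
  ultimately have "x \<in> {x. free_eval (case_prod f) x = 0}"
    using complex_vector.span_minimal by blast
  then show ?thesis by simp
qed

lemma tensor_lift:
  assumes tp: "is_tensor_product ra la tn" and f: "balanced ra la f"
  shows "clin (lin_lift (case_prod tn) (case_prod f))" "lin_lift (case_prod tn) (case_prod f) (tn x y) = f x y"
proof -
  note ker = tensor_product_kernel[OF tp f]
  show "clin (lin_lift (case_prod tn) (case_prod f))"
    using tp by (intro clin_lin_lift ker) (auto simp: is_tensor_product_def)
  show "lin_lift (case_prod tn) (case_prod f) (tn x y) = f x y"
    using lin_lift_gen[of "case_prod tn" "case_prod f" "(x, y)", OF ker] by simp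
qed

lemma tensor_eq:
  assumes tp: "is_tensor_product ra la tn" and "clin f" "clin g" "\<And>x y. f (tn x y) = g (tn x y)"
  shows "f z = g z"
proof (rule clin_eq_on_gen[of f g "case_prod tn"])
  show "surj (free_eval (case_prod tn))" using tp by (simp add: is_tensor_product_def)
  show "f (case_prod tn i) = g (case_prod tn i)" for i by (cases i) (simp add: assms(4))
qed fact+

text \<open>
  The part of the data that makes the universal second-order calculus work.  The last assumption, that one-forms are combinations of
  \<open>a db\<close>, is what makes \<open>d\<close> total on one-forms.
\<close>

locale calc =
  fixes C :: "('n, 'b::complex_algebra_1, 'o::complex_vector, 't::complex_vector, 'w::complex_vector, 'u::complex_vector) calculus"
  assumes bim: "bimodule (lmul C) (rmul C)"
    and der: "derivation (lmul C) (rmul C) (del C)" "derivation (lmul C) (rmul C) (delbar C)"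
    and tp: "is_tensor_product (rmul C) (lmul C) (tens C)"
    and wlin: "clin (wedge_map C)" and wsurj: "surj (wedge_map C)"
    and wker: "{t. wedge_map C t = 0} = universal_kernel C"
    and wtp: "is_tensor_product (wrmul C) (lmul C) (wtens C)"
    and exact: "surj (free_eval (\<lambda>(a, b). lmul C a (dif C b)))"
begin

abbreviation "la \<equiv> lmul C"
abbreviation "ra \<equiv> rmul C"
abbreviation "tn \<equiv> tens C"
abbreviation "wd \<equiv> wedge C"

lemma lmul_clin: "clin (la b)" "clin (\<lambda>b. la b x)" and rmul_clin: "clin (\<lambda>x. ra x b)" "clin (ra x)"
  and lmul_1: "la 1 x = x" and rmul_1: "ra x 1 = x"
  and lmul_mult: "la (a * b) x = la a (la b x)" and rmul_mult: "ra x (a * b) = ra (ra x a) b"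
  and bimod: "ra (la a x) b = la a (ra x b)"
  using bim unfolding bimodule_def linear_clin by auto

lemma dif_mult: "dif C (a * b) = ra (dif C a) b + la a (dif C b)"
  using der unfolding derivation_def dif_def by (simp add: clin_add[OF lmul_clin(1)] clin_add[OF rmul_clin(1)])
lemma dif_1: "dif C 1 = 0"
  using dif_mult[of 1 1] by (simp add: lmul_1 rmul_1)

lemmas tn_bal = tensor_product_balanced[OF tp]
lemmas tn_clin = balancedD(1,2)[OF tn_bal] and tn_mid = balancedD(3)[OF tn_bal]

lemma tlmul_bal: "balanced ra la (\<lambda>x y. tn (la b x) y)"
  unfolding balanced_def by (auto simp: bimod[symmetric] tn_mid intro: tn_clin clin_compose[OF tn_clin(1) lmul_clin(1)])
lemma trmul_bal: "balanced ra la (\<lambda>x y. tn x (ra y b))"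
  unfolding balanced_def by (auto simp: bimod tn_mid intro: tn_clin clin_compose[OF tn_clin(2) rmul_clin(1)])
lemma tlmul_clin: "clin (tlmul C b)" and tlmul_tn: "tlmul C b (tn x y) = tn (la b x) y"
  using tensor_lift[OF tp tlmul_bal[of b]] unfolding tlmul_def by auto
lemma trmul_clin: "clin (\<lambda>t. trmul C t b)" and trmul_tn: "trmul C (tn x y) b = tn x (ra y b)"
  using tensor_lift[OF tp trmul_bal[of b]] unfolding trmul_def by auto

lemma wd_bal: "balanced ra la wd"
  unfolding balanced_def wedge_def by (auto simp: tn_mid intro: clin_compose[OF wlin] tn_clin)
lemmas wd_clin = balancedD(1,2)[OF wd_bal] and wd_mid = balancedD(3)[OF wd_bal]

lemma ker_tlmul: "wedge_map C t = 0 \<Longrightarrow> wedge_map C (tlmul C b t) = 0"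
  and ker_trmul: "wedge_map C t = 0 \<Longrightarrow> wedge_map C (trmul C t b) = 0"
  and ker_rel: "t \<in> universal_relators C \<Longrightarrow> wedge_map C t = 0"
proof -
  have k: "wedge_map C t = 0 \<longleftrightarrow> t \<in> universal_kernel C" for t using wker by blast
  show "wedge_map C t = 0 \<Longrightarrow> wedge_map C (tlmul C b t) = 0" "wedge_map C t = 0 \<Longrightarrow> wedge_map C (trmul C t b) = 0"
    "t \<in> universal_relators C \<Longrightarrow> wedge_map C t = 0"
    unfolding k universal_kernel_def by blast+
qed

lemma wd_surj: "surj (free_eval (case_prod wd))"
proof (rule surjI)
  fix z
  obtain t where t: "z = wedge_map C t" using wsurj by (meson surjD)
  obtain x where "t = free_eval (case_prod tn) x" using tp by (meson is_tensor_product_def surjD)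
  then have "z = free_eval (case_prod wd) x"
    unfolding t by (simp add: clin_free_eval_comp[OF wlin] wedge_def case_prod_unfold)
  then show "free_eval (case_prod wd) (SOME x. z = free_eval (case_prod wd) x) = z"
    by (metis (mono_tags, lifting) someI)
qed

text \<open>
  The kernel of \<open>\<wedge>\<close> is a sub-bimodule, so left and right multiplication pass to two-forms.
\<close>

lemma wd_lift:
  assumes L: "clin L" and ker: "\<And>t. wedge_map C t = 0 \<Longrightarrow> wedge_map C (L t) = 0"
  shows "clin (lin_lift (case_prod wd) (\<lambda>(x, y). wedge_map C (L (tn x y))))"
    "lin_lift (case_prod wd) (\<lambda>(x, y). wedge_map C (L (tn x y))) (wd x y) = wedge_map C (L (tn x y))"
proof -
  have k: "free_eval (\<lambda>(x, y). wedge_map C (L (tn x y))) z = 0" if "free_eval (case_prod wd) z = 0" for z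
  proof -
    have "wedge_map C (free_eval (case_prod tn) z) = 0"
      using that by (simp add: clin_free_eval_comp[OF wlin] wedge_def case_prod_unfold)
    then have "wedge_map C (L (free_eval (case_prod tn) z)) = 0" by (rule ker)
    then show ?thesis
      by (simp add: clin_free_eval_comp[OF L] clin_free_eval_comp[OF wlin] case_prod_unfold)
  qed
  show "clin (lin_lift (case_prod wd) (\<lambda>(x, y). wedge_map C (L (tn x y))))"
    by (rule clin_lin_lift[OF k wd_surj])
  show "lin_lift (case_prod wd) (\<lambda>(x, y). wedge_map C (L (tn x y))) (wd x y) = wedge_map C (L (tn x y))"
    using lin_lift_gen[of "case_prod wd" "\<lambda>(x, y). wedge_map C (L (tn x y))" "(x, y)", OF k] by simp
qed

lemma wrmul_clin: "clin (\<lambda>z. wrmul C z b)" and wrmul_wd: "wrmul C (wd x y) b = wd x (ra y b)"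
  using wd_lift[OF trmul_clin[of b] ker_trmul] by (simp_all add: wrmul_def trmul_tn wedge_def[symmetric])

text \<open>
  Left multiplication on two-forms, and then on their tensor product with one-forms, is what the Leibniz rules of \<open>d\<close> and of the Riemann tensor are stated with.
\<close>

definition wlmul :: "'b \<Rightarrow> 'w \<Rightarrow> 'w" where
  "wlmul b = lin_lift (case_prod wd) (\<lambda>(x, y). wedge_map C (tlmul C b (tn x y)))"
lemma wlmul_clin: "clin (wlmul b)" and wlmul_wd: "wlmul b (wd x y) = wd (la b x) y"
  using wd_lift[OF tlmul_clin[of b] ker_tlmul] by (simp_all add: wlmul_def tlmul_tn wedge_def[symmetric])

lemma wl_wr: "wrmul C (wlmul b z) c = wlmul b (wrmul C z c)"
  by (rule clin_eq_on_gen[OF _ _ wd_surj])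
    (auto intro: clin_compose[OF wrmul_clin wlmul_clin] clin_compose[OF wlmul_clin wrmul_clin] simp: wlmul_wd wrmul_wd)

lemmas wt_bal = tensor_product_balanced[OF wtp]
lemmas wt_clin = balancedD(1,2)[OF wt_bal] and wt_mid = balancedD(3)[OF wt_bal]

definition ulmul :: "'b \<Rightarrow> 'u \<Rightarrow> 'u" where
  "ulmul b = lin_lift (case_prod (wtens C)) (case_prod (\<lambda>z y. wtens C (wlmul b z) y))"
lemma ulmul_clin: "clin (ulmul b)" and ulmul_wt: "ulmul b (wtens C z y) = wtens C (wlmul b z) y"
proof -
  have "balanced (wrmul C) la (\<lambda>z y. wtens C (wlmul b z) y)"
    unfolding balanced_def by (auto simp: wl_wr wt_mid[symmetric] intro: wt_clin clin_compose[OF wt_clin(1) wlmul_clin])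
  from tensor_lift[OF wtp this] show "clin (ulmul b)" "ulmul b (wtens C z y) = wtens C (wlmul b z) y"
    unfolding ulmul_def by auto
qed

text \<open>
  The relators of the universal calculus are exactly the obstructions to \<open>a db \<mapsto> da \<wedge> db\<close> being well defined.
\<close>

lemma dform_clin: "clin (dform C)" and dform_gen: "dform C (la a (dif C b)) = wd (dif C a) (dif C b)"
proof -
  have k: "free_eval (\<lambda>(a, b). wd (dif C a) (dif C b)) x = 0" if "free_eval (\<lambda>(a, b). la a (dif C b)) x = 0" for x
  proof -
    have "free_eval (\<lambda>(a, b). tn (dif C a) (dif C b)) x \<in> universal_relators C"
      unfolding universal_relators_def using that by blast
    then have "wedge_map C (free_eval (\<lambda>(a, b). tn (dif C a) (dif C b)) x) = 0" by (rule ker_rel)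
    then show ?thesis by (simp add: clin_free_eval_comp[OF wlin] wedge_def case_prod_unfold)
  qed
  show "clin (dform C)" unfolding dform_def by (rule clin_lin_lift[OF k exact])
  show "dform C (la a (dif C b)) = wd (dif C a) (dif C b)"
    unfolding dform_def using lin_lift_gen[of "\<lambda>(a, b). la a (dif C b)" "\<lambda>(a, b). wd (dif C a) (dif C b)" "(a, b)", OF k] by simp
qed

lemma dform_dif: "dform C (dif C b) = 0"
  using dform_gen[of 1 b] by (simp add: lmul_1 dif_1 clin_0[OF wd_clin(1)])

lemma dform_lmul: "dform C (la a x) = wd (dif C a) x + wlmul a (dform C x)"
proof (rule clin_eq_on_gen[OF _ _ exact, of "\<lambda>x. dform C (la a x)" "\<lambda>x. wd (dif C a) x + wlmul a (dform C x)"])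
  show "clin (\<lambda>x. dform C (la a x))" by (rule clin_compose[OF dform_clin lmul_clin(1)])
  show "clin (\<lambda>x. wd (dif C a) x + wlmul a (dform C x))"
    by (rule clin_plus[OF wd_clin(2) clin_compose[OF wlmul_clin dform_clin]])
  fix i show "dform C (la a (case i of (a, b) \<Rightarrow> la a (dif C b))) =
      wd (dif C a) (case i of (a, b) \<Rightarrow> la a (dif C b)) + wlmul a (dform C (case i of (a, b) \<Rightarrow> la a (dif C b)))"
    by (cases i) (simp add: lmul_mult[symmetric] dform_gen dif_mult clin_add[OF wd_clin(1)] wd_mid wlmul_wd)
qed

text \<open>
  On \<open>x = a dc\<close> one has \<open>x b = a d(c b) - (a c) db\<close>, to which the definition of \<open>d\<close> applies.
\<close>

lemma dform_rmul: "dform C (ra x b) = wrmul C (dform C x) b - wd x (dif C b)"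
proof (rule clin_eq_on_gen[OF _ _ exact, of "\<lambda>x. dform C (ra x b)" "\<lambda>x. wrmul C (dform C x) b - wd x (dif C b)"])
  show "clin (\<lambda>x. dform C (ra x b))" by (rule clin_compose[OF dform_clin rmul_clin(1)])
  show "clin (\<lambda>x. wrmul C (dform C x) b - wd x (dif C b))"
    by (rule clin_sub[OF clin_compose[OF wrmul_clin dform_clin] wd_clin(1)])
  fix i :: "'b \<times> 'b"
  obtain a c where i: "i = (a, c)" by (cases i)
  have "ra (la a (dif C c)) b = la a (dif C (c * b)) - la (a * c) (dif C b)"
    by (simp add: bimod dif_mult clin_add[OF lmul_clin(1)] lmul_mult)
  then have "dform C (ra (la a (dif C c)) b) = wd (dif C a) (dif C (c * b)) - wd (dif C (a * c)) (dif C b)"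
    by (simp add: clin_diff[OF dform_clin] dform_gen)
  also have "\<dots> = wrmul C (wd (dif C a) (dif C c)) b - wd (la a (dif C c)) (dif C b)"
    by (simp add: dif_mult clin_add[OF wd_clin(1)] clin_add[OF wd_clin(2)] wrmul_wd wd_mid)
  finally show "dform C (ra (case i of (a, b) \<Rightarrow> la a (dif C b)) b) =
      wrmul C (dform C (case i of (a, b) \<Rightarrow> la a (dif C b))) b - wd (case i of (a, b) \<Rightarrow> la a (dif C b)) (dif C b)"
    by (simp add: i dform_gen)
qed

lemma wid_bal: "balanced ra la (\<lambda>y z. wtens C (wd x y) z)"
  unfolding balanced_def by (auto simp: wrmul_wd[symmetric] wt_mid intro: wt_clin clin_compose[OF wt_clin(1) wd_clin(2)])
lemma wid_clin: "clin (wedge_id C x)" and wid_tn: "wedge_id C x (tn y z) = wtens C (wd x y) z"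
  using tensor_lift[OF tp wid_bal[of x]] unfolding wedge_id_def by auto
lemma wid_clin_left: "clin (\<lambda>x. wedge_id C x t)"
proof -
  have "wedge_id C (x + x') t = wedge_id C x t + wedge_id C x' t" for x x'
    by (rule tensor_eq[OF tp]) (auto intro: wid_clin clin_plus simp: wid_tn clin_add[OF wd_clin(1)] clin_add[OF wt_clin(1)])
  moreover have "wedge_id C (c *\<^sub>C x) t = c *\<^sub>C wedge_id C x t" for x c
    by (rule tensor_eq[OF tp]) (auto intro: wid_clin clin_compose[OF clin_scaleC] simp: wid_tn clin_scale[OF wd_clin(1)] clin_scale[OF wt_clin(1)])
  ultimately show ?thesis by (simp add: clin_def)
qed
lemma wid_mid: "wedge_id C (ra x b) t = wedge_id C x (tlmul C b t)"
  by (rule tensor_eq[OF tp]) (auto intro: wid_clin clin_compose[OF wid_clin tlmul_clin] simp: wid_tn tlmul_tn wd_mid)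
lemma wid_lmul: "wedge_id C (la b x) t = ulmul b (wedge_id C x t)"
  by (rule tensor_eq[OF tp]) (auto intro: wid_clin clin_compose[OF ulmul_clin wid_clin] simp: wid_tn ulmul_wt wlmul_wd)

text \<open>
  The Riemann tensor is \<open>nab\<close> followed by \<open>rlift\<close>.  Treating the second map by itself pays off because the
  first one has an explicit value in the tensor product, to which \<open>rlift\<close> is applied by linearity.
\<close>

definition rinner where "rinner nab y z = wtens C (dform C y) z - wedge_id C y (nab z)"
definition rlift where "rlift nab = lin_lift (case_prod tn) (case_prod (rinner nab))"

lemma riemann_eq: "riemann C nab x = rlift nab (nab x)"
  unfolding riemann_def rlift_def rinner_def ..

context
  fixes nab :: "'o \<Rightarrow> 't"
  assumes nlin: "clin nab" and nleib: "\<And>b x. nab (la b x) = tn (dif C b) x + tlmul C b (nab x)"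
begin

text \<open>
  The signs in the right Leibniz rule of \<open>d\<close> and in the left Leibniz rule of \<open>nab\<close> cancel.
\<close>

lemma rinner_bal: "balanced ra la (rinner nab)"
  unfolding balanced_def
proof (intro conjI allI)
  fix x y b
  show "clin (\<lambda>x. rinner nab x y)" unfolding rinner_def
    by (intro clin_sub clin_compose[OF wt_clin(1) dform_clin] wid_clin_left)
  show "clin (rinner nab x)" unfolding rinner_def
    by (intro clin_sub wt_clin(2) clin_compose[OF wid_clin nlin])
  show "rinner nab (ra x b) y = rinner nab x (la b y)"
    by (simp add: rinner_def dform_rmul nleib clin_diff[OF wt_clin(1)] wt_mid clin_add[OF wid_clin] wid_tn wid_mid)
qed

lemma rlift_clin: "clin (rlift nab)" and rlift_tn: "rlift nab (tn y z) = rinner nab y z"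
  unfolding rlift_def using tensor_lift[OF tp rinner_bal] by auto

text \<open>
  Reduces the term \<open>p G\<close> of the connection to \<open>dp \<wedge> G\<close> and the value at \<open>G\<close>.
\<close>

lemma rlift_tlmul: "rlift nab (tlmul C b t) = wedge_id C (dif C b) t + ulmul b (rlift nab t)"
  by (rule tensor_eq[OF tp])
    (auto intro!: clin_compose[OF rlift_clin tlmul_clin] clin_plus wid_clin clin_compose[OF ulmul_clin rlift_clin]
      simp: tlmul_tn rlift_tn rinner_def dform_lmul clin_add[OF wt_clin(1)] wid_tn wid_lmul ulmul_wt clin_diff[OF ulmul_clin])

end

end

section \<open>The calculus of quantum projective space\<close>

text \<open>
  Drops the first two legs, which belong to the first family of a word.
\<close>

definition sh :: "(nat \<Rightarrow> 'n) \<Rightarrow> nat \<Rightarrow> 'n" where "sh f = (\<lambda>j. f (Suc (Suc j)))"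

text \<open>
  One family and a word of two families as tensors with legs starting at 1.  Longer words are formed by nesting.
\<close>

definition W1 where "W1 u f = u (f (Suc 0)) (f (Suc (Suc 0)))"
definition W2 where "W2 t u v f = t (W1 u f) (W1 v (sh f))"

lemma sh_upd: "sh (f(Suc (Suc k) := a)) = (sh f)(k := a)"
  by (auto simp: sh_def fun_eq_iff)
lemma sh_plug: "sh (plug (Suc (Suc k)) a f) = plug k a (sh f)"
  by (auto simp: sh_def plug_def fun_eq_iff numeral_2_eq_2 Suc_diff_Suc)

lemma opL_sh: "opL (Suc (Suc k)) A (\<lambda>f. F (sh f)) = (\<lambda>f. opL k A F (sh f))"
  by (rule ext) (simp add: opL_def sh_upd, simp add: sh_def)
lemma ctr_sh: "ctr (Suc (Suc k)) w (\<lambda>f. F (sh f)) = (\<lambda>f. ctr k w F (sh f))"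
  by (rule ext) (simp add: ctr_def sh_plug)

text \<open>
  Operators and traces act on coefficients, so they commute with any linear map that depends only on
  untouched legs.  Instances below are constant maps, a further family on the right (from leg 5 on) and one
  on the left (on legs 1 and 2).
\<close>

lemma opL_apply:
  assumes "\<And>f. clin (\<Phi> f)" "\<And>f a b. \<Phi> (f(k := a, Suc k := b)) = \<Phi> f"
  shows "opL k A (\<lambda>f. \<Phi> f (F f)) = (\<lambda>f. \<Phi> f (opL k A F f))"
  by (rule ext) (simp add: opL_def assms(2) clin_sum[OF assms(1)] clin_scale[OF assms(1)])
lemma ctr_apply:
  assumes "\<And>f. clin (\<Psi> f)" "\<And>f a. \<Phi> (plug k a f) = \<Psi> f"
  shows "ctr k w (\<lambda>f. \<Phi> f (F f)) = (\<lambda>f. \<Psi> f (ctr k w F f))"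
  by (rule ext) (simp add: ctr_def assms(2) clin_sum[OF assms(1)] clin_scale[OF assms(1)])
lemma opL_const: "clin L \<Longrightarrow> opL k A (\<lambda>f. L (F f)) = (\<lambda>f. L (opL k A F f))"
  using opL_apply[of "\<lambda>_. L"] by blast
lemma ctr_const: "clin L \<Longrightarrow> ctr k w (\<lambda>f. L (F f)) = (\<lambda>f. L (ctr k w F f))"
  using ctr_apply[of "\<lambda>_. L" "\<lambda>_. L"] by blast

lemma opL_left:
  assumes "\<And>y. clin (\<lambda>x. t x y)" "k \<le> Suc (Suc (Suc 0))"
  shows "opL k A (\<lambda>f. t (F f) (W1 w (sh (sh f)))) = (\<lambda>f. t (opL k A F f) (W1 w (sh (sh f))))"
  by (rule opL_apply) (use assms in \<open>auto simp: sh_def W1_def\<close>)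
lemma ctr_left:
  assumes "\<And>y. clin (\<lambda>x. t x y)" "k \<le> Suc (Suc (Suc 0))"
  shows "ctr k c (\<lambda>f. t (F f) (W1 w (sh (sh f)))) = (\<lambda>f. t (ctr k c F f) (W1 w (sh f)))"
  by (rule ctr_apply) (use assms in \<open>auto simp: sh_def W1_def plug_def\<close>)
lemma opL_right:
  assumes "\<And>x. clin (t x)"
  shows "opL (Suc (Suc (Suc k))) A (\<lambda>f. t (W1 u f) (F (sh f))) = (\<lambda>f. t (W1 u f) (opL (Suc k) A F (sh f)))"
  by (subst opL_apply[where \<Phi> = "\<lambda>f. t (W1 u f)"]) (use assms in \<open>auto simp: W1_def opL_sh\<close>)
lemma ctr_right:
  assumes "\<And>x. clin (t x)"
  shows "ctr (Suc (Suc (Suc k))) c (\<lambda>f. t (W1 u f) (F (sh f))) = (\<lambda>f. t (W1 u f) (ctr (Suc k) c F (sh f)))"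
  by (subst ctr_apply[where \<Phi> = "\<lambda>f. t (W1 u f)" and \<Psi> = "\<lambda>f. t (W1 u f)"]) (use assms in \<open>auto simp: W1_def plug_def ctr_sh\<close>)

context braided_legs
begin

abbreviation "mul1 \<equiv> mulL (Suc 0)"
abbreviation "mul3 \<equiv> mulL (Suc (Suc (Suc 0)))"
abbreviation "omul1 \<equiv> omulL (Suc 0)"
abbreviation "omul3 \<equiv> omulL (Suc (Suc (Suc 0)))"
abbreviation "T1 \<equiv> TL (Suc 0)"
abbreviation "T3 \<equiv> TL (Suc (Suc (Suc 0)))"
abbreviation "tr1 \<equiv> ctr (Suc 0) e"
abbreviation "tr3 \<equiv> ctr (Suc (Suc (Suc 0))) e"
abbreviation "tr5 \<equiv> ctr (Suc (Suc (Suc (Suc (Suc 0))))) e"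

lemma left_ops:
  assumes t: "\<And>y. clin (\<lambda>x. g x y)"
  shows "mul1 (\<lambda>f. g (F f) (W1 w (sh (sh f)))) = (\<lambda>f. g (mul1 F f) (W1 w (sh f)))"
    "omul1 (\<lambda>f. g (F f) (W1 w (sh (sh f)))) = (\<lambda>f. g (omul1 F f) (W1 w (sh f)))"
    "T1 (\<lambda>f. g (F f) (W1 w (sh (sh f)))) = (\<lambda>f. g (T1 F f) (W1 w (sh (sh f))))"
    "TiL (Suc 0) (\<lambda>f. g (F f) (W1 w (sh (sh f)))) = (\<lambda>f. g (TiL (Suc 0) F f) (W1 w (sh (sh f))))"
    "tr1 (\<lambda>f. g (F f) (W1 w (sh (sh f)))) = (\<lambda>f. g (tr1 F f) (W1 w (sh f)))"
  by (simp_all add: mulL_def omulL_def TL_def TiL_def opL_left[where t = g, OF t] ctr_left[where t = g, OF t])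

lemma right_ops:
  assumes t: "\<And>x. clin (g x)"
  shows "mul3 (\<lambda>f. g (W1 u f) (F (sh f))) = (\<lambda>f. g (W1 u f) (mul1 F (sh f)))"
    "omul3 (\<lambda>f. g (W1 u f) (F (sh f))) = (\<lambda>f. g (W1 u f) (omul1 F (sh f)))"
    "T3 (\<lambda>f. g (W1 u f) (F (sh f))) = (\<lambda>f. g (W1 u f) (T1 F (sh f)))"
    "tr3 (\<lambda>f. g (W1 u f) (F (sh f))) = (\<lambda>f. g (W1 u f) (tr1 F (sh f)))"
  by (simp_all add: mulL_def omulL_def TL_def opL_right[where t = g, OF t] ctr_right[where t = g, OF t])

lemma const_ops:
  assumes L: "clin L"
  shows "mulL k (\<lambda>f. L (F f)) = (\<lambda>f. L (mulL k F f))"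
    "omulL k (\<lambda>f. L (F f)) = (\<lambda>f. L (omulL k F f))"
    "TL k (\<lambda>f. L (F f)) = (\<lambda>f. L (TL k F f))"
    "TiL k (\<lambda>f. L (F f)) = (\<lambda>f. L (TiL k F f))"
    "ctr k w (\<lambda>f. L (F f)) = (\<lambda>f. L (ctr k w F f))"
  by (simp_all add: mulL_def omulL_def TL_def TiL_def opL_const[OF L] ctr_const[OF L])

lemma zero_ops:
  "mulL k (\<lambda>f. 0) = (\<lambda>f. 0)" "omulL k (\<lambda>f. 0) = (\<lambda>f. 0)" "TL k (\<lambda>f. 0) = (\<lambda>f. 0)" "ctr k w (\<lambda>f. 0) = (\<lambda>f. 0)"
  by (simp_all add: mulL_def omulL_def TL_def opL_def[abs_def] ctr_def[abs_def])

lemma add_ops: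
  "mulL k (\<lambda>f. F f + G f) = (\<lambda>f. mulL k F f + mulL k G f)"
  "TL k (\<lambda>f. F f + G f) = (\<lambda>f. TL k F f + TL k G f)"
  "ctr k w (\<lambda>f. F f + G f) = (\<lambda>f. ctr k w F f + ctr k w G f)"
  by (simp_all add: mulL_def TL_def opL_def[abs_def] ctr_def[abs_def] scaleC_add_right sum.distrib fun_eq_iff)

end

text \<open>
  The relations of the calculus in flattened form: \<open>sym_x\<close> and \<open>sym_y\<close> are the relations of \<open>\<partial>p\<close> and
  \<open>\<partial>'p\<close> after composition with \<open>K\<close> and removal of scalars, and the traces use the normalised weight \<open>e\<close>.
\<close>

locale qproj = braided_legs R Ri Rs Rsi K M e t
  for R Ri Rs Rsi K M :: "complex ^ ('n::finite \<times> 'n) ^ ('n \<times> 'n)" and e :: "'n \<Rightarrow> complex" and t :: complex +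
  fixes C :: "('n, 'b::complex_algebra_1, 'o::complex_vector, 't::complex_vector, 'w::complex_vector, 'u::complex_vector) calculus"
  assumes bim: "bimodule (lmul C) (rmul C)"
    and der: "derivation (lmul C) (rmul C) (del C)" "derivation (lmul C) (rmul C) (delbar C)"
    and tp: "is_tensor_product (rmul C) (lmul C) (tens C)"
    and wlin: "clin (wedge_map C)" and wsurj: "surj (wedge_map C)"
    and wker: "{t. wedge_map C t = 0} = universal_kernel C"
    and wtp: "is_tensor_product (wrmul C) (lmul C) (wtens C)"
    and generated: "\<And>P z. (\<And>u v. P u \<Longrightarrow> P v \<Longrightarrow> P (u + v)) \<Longrightarrow> P 0 \<Longrightarrow> (\<And>b u. P u \<Longrightarrow> P (lmul C b u)) \<Longrightarrow>
       (\<And>i j. P (dp C i j)) \<Longrightarrow> (\<And>i j. P (dbp C i j)) \<Longrightarrow> P z"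
    and sym_x: "opL (Suc (Suc (Suc 0))) Rs (opL (Suc (Suc 0)) K (W2 (lmul C) (pgen C) (dp C))) = opL (Suc (Suc 0)) K (W2 (lmul C) (pgen C) (dp C))"
    and sym_y: "opL (Suc 0) R (opL (Suc (Suc 0)) K (W2 (lmul C) (pgen C) (dbp C))) = opL (Suc (Suc 0)) K (W2 (lmul C) (pgen C) (dbp C))"
    and tr_p: "ctr (Suc 0) e (W1 (pgen C)) = (\<lambda>f. 1)"
    and tr_x: "ctr (Suc 0) e (W1 (dp C)) = (\<lambda>f. 0)"
    and tr_y: "ctr (Suc 0) e (W1 (dbp C)) = (\<lambda>f. 0)"
    and xp: "W2 (rmul C) (dp C) (pgen C) = (\<lambda>f. t *\<^sub>C TL (Suc 0) (W2 (lmul C) (pgen C) (dp C)) f)"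
    and yp: "W2 (rmul C) (dbp C) (pgen C) = (\<lambda>f. (1 / t) *\<^sub>C TL (Suc 0) (W2 (lmul C) (pgen C) (dbp C)) f)"
begin

abbreviation "p \<equiv> pgen C"
abbreviation "x \<equiv> dp C"
abbreviation "y \<equiv> dbp C"

lemma lmul_clin': "clin (lmul C b)" "clin (\<lambda>b. lmul C b z)" and rmul_clin': "clin (\<lambda>z. rmul C z b)" "clin (rmul C z)"
  and lmul_1': "lmul C 1 z = z" and rmul_1': "rmul C z 1 = z"
  and lmul_mult': "lmul C (a * b) z = lmul C a (lmul C b z)"
  using bim unfolding bimodule_def linear_clin by auto
lemma dif_clin': "clin (dif C)"
  using der unfolding derivation_def linear_clin dif_def by (auto intro: clin_plus)
lemma dif_mult': "dif C (a * b) = rmul C (dif C a) b + lmul C a (dif C b)"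
  using der unfolding derivation_def dif_def by (simp add: clin_add[OF lmul_clin'(1)] clin_add[OF rmul_clin'(1)])
lemma dif_p: "dif C (p i j) = x i j + y i j" by (simp add: dif_def dp_def dbp_def)

lemma tr1_W2: "(\<And>b. clin (\<lambda>a. g a b)) \<Longrightarrow> tr1 (W2 g u v) = (\<lambda>f. g (tr1 (W1 u) f) (W1 v f))"
  unfolding W2_def
  by (subst ctr_apply[where \<Phi> = "\<lambda>f a. g a (W1 v (sh f))" and \<Psi> = "\<lambda>f a. g a (W1 v f)"]) (auto simp: W1_def sh_def plug_def)
lemma tr3_W2: "(\<And>a. clin (g a)) \<Longrightarrow> tr3 (W2 g u v) = (\<lambda>f. g (W1 u f) (tr1 (W1 v) (sh f)))"
  unfolding W2_def by (rule right_ops)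

lemma tr_px: "tr1 (W2 (lmul C) p x) = W1 x" "tr3 (W2 (lmul C) p x) = (\<lambda>f. 0)"
  and tr_py: "tr1 (W2 (lmul C) p y) = W1 y" "tr3 (W2 (lmul C) p y) = (\<lambda>f. 0)"
  and tr_yp: "tr3 (W2 (rmul C) y p) = W1 y"
  by (simp_all add: tr1_W2[OF lmul_clin'(2)] tr3_W2[OF lmul_clin'(1)] tr3_W2[OF rmul_clin'(2)] tr_p tr_x tr_y lmul_1' rmul_1'
      clin_0[OF lmul_clin'(1)])

lemma sym_x': "opL (Suc (Suc (Suc 0))) Rsi (opL (Suc (Suc 0)) K (W2 (lmul C) p x)) = opL (Suc (Suc 0)) K (W2 (lmul C) p x)"
  by (subst sym_x[symmetric]) simp
lemma sym_y': "opL (Suc 0) Ri (opL (Suc (Suc 0)) K (W2 (lmul C) p y)) = opL (Suc (Suc 0)) K (W2 (lmul C) p y)"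
  by (subst sym_y[symmetric]) simp

text \<open>
  The symmetry of the flattened word removes one Hecke operator, so a product coincides with one of the two partial traces,
  and these are known.  For words with \<open>p\<close> on the right, the right module structure first reduces to \<open>p\<close> on the left.
\<close>

lemma mul_px: "mul1 (W2 (lmul C) p x) = (\<lambda>f. 0)"
  using tr2_flat[of "Suc 0" "W2 (lmul C) p x"] by (simp add: mulL_flat sym_x' tr_px)
lemma omul_px: "omul1 (W2 (lmul C) p x) = W1 x"
  using tr1_flat[of "Suc 0" "W2 (lmul C) p x"] by (simp add: omulL_def sym_x' tr_px)
lemma mul_xp: "mul1 (W2 (rmul C) x p) = W1 x"
  unfolding xp const_ops(1)[OF clin_scaleC] mulL_TL omul_px tr_px by (simp add: scaleC_scaleC t_nz scaleC_one)
lemma mul_py: "mul1 (W2 (lmul C) p y) = W1 y"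
  using tr1_flat[of "Suc 0" "W2 (lmul C) p y"] by (simp add: mulL_flat sym_y' tr_py)
lemma omul_py: "omul1 (W2 (lmul C) p y) = (\<lambda>f. 0)"
proof -
  have "omul1 (W2 (lmul C) p y) = ctr (Suc (Suc 0)) e (opL (Suc (Suc (Suc 0))) Rsi (opL (Suc 0) Ri (opL (Suc (Suc 0)) K (W2 (lmul C) p y))))"
    unfolding omulL_def by (subst opL_commute) simp_all
  also have "\<dots> = tr3 (W2 (lmul C) p y)" by (simp only: sym_y' tr2_flat[symmetric])
  finally show ?thesis by (simp add: tr_py)
qed
lemma mul_yp: "mul1 (W2 (rmul C) y p) = (\<lambda>f. 0)"
  unfolding yp const_ops(1)[OF clin_scaleC] mulL_TL omul_py tr_py by simp
lemma omul_yp: "omul1 (W2 (rmul C) y p) = W1 y"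
proof -
  let ?z = "W2 (lmul C) p y"
  have "omul1 (T1 ?z) = ctr (Suc (Suc 0)) e (opL (Suc 0) Ri (opL (Suc (Suc (Suc 0))) Rsi (opL (Suc 0) R
      (opL (Suc (Suc (Suc 0))) Rsi (opL (Suc (Suc 0)) K ?z)))))"
    by (simp add: omulL_def TL_def)
  also have "\<dots> = ctr (Suc (Suc 0)) e (opL (Suc (Suc (Suc 0))) Rsi (opL (Suc (Suc (Suc 0))) Rsi (opL (Suc (Suc 0)) K ?z)))"
    by (subst opL_commute[of "Suc 0" "Suc (Suc (Suc 0))" R, symmetric]) simp_all
  also have "\<dots> = (\<lambda>f. (1 - t) *\<^sub>C tr3 ?z f + t *\<^sub>C mul1 ?z f)"
    by (simp only: opL_Rsi_Rsi ctr_lincomb mulL_flat tr2_flat)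
  finally show ?thesis unfolding yp const_ops(2)[OF clin_scaleC] by (simp add: tr_py mul_py scaleC_scaleC t_nz scaleC_one)
qed

lemma mul_W2: "mul1 (W2 g u v) f = (\<Sum>a\<in>UNIV. g (u (f (Suc 0)) a) (v a (f (Suc (Suc 0)))))"
  by (simp add: mulL_def ctr_def W2_def W1_def sh_def plug_def scaleC_one)

text \<open>
  Multiplication by \<open>p\<close> from the right is a projection of \<open>dp\<close> onto its \<open>x\<close> part.
\<close>

lemma x_eq: "x i j = (\<Sum>a\<in>UNIV. rmul C (dif C (p i a)) (p a j))"
proof -
  let ?f = "\<lambda>k. if k = Suc 0 then i else j"
  have "x i j = mul1 (W2 (rmul C) x p) ?f + mul1 (W2 (rmul C) y p) ?f"
    by (simp add: mul_xp mul_yp W1_def)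
  also have "\<dots> = (\<Sum>a\<in>UNIV. rmul C (dif C (p i a)) (p a j))"
    by (simp add: mul_W2 dif_p clin_add[OF rmul_clin'(1)] sum.distrib)
  finally show ?thesis .
qed

text \<open>
  By \<open>x_eq\<close> and the Leibniz rule, \<open>x = d(p) p\<close> is a combination of \<open>d(p p)\<close> and \<open>p d(p)\<close>; then
  \<open>y = dp - x\<close> is one too.
\<close>

lemma exact': "surj (free_eval (\<lambda>(a, b). lmul C a (dif C b)))"
proof -
  let ?G = "free_eval (\<lambda>(a, b). lmul C a (dif C b))"
  let ?P = "\<lambda>z. z \<in> range ?G"
  have add: "?P (u + v)" if "?P u" "?P v" for u v
    using that by (auto simp: clin_add[OF clin_free_eval, symmetric])
  have sub: "?P (u - v)" if "?P u" "?P v" for u v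
    using that by (auto simp: clin_diff[OF clin_free_eval, symmetric])
  have zero: "?P 0" using clin_0[OF clin_free_eval, of "\<lambda>(a, b). lmul C a (dif C b)"] by (metis rangeI)
  have gen: "?P (lmul C a (dif C b))" for a b
    using free_eval_single[of "\<lambda>(a, b). lmul C a (dif C b)" "(a, b)" 1] by (metis (no_types, lifting) case_prod_conv rangeI scaleC_one)
  have lm: "?P (lmul C b u)" if u: "?P u" for b u
  proof -
    obtain z where "u = ?G z" using u by blast
    then have eq: "lmul C b u = (\<Sum>g\<in>Poly_Mapping.keys z. lmul C (b * fst g) (dif C (Poly_Mapping.lookup z g *\<^sub>C snd g)))"
      by (simp add: free_eval_def clin_sum[OF lmul_clin'(1)] clin_scale[OF lmul_clin'(1)] clin_scale[OF dif_clin'] lmul_mult' case_prod_unfold)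
    have "?P (\<Sum>g\<in>S. lmul C (b * fst g) (dif C (Poly_Mapping.lookup z g *\<^sub>C snd g)))" for S
      by (induction S rule: infinite_finite_induct) (simp_all add: zero add gen del: image_iff)
    then show ?thesis unfolding eq .
  qed
  have dif: "?P (dif C b)" for b using gen[of 1 b] by (simp only: lmul_1')
  have Px: "?P (x i j)" for i j
  proof -
    have "?P (\<Sum>a\<in>S. rmul C (dif C (p i a)) (p a j))" for S
    proof (induction S rule: infinite_finite_induct)
      case (insert a S)
      have eq: "rmul C (dif C (p i a)) (p a j) = dif C (p i a * p a j) - lmul C (p i a) (dif C (p a j))"
        by (simp add: dif_mult')
      have "?P (rmul C (dif C (p i a)) (p a j))" unfolding eq by (rule sub[OF dif gen])
      then show ?case unfolding sum.insert[OF insert(1,2)] by (rule add[OF _ insert(3)])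
    next
      case (infinite S)
      show ?case unfolding sum.infinite[OF infinite] by (rule zero)
    next
      case empty
      show ?case unfolding sum.empty by (rule zero)
    qed
    then show ?thesis unfolding x_eq .
  qed
  have Py: "?P (y i j)" for i j
    using sub[OF dif Px, of "p i j" i j] by (simp add: dif_p)
  have "?P z" for z by (rule generated[of ?P]) (fact add zero lm Px Py)+
  then show ?thesis by auto
qed

sublocale calc C
  by unfold_locales (fact bim der tp wlin wsurj wker wtp exact')+

text \<open>
  The metric component \<open>g\<close> of two families, without its factor \<open>q\<^sup>m\<close>.
\<close>

definition G where "G u v = (\<Sum>a\<in>UNIV. e a *\<^sub>C (\<Sum>b\<in>UNIV. tens C (u a b) (v b a)))"

lemma tr_mul_W2: "tr1 (mul1 (W2 (tens C) u v)) = (\<lambda>f. G u v)"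
  by (rule ext) (simp add: ctr_def mul_W2 G_def, simp add: plug_def)

lemma dform_x: "dform C (x i j) = - (\<Sum>a\<in>UNIV. wedge C (dif C (p i a)) (dif C (p a j)))"
proof -
  have "dform C (x i j) = (\<Sum>a\<in>UNIV. dform C (rmul C (dif C (p i a)) (p a j)))"
    by (subst x_eq) (rule clin_sum[OF dform_clin])
  then show ?thesis by (simp add: dform_rmul dform_dif clin_0[OF wrmul_clin] sum_negf)
qed

text \<open>
  Balancing lets \<open>p\<close> move across the tensor sign.  A unit factor \<open>p\<close> can thus be created on one side and
  annihilated on the other, which is how the next two lemmas work.
\<close>

lemma mid: "(\<lambda>f. tens C (W2 (rmul C) u p f) (W1 v (sh (sh f)))) = (\<lambda>f. tens C (W1 u f) (W2 (lmul C) p v (sh f)))"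
  by (simp add: W2_def tn_mid)

lemma mul_mul: "mul1 (mul1 z) = mul1 (mul3 z)"
  unfolding mulL_def by (subst ctr_ctr) simp_all

lemmas tn_left = left_ops[of "tens C", OF tn_clin(1)] and tn_right = right_ops[of "tens C", OF tn_clin(2)]

lemma mul_xx: "mul1 (W2 (tens C) x x) = (\<lambda>f. 0)"
proof -
  let ?z = "\<lambda>f. tens C (W1 x f) (W2 (lmul C) p x (sh f))"
  have "W2 (tens C) x x = mul1 ?z"
    unfolding mid[symmetric] tn_left mul_xp by (simp add: W2_def[abs_def])
  then have "mul1 (W2 (tens C) x x) = mul1 (mul3 ?z)" by (simp only: mul_mul)
  also have "mul3 ?z = (\<lambda>f. 0)" unfolding tn_right mul_px by (simp add: clin_0[OF tn_clin(2)])
  finally show ?thesis by (simp add: zero_ops)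
qed

lemma mul_yy: "mul1 (W2 (tens C) y y) = (\<lambda>f. 0)"
  and omul_yy: "omul1 (W2 (tens C) y y) = (\<lambda>f. 0)"
proof -
  let ?z = "\<lambda>f. tens C (W1 y f) (W2 (lmul C) p y (sh f))"
  have "W2 (tens C) y y = mul3 ?z"
    unfolding tn_right mul_py by (simp add: W2_def[abs_def])
  then have "mul1 (W2 (tens C) y y) = mul1 (mul1 ?z)" by (simp only: mul_mul)
  also have "mul1 ?z = (\<lambda>f. 0)" unfolding mid[symmetric] tn_left mul_yp by (simp add: clin_0[OF tn_clin(1)])
  finally show "mul1 (W2 (tens C) y y) = (\<lambda>f. 0)" by (simp add: zero_ops)
  have "omul1 ?z = W2 (tens C) y y"
    unfolding mid[symmetric] tn_left omul_yp by (simp add: W2_def[abs_def])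
  then have "omul1 (W2 (tens C) y y) = omul1 (omul3 ?z)" using omulL_assoc[of "Suc 0" ?z] by simp
  also have "omul3 ?z = (\<lambda>f. 0)" unfolding tn_right omul_py by (simp add: clin_0[OF tn_clin(2)])
  finally show "omul1 (W2 (tens C) y y) = (\<lambda>f. 0)" by (simp add: zero_ops)
qed

lemma tr1_Wxy: "tr1 (W2 (tens C) x v) = (\<lambda>f. 0)" and tr1_Wyx: "tr1 (W2 (tens C) y v) = (\<lambda>f. 0)"
  and tr3_Wyx: "tr3 (W2 (tens C) v x) = (\<lambda>f. 0)"
  by (simp_all add: tr1_W2[OF tn_clin(1)] tr3_W2[OF tn_clin(2)] tr_x tr_y clin_0[OF tn_clin(1)] clin_0[OF tn_clin(2)])

text \<open>
  Triple words with \<open>p\<close> at the left and at the right end.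
\<close>

definition puv where "puv u v f = tlmul C (W1 p f) (W2 (tens C) u v (sh f))"
definition uvp where "uvp u v f = tens C (W1 u f) (W2 (rmul C) v p (sh f))"

lemma tl_right: "mul3 (puv u v) = (\<lambda>f. tlmul C (W1 p f) (mul1 (W2 (tens C) u v) (sh f)))"
  unfolding puv_def[abs_def] by (rule right_ops[of "tlmul C", OF tlmul_clin])

lemma tr3_mul3_puv: "tr3 (mul3 (puv u v)) = (\<lambda>f. tlmul C (W1 p f) (G u v))"
  unfolding tl_right right_ops[of "tlmul C", OF tlmul_clin] tr_mul_W2 ..

lemma puv_alt: "puv u v = (\<lambda>f. tens C (W2 (lmul C) p u f) (W1 v (sh (sh f))))"
  by (rule ext) (simp add: puv_def W2_def tlmul_tn)

text \<open>
  \<open>T\<close> moves \<open>p\<close> past one family up to a scalar; the scalars \<open>t\<close> and \<open>1/t\<close> for \<open>x\<close> and \<open>y\<close> cancel.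
\<close>

lemma uvp_eq_puv:
  assumes u: "W2 (rmul C) u p = (\<lambda>f. \<alpha> *\<^sub>C T1 (W2 (lmul C) p u) f)"
    and v: "W2 (rmul C) v p = (\<lambda>f. \<beta> *\<^sub>C T1 (W2 (lmul C) p v) f)" and "\<alpha> * \<beta> = 1"
  shows "uvp u v = T3 (T1 (puv u v))"
proof -
  have "T1 (puv u v) = (\<lambda>f. \<beta> *\<^sub>C (tens C (W1 u f) (W2 (lmul C) p v (sh f))))"
  proof -
    have "(\<lambda>f. tens C (W1 u f) (W2 (lmul C) p v (sh f))) = (\<lambda>f. \<alpha> *\<^sub>C T1 (puv u v) f)"
      unfolding mid[symmetric] puv_alt tn_left u by (simp add: clin_scale[OF tn_clin(1)])
    then show ?thesis using assms(3) by (simp add: fun_eq_iff scaleC_scaleC mult.commute[of \<beta>] scaleC_one)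
  qed
  then have "T3 (T1 (puv u v)) = (\<lambda>f. \<beta> *\<^sub>C tens C (W1 u f) (T1 (W2 (lmul C) p v) (sh f)))"
    by (simp only: const_ops(3)[OF clin_scaleC] tn_right)
  also have "\<dots> = uvp u v"
    unfolding uvp_def[abs_def] v by (simp add: clin_scale[OF tn_clin(2)])
  finally show ?thesis by simp
qed

lemma uvp_yx: "uvp y x = T3 (T1 (puv y x))" and uvp_xy: "uvp x y = T3 (T1 (puv x y))"
  by (rule uvp_eq_puv[OF yp xp] uvp_eq_puv[OF xp yp], simp add: t_nz)+

lemma central:
  assumes "uvp u v = T3 (T1 (puv u v))"
  shows "trmul C (G u v) (p i j) = tlmul C (p i j) (G u v)"
proof -
  have "uvp u v = (\<lambda>f. trmul C (W2 (tens C) u v f) (W1 p (sh (sh f))))"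
    by (rule ext) (simp add: uvp_def W2_def trmul_tn)
  moreover have trm: "clin (\<lambda>z. trmul C z b)" for b by (rule trmul_clin)
  ultimately have "tr1 (mul1 (uvp u v)) = (\<lambda>f. trmul C (G u v) (W1 p f))"
    using tr_mul_W2[of u v]
    by (simp only: left_ops[of "trmul C", OF trmul_clin])
       (subst ctr_apply[where \<Phi> = "\<lambda>f z. trmul C z (W1 p (sh f))" and \<Psi> = "\<lambda>f z. trmul C z (W1 p f)"];
         simp add: trmul_clin W1_def sh_def plug_def)
  then have "(\<lambda>f. trmul C (G u v) (W1 p f)) = (\<lambda>f. tlmul C (W1 p f) (G u v))"
    using trace_central[of "Suc 0" "puv u v"] unfolding assms tr3_mul3_puv by simp
  from fun_cong[OF this, of "\<lambda>k. if k = Suc 0 then i else j"] show ?thesis by (simp add: W1_def)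
qed

text \<open>
  The rank one identity for \<open>p y x\<close>, whose first two factors are symmetric by \<open>sym_y\<close>; on the other end \<open>x p = x\<close>.
\<close>

lemma mul_yx: "mul1 (W2 (tens C) y x) = (\<lambda>f. tlmul C (W1 p f) (G y x))"
proof -
  have sym: "opL (Suc 0) R (opL (Suc (Suc 0)) K (puv y x)) = opL (Suc (Suc 0)) K (puv y x)"
    unfolding puv_alt opL_left[where t = "tens C", OF tn_clin(1), simplified] sym_y
    by (simp add: opL_left[where t = "tens C", OF tn_clin(1)] sym_y)
  have "mul1 (mul1 (uvp y x)) = (\<lambda>f. tlmul C (W1 p f) (G y x))"
    using rank_one_mul[OF sym] unfolding uvp_yx[symmetric] tr3_mul3_puv .
  moreover have "mul3 (uvp y x) = W2 (tens C) y x"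
    unfolding uvp_def[abs_def] tn_right mul_xp by (simp add: W2_def[abs_def])
  ultimately show ?thesis by (simp add: mul_mul)
qed

text \<open>
  The rank one identity of the opposite product for \<open>p x y\<close>.  It concerns \<open>T\<inverse>\<close> since the other term
  of \<open>mulL_TiL\<close>, the trace over the first factor, vanishes for \<open>x\<close>.
\<close>

lemma mul_Ti_xy: "mul1 (TiL (Suc 0) (W2 (tens C) x y)) = (\<lambda>f. tlmul C (W1 p f) (G x y))"
proof -
  have sym: "opL (Suc (Suc (Suc 0))) Rs (opL (Suc (Suc 0)) K (puv x y)) = opL (Suc (Suc 0)) K (puv x y)"
    unfolding puv_alt by (simp add: opL_left[where t = "tens C", OF tn_clin(1)] sym_x)
  have tr0: "tr5 (puv x y) = (\<lambda>f. 0)"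
  proof -
    have "puv x y = (\<lambda>f. tlmul C (W1 p f) (W2 (tens C) x y (sh f)))" by (simp add: puv_def[abs_def])
    then have "tr5 (puv x y) = (\<lambda>f. tlmul C (W1 p f) (tr3 (W2 (tens C) x y) (sh f)))"
      by (simp add: ctr_right[where t = "tlmul C", OF tlmul_clin])
    then show ?thesis by (simp add: tr3_W2[OF tn_clin(2)] tr_y clin_0[OF tn_clin(2)] clin_0[OF tlmul_clin])
  qed
  have "omul3 (uvp x y) = W2 (tens C) x y"
    unfolding uvp_def[abs_def] tn_right omul_yp by (simp add: W2_def[abs_def])
  then have "omul1 (W2 (tens C) x y) = (\<lambda>f. t *\<^sub>C tlmul C (W1 p f) (G x y))"
    using rank_one_omul[OF sym tr0] unfolding uvp_xy[symmetric] tr3_mul3_puv by simp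
  then show ?thesis by (simp add: mulL_TiL tr1_Wxy scaleC_scaleC t_nz scaleC_one)
qed

end

section \<open>The Riemann tensor\<close>

context braided_legs
begin

lemma tr1_omul3: "tr1 (omul3 z) = omul1 (tr1 z)"
  unfolding omulL_def by (subst ctr_ctr) (simp_all add: opL_ctr_above)

end

context qproj
begin

lemma wrmul_wedge_map: "wrmul C (wedge_map C z) b = wedge_map C (trmul C z b)"
  by (rule tensor_eq[OF tp]) (auto intro: clin_compose[OF wrmul_clin wlin] clin_compose[OF wlin trmul_clin]
      simp: wrmul_wd[unfolded wedge_def] trmul_tn)

lemma W2_wedge: "W2 (wedge C) u v = (\<lambda>f. wedge_map C (W2 (tens C) u v f))"
  by (rule ext) (simp add: W2_def wedge_def)
lemma mul_wedge: fixes u v :: "'n \<Rightarrow> 'n \<Rightarrow> 'o" shows "mul1 (W2 (wedge C) u v) = (\<lambda>f. wedge_map C (mul1 (W2 (tens C) u v) f))"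
  unfolding W2_wedge by (rule const_ops[OF wlin])
lemma omul_wedge: "omul1 (W2 (wedge C) u v) = (\<lambda>f. wedge_map C (omul1 (W2 (tens C) u v) f))"
  unfolding W2_wedge by (rule const_ops[OF wlin])

text \<open>
  By \<open>x_eq\<close>, \<open>dx\<close> is minus the product of \<open>dp\<close> with itself, from which \<open>x x\<close> and \<open>y y\<close> drop out.
\<close>

lemma dform_W1_x: "dform C (W1 x f) = - (mul1 (W2 (wedge C) x y) f + mul1 (W2 (wedge C) y x) f)"
proof -
  have "dform C (W1 x f) = - (\<Sum>a\<in>UNIV. wedge C (dif C (p (f (Suc 0)) a)) (dif C (p a (f (Suc (Suc 0))))))"
    unfolding W1_def by (rule dform_x)
  also have "(\<Sum>a\<in>UNIV. wedge C (dif C (p (f (Suc 0)) a)) (dif C (p a (f (Suc (Suc 0)))))) =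
    mul1 (W2 (wedge C) x x) f + mul1 (W2 (wedge C) y x) f + (mul1 (W2 (wedge C) x y) f + mul1 (W2 (wedge C) y y) f)"
    by (simp add: mul_W2 dif_p clin_add[OF wd_clin(1)] clin_add[OF wd_clin(2)] sum.distrib)
  finally show ?thesis by (simp add: mul_wedge mul_xx mul_yy clin_0[OF wlin])
qed

lemma dform_W1_y: "dform C (W1 y f) = mul1 (W2 (wedge C) x y) f + mul1 (W2 (wedge C) y x) f"
proof -
  have "dform C (W1 x f + W1 y f) = 0" unfolding W1_def dif_p[symmetric] by (rule dform_dif)
  then show ?thesis by (simp add: clin_add[OF dform_clin] dform_W1_x add_eq_0_iff)
qed

text \<open>
  The trace of \<open>dx\<close> is zero because the trace of \<open>x\<close> is.
\<close>

lemma wedge_G: "wedge_map C (G y x) = - wedge_map C (G x y)"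
proof -
  have "tr1 (\<lambda>f. dform C (W1 x f)) = (\<lambda>f. 0)"
    by (simp add: const_ops(5)[OF dform_clin] tr_x clin_0[OF dform_clin])
  moreover have "tr1 (\<lambda>f. - (mul1 (W2 (wedge C) x y) f + mul1 (W2 (wedge C) y x) f)) =
      (\<lambda>f. - (wedge_map C (G x y) + wedge_map C (G y x)))"
  proof -
    have neg: "clin (\<lambda>z. - z :: 'w)" by (simp add: clin_def)
    show ?thesis
      unfolding const_ops(5)[OF neg] add_ops mul_wedge const_ops(5)[OF wlin] tr_mul_W2 ..
  qed
  ultimately have "(\<lambda>f :: nat \<Rightarrow> 'n. - (wedge_map C (G x y) + wedge_map C (G y x))) = (\<lambda>f. 0)"
    unfolding dform_W1_x by simp
  then have "- (wedge_map C (G x y) + wedge_map C (G y x)) = 0" by (rule fun_cong)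
  then show ?thesis by (simp add: add_eq_0_iff)
qed

text \<open>
  Triple words in two-forms tensor one-forms.
\<close>

definition Wd3 where "Wd3 u v w f = wtens C (W2 (wedge C) u v f) (W1 w (sh (sh f)))"

lemma Wd3_right: "Wd3 u v w = (\<lambda>f. wedge_id C (W1 u f) (W2 (tens C) v w (sh f)))"
  by (rule ext) (simp add: Wd3_def W2_def wid_tn)

lemmas wt_left = left_ops[of "wtens C", OF wt_clin(1)] and wid_right = right_ops[of "wedge_id C", OF wid_clin]

lemma mul_Wd3: fixes u v w :: "'n \<Rightarrow> 'n \<Rightarrow> 'o" shows "mul1 (Wd3 u v w) = (\<lambda>f. wtens C (mul1 (W2 (wedge C) u v) f) (W1 w (sh f)))"
  unfolding Wd3_def[abs_def] wt_left ..

lemma T1_px: "T1 (W2 (lmul C) p x) = (\<lambda>f. (1 / t) *\<^sub>C W2 (rmul C) x p f)"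
  unfolding xp by (simp add: scaleC_scaleC t_nz scaleC_one)

text \<open>
  A scalar commuting with \<open>p\<close> lets \<open>p\<close> cross to the right-hand \<open>x\<close>, where \<open>T\<close> turns \<open>p x\<close> into \<open>x p = x\<close>.
\<close>

lemma mul_T_central:
  assumes c: "\<And>i j. trmul C (G u v) (p i j) = tlmul C (p i j) (G u v)"
  shows "mul1 (T1 (\<lambda>f. wtens C (wedge_map C (tlmul C (W1 p f) (G u v))) (W1 x (sh f)))) =
    (\<lambda>f. (1 / t) *\<^sub>C wtens C (wedge_map C (G u v)) (W1 x f))"
proof -
  have "wtens C (wedge_map C (tlmul C (W1 p f) (G u v))) (W1 x (sh f)) =
      wtens C (wedge_map C (G u v)) (W2 (lmul C) p x f)" for f
    by (simp add: W1_def c[symmetric] wrmul_wedge_map[symmetric] wt_mid W2_def)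
  then show ?thesis
    by (simp add: const_ops[OF wt_clin(2)] T1_px const_ops(1)[OF clin_scaleC] mul_xp clin_scale[OF wt_clin(2)])
qed

lemma mul_T_yxx: "mul1 (T1 (mul1 (Wd3 y x x))) = (\<lambda>f. - ((1 / t) *\<^sub>C wtens C (wedge_map C (G x y)) (W1 x f)))"
  unfolding mul_Wd3 mul_wedge mul_yx mul_T_central[OF central[OF uvp_yx]] wedge_G
  by (simp add: clin_minus[OF wt_clin(1)] complex_vector.scale_minus_right)

lemma mul_T_Ti_xyx: "mul1 (T1 (mul1 (TiL (Suc 0) (Wd3 x y x)))) = (\<lambda>f. (1 / t) *\<^sub>C wtens C (wedge_map C (G x y)) (W1 x f))"
proof -
  have "mul1 (TiL (Suc 0) (Wd3 x y x)) = (\<lambda>f. wtens C (wedge_map C (mul1 (TiL (Suc 0) (W2 (tens C) x y)) f)) (W1 x (sh f)))"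
    unfolding Wd3_def[abs_def] wt_left W2_wedge const_ops(4)[OF wlin] const_ops(1)[OF wlin] ..
  then show ?thesis by (simp only: mul_Ti_xy mul_T_central[OF central[OF uvp_xy]])
qed

text \<open>
  In the Riemann tensor, \<open>y \<wedge> nab x\<close> equals \<open>U\<close> minus \<open>t\<close> times the term \<open>N\<close> defined further below.  Every trace and product of these two
  terms can be evaluated.
\<close>

definition U where "U = omul3 (Wd3 y y x)"

lemma U_eq: "U = (\<lambda>f. wedge_id C (W1 y f) (omul1 (W2 (tens C) y x) (sh f)))"
  unfolding U_def Wd3_right wid_right ..

text \<open>
  Associativity of the opposite product moves the bracket to \<open>y y\<close>, whose opposite product is zero.
\<close>

lemma omul_U: "omul1 U = (\<lambda>f. 0)"
proof -
  have "omul1 (Wd3 y y x) = (\<lambda>f. 0)"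
    unfolding Wd3_def[abs_def] wt_left omul_wedge omul_yy by (simp add: clin_0[OF wlin] clin_0[OF wt_clin(1)])
  then show ?thesis unfolding U_def omulL_assoc[symmetric] by (simp add: zero_ops)
qed

lemma tr_omul_yx: "tr1 (omul1 (W2 (tens C) y x)) = (\<lambda>f. t *\<^sub>C G y x)"
  by (simp add: tr_omulL tr1_Wyx zero_ops tr_mul_W2)

lemma tr3_U: "tr3 U = (\<lambda>f. t *\<^sub>C wedge_id C (W1 y f) (G y x))"
  unfolding U_eq wid_right tr_omul_yx by (simp add: clin_scale[OF wid_clin])

lemma tr1_U: "tr1 U = (\<lambda>f. 0)"
proof -
  have "tr1 (Wd3 y y x) = (\<lambda>f. wedge_id C (tr1 (W1 y) f) (W2 (tens C) y x f))"
    unfolding Wd3_right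
    by (subst ctr_apply[where \<Phi> = "\<lambda>f z. wedge_id C z (W2 (tens C) y x (sh f))" and \<Psi> = "\<lambda>f z. wedge_id C z (W2 (tens C) y x f)"])
       (auto simp: wid_clin_left W2_def W1_def sh_def plug_def)
  then show ?thesis unfolding U_def tr1_omul3 by (simp add: tr_y clin_0[OF wid_clin_left] zero_ops)
qed

text \<open>
  \<open>tr_omulL\<close> expresses this trace by the opposite product and the partial trace of \<open>U\<close>, both of which vanish.
\<close>

lemma tr_mul_U: "tr1 (mul1 U) = (\<lambda>f. 0)"
proof (rule ext)
  fix f
  have "t *\<^sub>C tr1 (mul1 U) f = 0"
    using fun_cong[OF tr_omulL[of "Suc 0" U], of f] by (simp add: omul_U tr1_U zero_ops)
  then show "tr1 (mul1 U) f = 0" using t_nz by (simp add: complex_vector.scale_eq_0_iff)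
qed

lemma mul_T_U: "mul1 (T1 U) = (\<lambda>f. (t - 1) *\<^sub>C wedge_id C (W1 y f) (G y x))"
  by (simp add: mulL_TL omul_U tr3_U scaleC_scaleC left_diff_distrib t_nz)

definition N where "N f = wedge_id C (W2 (rmul C) y p f) (G y x)"

lemma mul_N: "mul1 N = (\<lambda>f. 0)"
  unfolding N_def[abs_def] const_ops(1)[OF wid_clin_left] mul_yp by (simp add: clin_0[OF wid_clin_left])
lemma mul_T_N: "mul1 (T1 N) = (\<lambda>f. wedge_id C (W1 y f) (G y x))"
proof -
  have "mul1 (T1 (W2 (rmul C) y p)) = W1 y"
    by (simp add: mulL_TL omul_yp tr_yp scaleC_add_left[symmetric] scaleC_one)
  then show ?thesis
    unfolding N_def[abs_def] const_ops(3)[OF wid_clin_left] const_ops(1)[OF wid_clin_left] by simp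
qed

context
  fixes nab :: "'o \<Rightarrow> 't"
  assumes nlin: "clin nab" and nleib: "\<And>b z. nab (lmul C b z) = tens C (dif C b) z + tlmul C b (nab z)"
    and nab_x: "\<And>f. nab (W1 x f) = t *\<^sub>C mul1 (T1 (W2 (tens C) y x)) f - t *\<^sub>C tlmul C (W1 p f) (G y x)"
begin

text \<open>
  In this form of the connection, \<open>E T\<close> is replaced by the opposite product; the trace term of \<open>mulL_TL\<close> vanishes for a word ending in \<open>x\<close>.
\<close>

lemma nab_x': "nab (W1 x f) = omul1 (W2 (tens C) y x) f - t *\<^sub>C tlmul C (W1 p f) (G y x)"
  by (simp add: nab_x mulL_TL tr3_Wyx scaleC_scaleC t_nz scaleC_one)

lemma rlift_yx: "(\<lambda>f. rlift nab (W2 (tens C) y x f)) =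
   (\<lambda>f. (mul1 (Wd3 x y x) f + mul1 (Wd3 y x x) f) + ((- 1) *\<^sub>C U f + t *\<^sub>C N f))"
proof (rule ext)
  fix f
  have "rlift nab (W2 (tens C) y x f) = wtens C (dform C (W1 y f)) (W1 x (sh f)) - wedge_id C (W1 y f) (nab (W1 x (sh f)))"
    unfolding W2_def rlift_tn[OF nlin nleib] rinner_def ..
  also have "wedge_id C (W1 y f) (nab (W1 x (sh f))) = U f - t *\<^sub>C N f"
    by (simp add: nab_x' clin_diff[OF wid_clin] clin_scale[OF wid_clin] U_eq N_def W2_def wid_mid)
  finally show "rlift nab (W2 (tens C) y x f) = (mul1 (Wd3 x y x) f + mul1 (Wd3 y x x) f) + ((- 1) *\<^sub>C U f + t *\<^sub>C N f)"
    by (simp add: dform_W1_y mul_Wd3 clin_add[OF wt_clin(1)] scaleC_minus_one)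
qed

lemma tr_mul_mul_xyx: "tr1 (mul1 (mul1 (Wd3 x y x))) = (\<lambda>f. 0)"
proof -
  have "mul3 (Wd3 x y x) = (\<lambda>f. wedge_id C (W2 (rmul C) x p f) (G y x))"
    unfolding Wd3_right wid_right mul_yx by (simp add: W2_def wid_mid)
  then have "mul1 (mul1 (Wd3 x y x)) = (\<lambda>f. wedge_id C (W1 x f) (G y x))"
    unfolding mul_mul by (simp add: const_ops(1)[OF wid_clin_left] mul_xp)
  then show ?thesis by (simp add: const_ops(5)[OF wid_clin_left] tr_x clin_0[OF wid_clin_left])
qed

lemma mul_mul_yxx: "mul1 (mul1 (Wd3 y x x)) = (\<lambda>f. 0)"
  unfolding mul_mul Wd3_right wid_right mul_xx by (simp add: clin_0[OF wid_clin] zero_ops)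

text \<open>
  \<open>G\<close> is the trace of the matrix product \<open>y x\<close>, and each of the four terms in \<open>rlift_yx\<close> has vanishing traced
  product.
\<close>

lemma rlift_G: "rlift nab (G y x) = 0"
proof -
  have "(\<lambda>f :: nat \<Rightarrow> 'n. rlift nab (G y x)) = tr1 (mul1 (\<lambda>f. rlift nab (W2 (tens C) y x f)))"
    unfolding const_ops[OF rlift_clin[OF nlin nleib]] tr_mul_W2 ..
  also have "\<dots> = (\<lambda>f. 0)"
    unfolding rlift_yx add_ops const_ops[OF clin_scaleC] tr_mul_mul_xyx mul_mul_yxx tr_mul_U mul_N zero_ops by simp
  finally show ?thesis by (rule fun_cong)
qed

text \<open>
  The terms \<open>U\<close> and \<open>N\<close> contribute \<open>- (t - 1) + t = 1\<close> times \<open>y \<wedge> G\<close>, multiplied by the factor \<open>t\<close> of the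
  connection, and this cancels the \<open>y\<close> part of \<open>dp \<wedge> G\<close>.
\<close>

theorem riemann_x: "riemann C nab (W1 x f) =
  t *\<^sub>C mul1 (T1 (mul1 (Wd3 x y x))) f + t *\<^sub>C mul1 (T1 (mul1 (Wd3 y x x))) f - t *\<^sub>C wedge_id C (W1 x f) (G y x)"
proof -
  note rl = rlift_clin[OF nlin nleib]
  have "riemann C nab (W1 x f) = t *\<^sub>C rlift nab (mul1 (T1 (W2 (tens C) y x)) f) - t *\<^sub>C rlift nab (tlmul C (W1 p f) (G y x))"
    by (simp add: riemann_eq nab_x clin_diff[OF rl] clin_scale[OF rl])
  also have "rlift nab (mul1 (T1 (W2 (tens C) y x)) f) = mul1 (T1 (\<lambda>f. rlift nab (W2 (tens C) y x f))) f"
    by (simp add: const_ops[OF rl])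
  also have "\<dots> = mul1 (T1 (mul1 (Wd3 x y x))) f + mul1 (T1 (mul1 (Wd3 y x x))) f
      + ((- 1) *\<^sub>C (t - 1) *\<^sub>C wedge_id C (W1 y f) (G y x) + t *\<^sub>C wedge_id C (W1 y f) (G y x))"
    unfolding rlift_yx add_ops const_ops[OF clin_scaleC] mul_T_U mul_T_N ..
  also have "(- 1) *\<^sub>C (t - 1) *\<^sub>C wedge_id C (W1 y f) (G y x) + t *\<^sub>C wedge_id C (W1 y f) (G y x) = wedge_id C (W1 y f) (G y x)"
    by (simp only: scaleC_scaleC scaleC_add_left[symmetric]) (simp add: scaleC_one)
  also have "rlift nab (tlmul C (W1 p f) (G y x)) = wedge_id C (W1 x f) (G y x) + wedge_id C (W1 y f) (G y x)"
    by (simp add: rlift_tlmul[OF nlin nleib] rlift_G clin_0[OF ulmul_clin] W1_def dif_p clin_add[OF wid_clin_left])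
  finally show ?thesis by (simp add: scaleC_add_right)
qed

text \<open>
  In multiples of \<open>\<wedge>(G x y) \<otimes> x\<close>, the word \<open>y x x\<close> with its factor \<open>t\<close> is \<open>-1\<close> and the \<open>T\<inverse>\<close> word is \<open>1/t\<close>;
  the remaining coefficient makes up for the difference.
\<close>

theorem riemann_x': "riemann C nab (W1 x f) =
  t *\<^sub>C mul1 (T1 (mul1 (Wd3 x y x))) f - mul1 (T1 (mul1 (TiL (Suc 0) (Wd3 x y x)))) f
    - (1 - 1 / t) *\<^sub>C wtens C (wedge_map C (G x y)) (W1 x f) - t *\<^sub>C wedge_id C (W1 x f) (G y x)"
  unfolding riemann_x mul_T_yxx mul_T_Ti_xyx
  by (simp add: complex_vector.scale_minus_right scaleC_scaleC t_nz scaleC_one complex_vector.scale_left_diff_distrib)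

end

end

section \<open>From index lists to legs, and the theorem\<close>

text \<open>
  Reads a tensor indexed by lists of length \<open>n\<close> as one indexed by assignments, with legs 1 to \<open>n\<close>.
\<close>

definition lf where "lf n z f = z (map f [1..<Suc n])"

lemma lf_on_legs:
  fixes z :: "'n::finite list \<Rightarrow> 'm::complex_vector"
  assumes "1 \<le> k" "k < n"
  shows "lf n (on_legs k A z) = opL k A (lf n z)"
proof (rule ext)
  fix f :: "nat \<Rightarrow> 'n"
  have nth: "map f [1..<Suc n] ! (k - 1) = f k" "map f [1..<Suc n] ! k = f (Suc k)"
    using assms by (simp_all add: nth_map_upt del: upt_Suc)
  have upd: "(map f [1..<Suc n])[k - 1 := a, k := b] = map (f(k := a, Suc k := b)) [1..<Suc n]" for a b
    using assms by (intro nth_equalityI) (auto simp: nth_list_update nth_map_upt simp del: upt_Suc)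
  show "lf n (on_legs k A z) f = opL k A (lf n z) f"
    unfolding lf_def on_legs_def opL_def nth upd sum_pair_UNIV by simp
qed

text \<open>
  Contractions agree as long as the pairing is diagonal, as \<open>E\<close> and \<open>E'\<close> are.
\<close>

lemma lf_contract:
  fixes z :: "'n::finite list \<Rightarrow> 'm::complex_vector"
  assumes "1 \<le> k" "k \<le> Suc n" and B: "\<And>a b. B a b = (if a = b then w a else 0)"
  shows "lf n (contract k B z) = ctr k w (lf (Suc (Suc n)) z)"
proof (rule ext)
  fix f :: "nat \<Rightarrow> 'n"
  have ins: "take (k - 1) (map f [1..<Suc n]) @ [a, a] @ drop (k - 1) (map f [1..<Suc n]) = map (plug k a f) [1..<Suc (Suc (Suc n))]" for a
  proof (intro nth_equalityI)
    show "length (take (k - 1) (map f [1..<Suc n]) @ [a, a] @ drop (k - 1) (map f [1..<Suc n])) = length (map (plug k a f) [1..<Suc (Suc (Suc n))])"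
      using assms by (simp del: upt_Suc)
    fix i assume "i < length (take (k - 1) (map f [1..<Suc n]) @ [a, a] @ drop (k - 1) (map f [1..<Suc n]))"
    then have i: "i < Suc (Suc n)" using assms by (simp del: upt_Suc)
    consider "i < k - 1" | "i = k - 1" | "i = k" | "k < i" by linarith
    then show "(take (k - 1) (map f [1..<Suc n]) @ [a, a] @ drop (k - 1) (map f [1..<Suc n])) ! i = map (plug k a f) [1..<Suc (Suc (Suc n))] ! i"
    proof cases
      case 4
      then obtain d where d: "i = Suc k + d" using less_iff_Suc_add by auto
      have "i - (k - 1) = Suc (Suc d)" "Suc i - 2 = k + d" "k - 1 + d < n" using d assms i by auto
      moreover have "\<not> n \<le> k - 1" "\<not> Suc (k + d) < k - 1" using d assms i by auto
      ultimately show ?thesis using assms i d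
        by (simp add: nth_append nth_map_upt plug_def min_def del: upt_Suc)
    qed (use assms i in \<open>auto simp: nth_append nth_map_upt plug_def min_def simp del: upt_Suc\<close>)
  qed
  have "lf n (contract k B z) f = (\<Sum>a\<in>UNIV. \<Sum>b\<in>UNIV. if b = a then w a *\<^sub>C z (map (plug k a f) [1..<Suc (Suc (Suc n))]) else 0)"
    unfolding lf_def contract_def sum_pair_UNIV B by (intro sum.cong refl) (simp add: ins[unfolded append_Cons append_Nil One_nat_def] del: upt_Suc)
  also have "\<dots> = ctr k w (lf (Suc (Suc n)) z) f" by (simp add: sum.delta ctr_def lf_def del: upt_Suc)
  finally show "lf n (contract k B z) f = ctr k w (lf (Suc (Suc n)) z) f" .
qed

lemma upt_numeral: "[1..<Suc 4] = [Suc 0, Suc (Suc 0), Suc (Suc (Suc 0)), Suc (Suc (Suc (Suc 0)))]"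
  "[1..<Suc 2] = [Suc 0, Suc (Suc 0)]" "[1..<Suc 0] = []"
  "[1..<Suc 6] = [Suc 0, Suc (Suc 0), Suc (Suc (Suc 0)), Suc (Suc (Suc (Suc 0))), Suc (Suc (Suc (Suc (Suc 0)))), Suc (Suc (Suc (Suc (Suc (Suc 0)))))]"
  by (simp_all add: upt_rec numeral_eq_Suc)

lemma lf_fam:
  "lf 2 (fam1 u) = W1 u"
  "lf 4 (fam2 g u v) = W2 g u v"
  "lf 6 (fam3 h u v w) = (\<lambda>f. h (W1 u f) (W1 v (sh f)) (W1 w (sh (sh f))))"
  by (simp_all add: fun_eq_iff lf_def fam1_def fam2_def fam3_def W1_def W2_def sh_def upt_numeral numeral_eq_Suc)

lemma opL_scalM: "opL k (scalM c A) z = (\<lambda>f. c *\<^sub>C opL k A z f)"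
  by (rule ext) (simp add: opL_def scalM_def scaleC_sum_right scaleC_scaleC)

lemma scaleC_cancel: "c \<noteq> 0 \<Longrightarrow> c *\<^sub>C x = c *\<^sub>C y \<Longrightarrow> x = (y :: 'm::complex_vector)"
  by (rule complex_vector.scale_left_imp_eq)

lemma clin_opL: "clin L \<Longrightarrow> L (opL k A z f) = opL k A (\<lambda>f. L (z f)) f"
  using opL_const[of L k A z] by simp

text \<open>
  The braidings are those of \<open>braided_legs\<close> up to \<open>Q = q\<^sup>w\<close>; these scalars become the factors \<open>q\<^sup>w\<close> and
  \<open>q\<^sup>-\<^sup>w\<close> in the relations of the calculus and cancel there.
\<close>

locale explicit_braiding = braided_legs R Ri Rs Rsi K M e t
  for R Ri Rs Rsi K M :: "complex ^ ('n::finite \<times> 'n) ^ ('n \<times> 'n)" and e :: "'n \<Rightarrow> complex" and t :: complex +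
  fixes r q and V :: "'n uq_action" and Q :: complex
  assumes Q0: "Q \<noteq> 0" and bVV: "braiding r q V V = scalM Q R" and bdd: "braiding r q (dual_action V) (dual_action V) = scalM Q Rs"
    and bVd: "braiding r q V (dual_action V) = scalM (1 / Q) M"
begin

lemma inverses: "matrix_inv (scalM Q R) = scalM (1 / Q) Ri" "matrix_inv (scalM Q Rs) = scalM (1 / Q) Rsi"
  "matrix_inv (scalM (1 / Q) M) = scalM Q K"
proof -
  have "R ** Ri = mat 1" "Rs ** Rsi = mat 1" using R_inv Rs_inv matrix_left_right_inverse by blast+
  then show "matrix_inv (scalM Q R) = scalM (1 / Q) Ri" "matrix_inv (scalM Q Rs) = scalM (1 / Q) Rsi"
    "matrix_inv (scalM (1 / Q) M) = scalM Q K"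
    using Q0 MK by (auto intro!: matrix_inv_eqI(1) simp: scalM_mult scalM_scalM)
qed

lemma on_legs_lf:
  assumes "n \<ge> 4"
  shows "lf n (on_legs 1 A z) = opL (Suc 0) A (lf n z)" "lf n (on_legs 2 A z) = opL (Suc (Suc 0)) A (lf n z)"
    "lf n (on_legs 3 A z) = opL (Suc (Suc (Suc 0))) A (lf n z)"
  using assms lf_on_legs[of 1 n A z] lf_on_legs[of 2 n A z] lf_on_legs[of 3 n A z] by (simp_all add: numeral_2_eq_2 numeral_3_eq_3)

lemma lf_S: "n \<ge> 4 \<Longrightarrow> lf n (S123 r q V z) = (\<lambda>f. Q *\<^sub>C opL (Suc (Suc 0)) M (opL (Suc 0) R (opL (Suc (Suc 0)) K (lf n z))) f)"
  unfolding S123_def bVV bVd inverses using Q0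
  by (simp add: on_legs_lf[unfolded One_nat_def] opL_scalM opL_scale scaleC_scaleC)

lemma lf_tS: "n \<ge> 4 \<Longrightarrow> lf n (tildeS234 r q V z) = (\<lambda>f. (1 / Q) *\<^sub>C opL (Suc (Suc 0)) M (opL (Suc (Suc (Suc 0))) Rsi (opL (Suc (Suc 0)) K (lf n z))) f)"
  unfolding tildeS234_def bdd bVd inverses using Q0
  by (simp add: on_legs_lf opL_scalM opL_scale scaleC_scaleC)

lemma lf_T: "n \<ge> 4 \<Longrightarrow> lf n (T1234 r q V z) = TL (Suc 0) (lf n z)"
  unfolding T1234_def TL_def using Q0
  by (simp add: lf_S lf_tS opL_scale scaleC_scaleC scaleC_one)

lemma lf_Ti: "n \<ge> 4 \<Longrightarrow> lf n (T1234_inv r q V z) = TiL (Suc 0) (lf n z)"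
  unfolding T1234_inv_def Let_def TiL_def bdd bVd bVV inverses using Q0
  by (simp add: on_legs_lf[unfolded One_nat_def] opL_scalM opL_scale scaleC_scaleC scaleC_one opL_commute[of "Suc 0" "Suc (Suc (Suc 0))"])

end

lemma clin_module_eval:
  fixes la :: "'b::complex_algebra_1 \<Rightarrow> 'o::complex_vector \<Rightarrow> 'o" and f :: "'g \<Rightarrow> 'o"
  assumes la: "\<And>x. clin (\<lambda>b. la b x)"
  shows "clin (module_eval la f)"
proof -
  have sup: "module_eval la f x = (\<Sum>g\<in>S. la (Poly_Mapping.lookup x g) (f g))"
    if "finite S" "Poly_Mapping.keys x \<subseteq> S" for x :: "'g \<Rightarrow>\<^sub>0 'b" and S
    unfolding module_eval_def using that
    by (intro sum.mono_neutral_left) (auto simp: in_keys_iff clin_0[OF la])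
  have "module_eval la f (x + y) = module_eval la f x + module_eval la f y" for x y :: "'g \<Rightarrow>\<^sub>0 'b"
  proof -
    let ?S = "Poly_Mapping.keys x \<union> Poly_Mapping.keys y"
    have "module_eval la f (x + y) = (\<Sum>g\<in>?S. la (Poly_Mapping.lookup (x + y) g) (f g))"
      by (rule sup) (simp_all add: Poly_Mapping.keys_add)
    then show ?thesis by (simp add: sup[of ?S] lookup_add clin_add[OF la] sum.distrib)
  qed
  moreover have "module_eval la f (c *\<^sub>C x) = c *\<^sub>C module_eval la f x" for c and x :: "'g \<Rightarrow>\<^sub>0 'b"
  proof -
    have "module_eval la f (c *\<^sub>C x) = (\<Sum>g\<in>Poly_Mapping.keys x. la (Poly_Mapping.lookup (c *\<^sub>C x) g) (f g))"
      by (rule sup) (auto simp: in_keys_iff lookup_scaleC)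
    then show ?thesis by (simp add: module_eval_def lookup_scaleC clin_scale[OF la] scaleC_sum_right)
  qed
  ultimately show ?thesis by (simp add: clin_def)
qed

lemma module_eval_single:
  assumes "\<And>x. clin (\<lambda>b. la b x)"
  shows "module_eval la f (Poly_Mapping.single g b) = la b (f g)"
  by (cases "b = 0") (simp_all add: module_eval_def clin_0[OF assms])

lemma free_lmult_single: "free_lmult b (Poly_Mapping.single g c) = Poly_Mapping.single g (b * c)"
  unfolding free_lmult_def by (rule poly_mapping_eqI) (simp add: Poly_Mapping.map.rep_eq lookup_single when_def)

lemma presented_left_module_relator:
  assumes "presented_left_module la N f A" "a \<in> A"
  shows "module_eval la f a = 0"
proof -
  have "a \<in> left_submodule A" using assms(2) by (auto simp: left_submodule_def)
  then show ?thesis using assms(1) by (auto simp: presented_left_module_def)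
qed

lemma presented_algebra_relator:
  assumes "presented_algebra p A" "a \<in> A"
  shows "alg_eval p a = 0"
proof -
  have "a \<in> two_sided_ideal A" using assms(2) by (auto simp: two_sided_ideal_def)
  then show ?thesis using assms(1) by (auto simp: presented_algebra_def)
qed

lemma alg_eval_letter: "alg_eval p (Poly_Mapping.single (Word [g]) 1) = p g"
  and alg_eval_1: "alg_eval p 1 = 1"
  by (simp_all add: alg_eval_def free_eval_single scaleC_one single_one[symmetric] zero_fword_def del: single_one)

context explicit_braiding
begin

text \<open>
  The relations of \<open>\<Omega>\<^sub>\<plusminus>\<close> live in a free module; evaluating them by the module map that sends the free generators to the
  forms \<open>x\<close> turns relators into identities between words.  The operator \<open>L\<close> stands for \<open>S\<close> or \<open>S'\<close> on the
  level of legs, so that both halves of the calculus are instances.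
\<close>

lemma form_relators:
  fixes la :: "'b::complex_algebra_1 \<Rightarrow> 'o::complex_vector \<Rightarrow> 'o" and p :: "'n \<Rightarrow> 'n \<Rightarrow> 'b" and x :: "'n \<Rightarrow> 'n \<Rightarrow> 'o"
  assumes la: "\<And>z. clin (\<lambda>b. la b z)" and la1: "\<And>z. la 1 z = z"
    and pm: "presented_left_module la N (case_prod x) (Omega_relators r q wt p Z c)"
    and wt: "\<And>a. qpow q (wform r (wt a) (two_rho r)) = m * e a" and m0: "m \<noteq> 0"
  shows form_trace: "ctr (Suc 0) e (W1 x) = (\<lambda>f. 0)"
    and form_sym: "\<And>L. (\<And>(z :: 'n list \<Rightarrow> ('n \<times> 'n) \<Rightarrow>\<^sub>0 'b) f. lf 4 (Z z) f = L (lf 4 z) f) \<Longrightarrow>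
      module_eval la (case_prod x) (L (W2 free_lmult p (\<lambda>i j. Poly_Mapping.single (i, j) 1)) f) = c *\<^sub>C W2 la p x f"
    and form_word: "module_eval la (case_prod x) (W2 free_lmult p (\<lambda>i j. Poly_Mapping.single (i, j) 1) f) = W2 la p x f"
proof -
  let ?E = "module_eval la (case_prod x)" and ?s = "\<lambda>i j. Poly_Mapping.single (i, j) (1 :: 'b)"
  have E: "clin ?E" by (rule clin_module_eval[OF la])
  have Es: "?E (Poly_Mapping.single (i, j) b) = la b (x i j)" for i j b
    by (simp add: module_eval_single[where la = la, OF la])
  show word: "?E (W2 free_lmult p ?s f) = W2 la p x f" for f
    by (simp add: W2_def W1_def free_lmult_single Es)
  show "ctr (Suc 0) e (W1 x) = (\<lambda>f. 0)"
  proof (rule ext)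
    fix f :: "nat \<Rightarrow> 'n"
    have "contract 1 (evE' r q wt) (fam1 ?s) [] \<in> Omega_relators r q wt p Z c"
      by (simp add: Omega_relators_def Let_def)
    from presented_left_module_relator[OF pm this]
    have z: "?E (lf 0 (contract 1 (evE' r q wt) (fam1 ?s)) f) = 0" by (simp add: lf_def)
    have c: "lf 0 (contract 1 (evE' r q wt) (fam1 ?s)) = ctr 1 (\<lambda>a. m * e a) (lf (Suc (Suc 0)) (fam1 ?s))"
      by (rule lf_contract) (auto simp: evE'_def wt)
    have l: "lf (Suc (Suc 0)) (fam1 ?s) = W1 ?s" using lf_fam(1)[of ?s] by (simp add: numeral_2_eq_2)
    have "?E (ctr (Suc 0) (\<lambda>a. m * e a) (W1 ?s) f) = 0" using z unfolding c l by simp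
    then have "m *\<^sub>C ctr (Suc 0) e (\<lambda>f. ?E (W1 ?s f)) f = 0"
      by (simp add: ctr_weight_scale clin_scale[OF E] ctr_const[OF E])
    moreover have "(\<lambda>f. ?E (W1 ?s f)) = W1 x" by (simp add: fun_eq_iff W1_def Es la1)
    ultimately show "ctr (Suc 0) e (W1 x) f = 0" using m0 by (simp add: complex_vector.scale_eq_0_iff)
  qed
  fix L and f :: "nat \<Rightarrow> 'n"
  assume L: "\<And>(z :: 'n list \<Rightarrow> ('n \<times> 'n) \<Rightarrow>\<^sub>0 'b) f. lf 4 (Z z) f = L (lf 4 z) f"
  let ?pe = "fam2 free_lmult p ?s"
  have "Z ?pe (map f [1..<Suc 4]) - c *\<^sub>C ?pe (map f [1..<Suc 4]) \<in> Omega_relators r q wt p Z c"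
    unfolding Omega_relators_def Let_def by (intro UnI1 CollectI exI conjI refl) (simp only: upt_numeral list.map list.size, simp)
  from presented_left_module_relator[OF pm this]
  have "?E (lf 4 (Z ?pe) f - c *\<^sub>C lf 4 ?pe f) = 0" by (simp add: lf_def del: upt_Suc)
  then show "?E (L (W2 free_lmult p ?s) f) = c *\<^sub>C W2 la p x f"
    unfolding L lf_fam by (simp add: clin_diff[OF E] clin_scale[OF E] word)
qed

end

theorem lemma5p3:
  fixes r s :: nat and q :: real
    and V :: "'n::finite uq_action" and wt :: "'n \<Rightarrow> weight"
    and C :: "('n, 'b::complex_algebra_1, 'o::complex_vector, 't::complex_vector,
               'w::complex_vector, 'u::complex_vector) calculus"
    and nab :: "'o \<Rightarrow> 't"
  assumes "r \<ge> 1" and "0 < q" and "q < 1" and "s \<in> {1, r}"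
    and "CARD('n) = r + 1"
    and "is_simple_type1 r q V (fundamental_weight r s)"
    and "\<And>i. wt i \<in> weight_lattice r" and "\<And>i. weight_vector r q V (wt i) (axis i 1)"
    and "is_quantum_projective_calculus r s q V wt C"
    and "is_levi_civita r s q V wt C nab"
  shows "\<forall>i j.
    (let a = wform r (simple_root s) (simple_root s);
         m = wform r (fundamental_weight r s) (two_rho r);
         E23 = contract 2 evE;
         T = T1234 r q V; T_inv = T1234_inv r q V;
         w3 = (\<lambda>x y z. wtens C (wedge C x y) z)
     in
       riemann C nab (dp C i j) =
         qpow q a *\<^sub>C E23 (T (E23 (fam3 w3 (dp C) (dbp C) (dp C)))) [i, j]
         + qpow q a *\<^sub>C E23 (T (E23 (fam3 w3 (dbp C) (dp C) (dp C)))) [i, j]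
         - (qpow q a * qpow q (- m)) *\<^sub>C wedge_id C (dp C i j) (g_mp r q wt C)
     \<and> riemann C nab (dp C i j) =
         qpow q a *\<^sub>C E23 (T (E23 (fam3 w3 (dp C) (dbp C) (dp C)))) [i, j]
         - E23 (T (E23 (T_inv (fam3 w3 (dp C) (dbp C) (dp C))))) [i, j]
         - ((1 - qpow q (- a)) * qpow q (- m)) *\<^sub>C wtens C (wedge_map C (g_pm r q wt C)) (dp C i j)
         - (qpow q a * qpow q (- m)) *\<^sub>C wedge_id C (dp C i j) (g_mp r q wt C))"
proof -
  define h where "h = complex_of_real q"
  define w where "w = wform r (fundamental_weight r s) (fundamental_weight r s)"
  define m where "m = wform r (fundamental_weight r s) (two_rho r)"
  define a where "a = wform r (simple_root s) (simple_root s)"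
  obtain pos where bij: "bij_betw pos UNIV {..<CARD('n)}"
    and bVV: "braiding r q V V = scalM (qpow q w) (heckeR pos h)"
    and bdd: "braiding r q (dual_action V) (dual_action V) = scalM (qpow q w) (dualRs (heckeR pos h))"
    and bVd: "braiding r q V (dual_action V) = scalM (qpow q (- w)) (dualM pos h)"
    and wt: "\<forall>a. qpow q (wform r (wt a) (two_rho r)) = qpow q m * (1 / h\<^sup>2) ^ pos a"
    using braidings_explicit[OF assms(1-6,8)] unfolding h_def w_def m_def by blast
  have h0: "h \<noteq> 0" using assms(2) by (simp add: h_def)
  have Q0: "qpow q w \<noteq> 0" and M0: "qpow q m \<noteq> 0" using assms(2) by simp_all
  have Q0': "1 / qpow q w \<noteq> 0" using Q0 by simp
  define e where "e = (\<lambda>a. (1 / h\<^sup>2) ^ pos a)"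
  interpret explicit_braiding "heckeR pos h" "heckeRi pos h" "dualRs (heckeR pos h)" "dualRs (heckeRi pos h)"
    "dualK (heckeR pos h)" "dualM pos h" e "h\<^sup>2" r q V "qpow q w"
    unfolding explicit_braiding_def explicit_braiding_axioms_def e_def
    using heckeR_braided_legs[OF h0 bij] Q0 bVV bdd bVd by (simp add: qpow_minus)
  have wt': "qpow q (wform r (wt a) (two_rho r)) = qpow q m * e a" for a using wt by (simp add: e_def)
  have sr: "s \<in> {1..r}" using assms(1,4) by auto
  have a2: "qpow q a = h\<^sup>2" "qpow q (- a) = 1 / h\<^sup>2"
    using assms(2) qpow_2[OF assms(2)] by (simp_all add: a_def cartan_entry[OF sr sr] qpow_minus h_def)

  note cal = assms(9)[unfolded is_quantum_projective_calculus_def linear_clin]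
  note fodc = cal[THEN conjunct2, THEN conjunct1, unfolded is_fodc_def Let_def, folded a_def w_def]
  have bim: "bimodule (lmul C) (rmul C)" by (rule fodc[THEN conjunct1])
  have la: "clin (\<lambda>b. lmul C b z)" "lmul C 1 z = z" and lac: "clin (lmul C b)" for b z
    using bim unfolding bimodule_def linear_clin by auto
  obtain Mp Mm where Mp: "presented_left_module (lmul C) Mp (case_prod (dp C))
          (Omega_relators r q wt (pgen C) (tildeS234 r q V) (qpow q (- w)))"
    and Mm: "presented_left_module (lmul C) Mm (case_prod (dbp C))
          (Omega_relators r q wt (pgen C) (S123 r q V) (qpow q w))"
    and dec: "\<forall>x. \<exists>y\<in>Mp. \<exists>z\<in>Mm. x = y + z"
    using fodc[THEN conjunct2, THEN conjunct1] by (elim exE conjE) (rule that)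
  note fodc' = fodc[THEN conjunct2, THEN conjunct2]
  have rmul_p: "rmul C (dp C i j) (pgen C k l) = h\<^sup>2 *\<^sub>C T1234 r q V (fam2 (lmul C) (pgen C) (dp C)) [i, j, k, l]"
    "rmul C (dbp C i j) (pgen C k l) = (1 / h\<^sup>2) *\<^sub>C T1234 r q V (fam2 (lmul C) (pgen C) (dbp C)) [i, j, k, l]" for i j k l
    using fodc'[THEN conjunct1] fodc'[THEN conjunct2, THEN conjunct1] unfolding a2 by blast+
  note der = fodc'[THEN conjunct2, THEN conjunct2, THEN conjunct1] fodc'[THEN conjunct2, THEN conjunct2, THEN conjunct2]
  note cal' = cal[THEN conjunct2, THEN conjunct2]
  note tp = cal'[THEN conjunct1] and wlin = cal'[THEN conjunct2, THEN conjunct1]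
    and wsurj = cal'[THEN conjunct2, THEN conjunct2, THEN conjunct1]
    and wker = cal'[THEN conjunct2, THEN conjunct2, THEN conjunct2, THEN conjunct1]
    and wtp = cal'[THEN conjunct2, THEN conjunct2, THEN conjunct2, THEN conjunct2]
  have tr_x: "ctr (Suc 0) e (W1 (dp C)) = (\<lambda>f. 0)" by (rule form_trace[OF la Mp wt' M0])
  have tr_y: "ctr (Suc 0) e (W1 (dbp C)) = (\<lambda>f. 0)" by (rule form_trace[OF la Mm wt' M0])
  have E: "clin (module_eval (lmul C) (case_prod (dp C)))" "clin (module_eval (lmul C) (case_prod (dbp C)))"
    by (rule clin_module_eval[OF la(1)])+
  \<comment> \<open>the scalar \<open>q\<^sup>w\<close> cancels; composing with \<open>K\<close> and then with \<open>dualRs R\<close> removes the inverses in the relation\<close>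
  have sym_x: "opL (Suc (Suc (Suc 0))) (dualRs (heckeR pos h)) (opL (Suc (Suc 0)) (dualK (heckeR pos h)) (W2 (lmul C) (pgen C) (dp C)))
      = opL (Suc (Suc 0)) (dualK (heckeR pos h)) (W2 (lmul C) (pgen C) (dp C))"
  proof -
    let ?W = "W2 (lmul C) (pgen C) (dp C)"
    have eq: "(1 / qpow q w) *\<^sub>C opL (Suc (Suc 0)) (dualM pos h) (opL (Suc (Suc (Suc 0))) (dualRs (heckeRi pos h)) (opL (Suc (Suc 0)) (dualK (heckeR pos h)) ?W)) f
      = qpow q (- w) *\<^sub>C ?W f" for f
    proof -
      let ?L = "\<lambda>z f. (1 / qpow q w) *\<^sub>C opL (Suc (Suc 0)) (dualM pos h) (opL (Suc (Suc (Suc 0))) (dualRs (heckeRi pos h)) (opL (Suc (Suc 0)) (dualK (heckeR pos h)) z)) f"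
      have L: "lf 4 (tildeS234 r q V z) f = ?L (lf 4 z) f" for z :: "'n list \<Rightarrow> ('n \<times> 'n) \<Rightarrow>\<^sub>0 'b" and f
        by (simp add: lf_tS)
      show ?thesis
        using form_sym[where L = ?L and f = f, OF la Mp wt' M0 L]
        by (simp add: clin_scale[OF E(1)] clin_opL[OF E(1)] form_word[OF la Mp wt' M0])
    qed
    have "opL (Suc (Suc 0)) (dualM pos h) (opL (Suc (Suc (Suc 0))) (dualRs (heckeRi pos h)) (opL (Suc (Suc 0)) (dualK (heckeR pos h)) ?W)) = ?W"
      by (rule ext, rule scaleC_cancel[OF Q0' eq[unfolded qpow_minus]])
    from arg_cong[OF this, of "opL (Suc (Suc 0)) (dualK (heckeR pos h))"]
    have "opL (Suc (Suc (Suc 0))) (dualRs (heckeRi pos h)) (opL (Suc (Suc 0)) (dualK (heckeR pos h)) ?W) = opL (Suc (Suc 0)) (dualK (heckeR pos h)) ?W"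
      by simp
    from arg_cong[OF this, of "opL (Suc (Suc (Suc 0))) (dualRs (heckeR pos h))"] show ?thesis by simp
  qed
  have sym_y: "opL (Suc 0) (heckeR pos h) (opL (Suc (Suc 0)) (dualK (heckeR pos h)) (W2 (lmul C) (pgen C) (dbp C)))
      = opL (Suc (Suc 0)) (dualK (heckeR pos h)) (W2 (lmul C) (pgen C) (dbp C))"
  proof -
    let ?W = "W2 (lmul C) (pgen C) (dbp C)"
    have eq: "qpow q w *\<^sub>C opL (Suc (Suc 0)) (dualM pos h) (opL (Suc 0) (heckeR pos h) (opL (Suc (Suc 0)) (dualK (heckeR pos h)) ?W)) f
      = qpow q w *\<^sub>C ?W f" for f
    proof -
      let ?L = "\<lambda>z f. qpow q w *\<^sub>C opL (Suc (Suc 0)) (dualM pos h) (opL (Suc 0) (heckeR pos h) (opL (Suc (Suc 0)) (dualK (heckeR pos h)) z)) f"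
      have L: "lf 4 (S123 r q V z) f = ?L (lf 4 z) f" for z :: "'n list \<Rightarrow> ('n \<times> 'n) \<Rightarrow>\<^sub>0 'b" and f
        by (simp add: lf_S)
      show ?thesis
        using form_sym[where L = ?L and f = f, OF la Mm wt' M0 L]
        by (simp add: clin_scale[OF E(2)] clin_opL[OF E(2)] form_word[OF la Mm wt' M0])
    qed
    have "opL (Suc (Suc 0)) (dualM pos h) (opL (Suc 0) (heckeR pos h) (opL (Suc (Suc 0)) (dualK (heckeR pos h)) ?W)) = ?W"
      by (rule ext, rule scaleC_cancel[OF Q0 eq])
    from arg_cong[OF this, of "opL (Suc (Suc 0)) (dualK (heckeR pos h))"] show ?thesis by simp
  qed
  have tr_p: "ctr (Suc 0) e (W1 (pgen C)) = (\<lambda>f. 1)"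
  proof (rule ext)
    fix f :: "nat \<Rightarrow> 'n"
    let ?P = "\<lambda>i j. Poly_Mapping.single (Word [(i, j)]) (1::complex)" and ?E = "alg_eval (case_prod (pgen C))"
    have E: "clin ?E" unfolding alg_eval_def by (rule clin_free_eval)
    have "contract 1 (evE' r q wt) (fam1 ?P) [] - qpow q m *\<^sub>C 1 \<in> B_relators r s q V wt"
      by (simp add: B_relators_def Let_def m_def)
    from presented_algebra_relator[OF cal[THEN conjunct1] this]
    have z: "?E (lf 0 (contract 1 (evE' r q wt) (fam1 ?P)) f) = qpow q m *\<^sub>C 1"
      by (simp add: lf_def clin_diff[OF E] clin_scale[OF E] alg_eval_1)
    have c: "lf 0 (contract 1 (evE' r q wt) (fam1 ?P)) = ctr 1 (\<lambda>a. qpow q m * e a) (lf (Suc (Suc 0)) (fam1 ?P))"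
      by (rule lf_contract) (auto simp: evE'_def wt')
    have l: "lf (Suc (Suc 0)) (fam1 ?P) = W1 ?P" using lf_fam(1)[of ?P] by (simp add: numeral_2_eq_2)
    have "?E (ctr (Suc 0) (\<lambda>a. qpow q m * e a) (W1 ?P) f) = qpow q m *\<^sub>C 1" using z unfolding c l by simp
    then have A: "qpow q m *\<^sub>C ctr (Suc 0) e (\<lambda>f. ?E (W1 ?P f)) f = qpow q m *\<^sub>C 1"
      by (simp add: ctr_weight_scale clin_scale[OF E] ctr_const[OF E])
    have B: "(\<lambda>f. ?E (W1 ?P f)) = W1 (pgen C)" by (simp add: fun_eq_iff W1_def alg_eval_letter)
    show "ctr (Suc 0) e (W1 (pgen C)) f = 1" by (rule scaleC_cancel[OF M0 A[unfolded B]])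
  qed
  \<comment> \<open>turns an identity for all entries of a four-leg word into one for tensors\<close>
  have word4: "W2 g u v f = z" if "\<And>i j k l. g (u i j) (v k l) = c *\<^sub>C T1234 r q V (fam2 g' u' v') [i, j, k, l]"
     "c *\<^sub>C TL (Suc 0) (W2 g' u' v') f = z" for g :: "'x \<Rightarrow> 'y \<Rightarrow> 'o" and u v f z c and g' :: "'p \<Rightarrow> 'r \<Rightarrow> 'o" and u' v'
  proof -
    have "W2 g u v f = c *\<^sub>C lf 4 (T1234 r q V (fam2 g' u' v')) f"
      unfolding W2_def W1_def sh_def lf_def upt_numeral list.map by (rule that(1))
    then show ?thesis using that(2) by (simp add: lf_T lf_fam)
  qed
  have xp: "W2 (rmul C) (dp C) (pgen C) = (\<lambda>f. h\<^sup>2 *\<^sub>C TL (Suc 0) (W2 (lmul C) (pgen C) (dp C)) f)"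
    by (rule ext, rule word4[OF rmul_p(1) refl])
  have yp: "W2 (rmul C) (dbp C) (pgen C) = (\<lambda>f. (1 / h\<^sup>2) *\<^sub>C TL (Suc 0) (W2 (lmul C) (pgen C) (dbp C)) f)"
    by (rule ext, rule word4[OF rmul_p(2) refl])
  \<comment> \<open>every one-form is a sum of left multiples of \<open>\<partial>p\<close> and \<open>\<partial>'p\<close>\<close>
  have gen: "P z" if "\<And>u v. P u \<Longrightarrow> P v \<Longrightarrow> P (u + v)" "P 0" "\<And>b u. P u \<Longrightarrow> P (lmul C b u)"
       "\<And>i j. P (dp C i j)" "\<And>i j. P (dbp C i j)" for P z
  proof -
    have sum: "P (sum g S)" if "\<And>i. P (g i)" for g :: "'n \<times> 'n \<Rightarrow> 'o" and S
      using that \<open>P 0\<close> by (induction S rule: infinite_finite_induct) (auto intro: \<open>\<And>u v. P u \<Longrightarrow> P v \<Longrightarrow> P (u + v)\<close>)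
    have "P z" if "z \<in> Mp" for z
      using that Mp \<open>\<And>i j. P (dp C i j)\<close> unfolding presented_left_module_def module_eval_def
      by (auto intro!: sum \<open>\<And>b u. P u \<Longrightarrow> P (lmul C b u)\<close>)
    moreover have "P z" if "z \<in> Mm" for z
      using that Mm \<open>\<And>i j. P (dbp C i j)\<close> unfolding presented_left_module_def module_eval_def
      by (auto intro!: sum \<open>\<And>b u. P u \<Longrightarrow> P (lmul C b u)\<close>)
    ultimately show ?thesis using dec that(1) by metis
  qed
  interpret qproj "heckeR pos h" "heckeRi pos h" "dualRs (heckeR pos h)" "dualRs (heckeRi pos h)"
    "dualK (heckeR pos h)" "dualM pos h" e "h\<^sup>2" C
    by unfold_locales (fact bim der tp wlin wsurj wker wtp gen sym_x sym_y tr_p tr_x tr_y xp yp)+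

  have g: "contract 1 (evE' r q wt) (contract 2 evE (fam2 (tens C) u v)) [] = qpow q m *\<^sub>C G u v" for u v
  proof -
    have "contract 1 (evE' r q wt) (contract 2 evE (fam2 (tens C) u v)) [] = lf 0 (contract 1 (evE' r q wt) (contract 2 evE (fam2 (tens C) u v))) (\<lambda>_. undefined)"
      by (simp add: lf_def)
    also have "lf 0 (contract 1 (evE' r q wt) (contract 2 evE (fam2 (tens C) u v))) = ctr 1 (\<lambda>a. qpow q m * e a) (lf (Suc (Suc 0)) (contract 2 evE (fam2 (tens C) u v)))"
      by (rule lf_contract) (auto simp: evE'_def wt')
    also have "lf (Suc (Suc 0)) (contract 2 evE (fam2 (tens C) u v)) = ctr 2 (\<lambda>_. 1) (lf (Suc (Suc (Suc (Suc 0)))) (fam2 (tens C) u v))"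
      by (rule lf_contract) (auto simp: evE_def)
    also have "lf (Suc (Suc (Suc (Suc 0)))) (fam2 (tens C) u v) = W2 (tens C) u v"
      using lf_fam(2)[of "tens C" u v] by (simp add: numeral_eq_Suc)
    also have "ctr 2 (\<lambda>_. 1) (W2 (tens C) u v) = mulL (Suc 0) (W2 (tens C) u v)" by (simp add: mulL_def numeral_2_eq_2)
    finally show ?thesis by (simp add: ctr_weight_scale tr_mul_W2)
  qed
  have gmp: "g_mp r q wt C = qpow q m *\<^sub>C G (dbp C) (dp C)" and gpm: "g_pm r q wt C = qpow q m *\<^sub>C G (dp C) (dbp C)"
    by (simp_all only: g_mp_def g_pm_def g)
  have con: "lf n (contract 2 evE z) = mulL (Suc 0) (lf (Suc (Suc n)) z)" if "n \<ge> 1" for n and z :: "'n list \<Rightarrow> 'z::complex_vector"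
    using lf_contract[of 2 n evE "\<lambda>_. 1" z] that by (simp add: mulL_def numeral_2_eq_2 evE_def)
  have ET: "contract 2 evE (T1234 r q V z) (map f [1..<Suc 2]) = mulL (Suc 0) (TL (Suc 0) (lf 4 z)) f" for z :: "'n list \<Rightarrow> 'z::complex_vector" and f
    using con[of 2 "T1234 r q V z"] lf_T[of 4 z] unfolding lf_def by (simp add: fun_eq_iff numeral_eq_Suc del: upt_Suc)
  have co4: "lf 4 (contract 2 evE z) = mulL (Suc 0) (lf 6 z)" for z :: "'n list \<Rightarrow> 'z::complex_vector"
    using con[of 4 z] by simp

  note lc = assms(10)[unfolded is_levi_civita_def Let_def linear_clin, folded a_def m_def]
  have nlin: "clin nab" and nleib: "\<And>b z. nab (lmul C b z) = tens C (dif C b) z + tlmul C b (nab z)"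
    using lc by blast+
  have W1_list: "W1 u f = u i j" "map f [1..<Suc 2] = [i, j]" if "f = (\<lambda>k. if k = Suc 0 then i else j)" for u :: "'n \<Rightarrow> 'n \<Rightarrow> 'z" and f i j
    unfolding upt_numeral using that by (simp_all add: W1_def)
  have nab_x: "nab (W1 (dp C) f) = h\<^sup>2 *\<^sub>C mulL (Suc 0) (TL (Suc 0) (W2 (tens C) (dbp C) (dp C))) f
      - h\<^sup>2 *\<^sub>C tlmul C (W1 (pgen C) f) (G (dbp C) (dp C))" for f
  proof -
    have "nab (W1 (dp C) f) = qpow q a *\<^sub>C contract 2 evE (T1234 r q V (fam2 (tens C) (dbp C) (dp C))) (map f [1..<Suc 2])
        - (qpow q a * qpow q (- m)) *\<^sub>C tlmul C (W1 (pgen C) f) (g_mp r q wt C)"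
      unfolding upt_numeral list.map W1_def using lc by blast
    then show ?thesis
      unfolding ET lf_fam gmp a2 using M0
      by (simp add: clin_scale[OF tlmul_clin] scaleC_scaleC qpow_minus)
  qed
  have fam: "lf 6 (fam3 (\<lambda>x y z. wtens C (wedge C x y) z) u v z) = Wd3 u v z" for u v z
    unfolding lf_fam by (simp add: fun_eq_iff Wd3_def W2_def)
  show ?thesis
  proof (intro allI)
    fix i j :: 'n
    define f where "f = (\<lambda>k. if k = Suc 0 then i else j)"
    note f = W1_list[OF f_def]
    have 1: "(h\<^sup>2 * qpow q (- m)) *\<^sub>C wedge_id C (dp C i j) (g_mp r q wt C) = h\<^sup>2 *\<^sub>C wedge_id C (W1 (dp C) f) (G (dbp C) (dp C))"
      using M0 by (simp add: f gmp clin_scale[OF wid_clin] scaleC_scaleC qpow_minus)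
    have 2: "((1 - 1 / h\<^sup>2) * qpow q (- m)) *\<^sub>C wtens C (wedge_map C (g_pm r q wt C)) (dp C i j) =
        (1 - 1 / h\<^sup>2) *\<^sub>C wtens C (wedge_map C (G (dp C) (dbp C))) (W1 (dp C) f)"
      using M0 by (simp add: f gpm clin_scale[OF wlin] clin_scale[OF wt_clin(1)] scaleC_scaleC qpow_minus)
    have 3: "contract 2 evE (T1234 r q V (contract 2 evE (fam3 (\<lambda>x y z. wtens C (wedge C x y) z) u v z))) [i, j] =
        mulL (Suc 0) (TL (Suc 0) (mulL (Suc 0) (Wd3 u v z))) f" for u v z
      unfolding f(2)[symmetric] ET co4 fam ..
    have 4: "contract 2 evE (T1234 r q V (contract 2 evE (T1234_inv r q V (fam3 (\<lambda>x y z. wtens C (wedge C x y) z) u v z)))) [i, j] =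
        mulL (Suc 0) (TL (Suc 0) (mulL (Suc 0) (TiL (Suc 0) (Wd3 u v z)))) f" for u v z
      unfolding f(2)[symmetric] ET co4 by (simp add: lf_Ti fam)
    show "let a = wform r (simple_root s) (simple_root s);
         m = wform r (fundamental_weight r s) (two_rho r);
         E23 = contract 2 evE;
         T = T1234 r q V; T_inv = T1234_inv r q V;
         w3 = (\<lambda>x y z. wtens C (wedge C x y) z)
     in
       riemann C nab (dp C i j) =
         qpow q a *\<^sub>C E23 (T (E23 (fam3 w3 (dp C) (dbp C) (dp C)))) [i, j]
         + qpow q a *\<^sub>C E23 (T (E23 (fam3 w3 (dbp C) (dp C) (dp C)))) [i, j]
         - (qpow q a * qpow q (- m)) *\<^sub>C wedge_id C (dp C i j) (g_mp r q wt C)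
     \<and> riemann C nab (dp C i j) =
         qpow q a *\<^sub>C E23 (T (E23 (fam3 w3 (dp C) (dbp C) (dp C)))) [i, j]
         - E23 (T (E23 (T_inv (fam3 w3 (dp C) (dbp C) (dp C))))) [i, j]
         - ((1 - qpow q (- a)) * qpow q (- m)) *\<^sub>C wtens C (wedge_map C (g_pm r q wt C)) (dp C i j)
         - (qpow q a * qpow q (- m)) *\<^sub>C wedge_id C (dp C i j) (g_mp r q wt C)"
      unfolding Let_def a_def[symmetric] m_def[symmetric] a2 1 2 3 4
      using riemann_x[OF nlin nleib nab_x, of f] riemann_x'[OF nlin nleib nab_x, of f] unfolding f(1) by blast
  qed
qed

end
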